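(* Let $n,p$ be positive integers and let $\alpha,\beta\in\mathbb{R}$ with $n+\alpha>0$ and $\beta>-1$. For $x,y\in\widehat{B}_p$ the polyharmonic weighted Bergman kernel is given by $$R_{p,\alpha,\beta}(x,y)=\frac{2}{n\Gamma(\beta+1)\Omega_n}D^{\beta+1}\left(t^{\frac{n+\alpha}{2}+\beta }P_p(tx,y)\right)\Big|_{t=1},$$ where $D^{\beta+1}$ is the Riemann–Liouville fractional derivative of order $\beta+1$ in the variable $t$ and $P_p$ is the extended polyharmonic Poisson kernel.
   Context: Notation: for complex vectors $z,w\in\mathbb{C}^n$, $zw=\sum_j z_jw_j$ (bilinear), $\overline{y}$ is the componentwise conjugate, and $|z|=(\sum_j z_j^2)^{1/2}$ is the complex extension of the Euclidean norm (principal square root), so $|x|^{2k}=(\sum_jx_j^2)^k$ and $|\overline{y}|^{2k}=(\sum_j\overline{y_j}^2)^k$. Non-integer powers are principal branches. Sets: $B$ is the open unit ball of $\mathbb{R}^n$ centred at $0$ and $\widehat{B}_p=\bigcup_{k=0}^{p-1}e^{k\pi i/p}B\subset\mathbb{C}^n$. $\Omega_n=\pi^{n/2}/\Gamma(n/2+1)$ is the volume of $B$. Polyharmonic functions: a complex-valued analytic function $u$ on $B$ is polyharmonic of order $p$ if $\Delta^p u=0$ on $B$; the space of these is $\mathcal{A}_{\Delta^p}(B)$. Each such $u$ has an expansion $u=\sum_{m\ge 0} q_m$ into homogeneous polynomials $q_m$ of degree $m$, converging on $B$, and is extended holomorphically to rotated balls by $u(e^{i\psi}x)=\sum_m e^{im\psi}q_m(x)$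 ($\psi\in\mathbb{R}$, $x\in B$). In this way $u$ is regarded as a function on $\widehat{B}_p$. Weighted Bergman space: $b_{p,\alpha,\beta}^2(\widehat{B}_p)$ is the space of $u\in\mathcal{A}_{\Delta^p}(B)$ (extended to $\widehat{B}_p$) with $\langle u,u\rangle_{b_{p,\alpha,\beta}^2}<\infty$, where $\langle u,v\rangle_{b_{p,\alpha,\beta}^2}=\frac1p\sum_{k=0}^{p-1}\int_B u(e^{k\pi i/p}y)\overline{v(e^{k\pi i/p}y)}\,|y|^\alpha(1-|y|^2)^\beta dy$. It is a Hilbert space on which point evaluations at points of $\widehat{B}_p$ are bounded. Weighted Bergman kernel: for each $x\in\widehat{B}_p$, $R_{p,\alpha,\beta}(x,\cdot)\in b_{p,\alpha,\beta}^2(\widehat{B}_p)$ is the function given by the Riesz theorem such that $u(x)=\langle u,R_{p,\alpha,\beta}(x,\cdot)\rangle_{b_{p,\alpha,\beta}^2}=\frac1p\sum_{k=0}^{p-1}\int_B u(e^{k\pi i/p}y)\overline{R_{p,\alpha,\beta}(x,e^{k\pi i/p}y)}\,|y|^\alpha(1-|y|^2)^\beta dy$ for all $u\in b_{p,\alpha,\beta}^2(\widehat{B}_p)$. The extended polyharmonic Poisson kernel is $P_p(x,y)=\dfrac{1-|x|^{2p}|\overline{y}|^{2p}}{(1-2x\overline{y}+|x|^2|\overline{y}|^2)^{n/2}}$ for $x,y\in\widehat{B}_p$. Fractional derivatives: for $l>0$ and $u\in L^1(0,1)$, $D^{-l}u(t)=\frac{1}{\Gamma(l)}\int_0^t\frac{u(\tau)}{(t-\tau)^{1-l}}\,d\tau$,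 and $D^0u=u$; for $l>0$, $D^lu(t)=\frac{d^j}{dt^j}\left(D^{-(j-l)}u(t)\right)$, where $j$ is an integer with $j-1\le l\le j$.
   Formalization: The formula is proved for the complex conjugate of R(x,y): with R(x,·) in the Bergman space and u(x)=⟨u,R(x,·)⟩, the printed formula fails for p≥2 (e.g. n=1, p=2, α=β=0, x=1/2, y=i/2) and holds as printed where the right-hand side is real. *)

theory Defs
  imports "HOL-Analysis.Analysis"
begin

section \<open>Polyharmonic functions on the unit ball\<close>

text \<open>Multi-indices are functions \<open>k :: 'n \<Rightarrow> nat\<close>; this is the monomial \<open>x\<^sup>k\<close>.\<close>

definition monomial :: "('n::finite \<Rightarrow> nat) \<Rightarrow> real^'n \<Rightarrow> real" where
  "monomial k x = (\<Prod>j\<in>UNIV. (x $ j) ^ k j)"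

definition real_analytic_on :: "(real^'n::finite \<Rightarrow> complex) \<Rightarrow> (real^'n) set \<Rightarrow> bool" where
  "real_analytic_on u S \<longleftrightarrow>
     (\<forall>a\<in>S. \<exists>r>0. \<exists>c :: ('n \<Rightarrow> nat) \<Rightarrow> complex. \<forall>x\<in>ball a r.
        ((\<lambda>k. c k * complex_of_real (monomial k (x - a))) has_sum u x) UNIV)"

definition partial_deriv :: "'n \<Rightarrow> (real^'n::finite \<Rightarrow> complex) \<Rightarrow> real^'n \<Rightarrow> complex" where
  "partial_deriv j u x = vector_derivative (\<lambda>t. u (x + t *\<^sub>R axis j 1)) (at 0)"

definition laplacian :: "(real^'n::finite \<Rightarrow> complex) \<Rightarrow> real^'n \<Rightarrow> complex" where
  "laplacian u x = (\<Sum>j\<in>UNIV. partial_deriv j (partial_deriv j u) x)"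

definition polyharmonic_on_ball :: "nat \<Rightarrow> (real^'n::finite \<Rightarrow> complex) \<Rightarrow> bool" where
  "polyharmonic_on_ball p u \<longleftrightarrow>
     real_analytic_on u (ball 0 1) \<and> (\<forall>x\<in>ball 0 1. (laplacian ^^ p) u x = 0)"

definition homogeneous_polynomial :: "nat \<Rightarrow> (real^'n::finite \<Rightarrow> complex) \<Rightarrow> bool" where
  "homogeneous_polynomial m q \<longleftrightarrow>
     (\<exists>c :: ('n \<Rightarrow> nat) \<Rightarrow> complex. \<forall>x.
        q x = (\<Sum>k | sum k UNIV = m. c k * complex_of_real (monomial k x)))"


section \<open>Rotated balls and holomorphic extension\<close>

definition rot :: "real \<Rightarrow> real^'n::finite \<Rightarrow> complex^'n" where
  "rot \<psi> x = (\<chi> j. cis \<psi> * complex_of_real (x $ j))"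

definition rotated_balls :: "nat \<Rightarrow> (complex^'n::finite) set" where
  "rotated_balls p = (\<Union>k<p. rot (real k * pi / real p) ` ball 0 1)"

text \<open>
  \<open>U\<close> is the extension of \<open>u\<close> to the rotated balls, given by
  \<open>U (e\<^sup>i\<^sup>\<psi> x) = (\<Sum>m. e\<^sup>i\<^sup>m\<^sup>\<psi> q\<^sub>m(x))\<close>. Values of \<open>U\<close> elsewhere are unconstrained.
\<close>

definition extends_to_rotated_balls ::
    "nat \<Rightarrow> (real^'n::finite \<Rightarrow> complex) \<Rightarrow> (complex^'n \<Rightarrow> complex) \<Rightarrow> bool" where
  "extends_to_rotated_balls p u U \<longleftrightarrow>
     (\<exists>q. (\<forall>m. homogeneous_polynomial m (q m)) \<and>
          (\<forall>x\<in>ball 0 1. (\<lambda>m. q m x) sums u x) \<and>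
          (\<forall>\<psi>. \<forall>x\<in>ball 0 1. rot \<psi> x \<in> rotated_balls p \<longrightarrow>
             (\<lambda>m. cis (real m * \<psi>) * q m x) sums U (rot \<psi> x)))"


section \<open>The weighted Bergman space and its kernel\<close>

definition bergman_weight :: "real \<Rightarrow> real \<Rightarrow> real^'n::finite \<Rightarrow> real" where
  "bergman_weight \<alpha> \<beta> y = norm y powr \<alpha> * (1 - (norm y)\<^sup>2) powr \<beta>"

definition bergman_inner ::
    "nat \<Rightarrow> real \<Rightarrow> real \<Rightarrow> (complex^'n::finite \<Rightarrow> complex) \<Rightarrow> (complex^'n \<Rightarrow> complex) \<Rightarrow> complex" where
  "bergman_inner p \<alpha> \<beta> U V =
     1 / of_nat p * (\<Sum>k<p. LINT y:ball 0 1|lborel.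
        U (rot (real k * pi / real p) y) * cnj (V (rot (real k * pi / real p) y))
          * complex_of_real (bergman_weight \<alpha> \<beta> y))"

text \<open>
  Finiteness of \<open>\<langle>U, U\<rangle>\<close> is expressed by integrability of each of its nonnegative summands,
  since the Bochner integral of a non-integrable function is \<open>0\<close>.
\<close>

definition bergman_space :: "nat \<Rightarrow> real \<Rightarrow> real \<Rightarrow> (complex^'n::finite \<Rightarrow> complex) set" where
  "bergman_space p \<alpha> \<beta> =
     {U. (\<exists>u. polyharmonic_on_ball p u \<and> extends_to_rotated_balls p u U) \<and>
         (\<forall>k<p. set_integrable lborel (ball 0 1)
            (\<lambda>y. (cmod (U (rot (real k * pi / real p) y)))\<^sup>2 * bergman_weight \<alpha> \<beta> y))}"

text \<open>
  \<open>R x\<close> represents evaluation at \<open>x\<close>. As \<open>R x\<close> belongs to the Bergman space, \<open>R x y\<close> is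
  holomorphic in \<open>y\<close>, hence antiholomorphic in \<open>x\<close>; the extended Poisson kernel below has the
  opposite dependence. So a closed form in terms of that kernel is one for \<open>cnj (R x y)\<close>, the
  function of \<open>y\<close> against which \<open>u\<close> is integrated in the reproducing formula. For example,
  if \<open>n = 1\<close>, \<open>p = 2\<close>, \<open>\<alpha> = \<beta> = 0\<close>, then \<open>R x y = (\<Sum>m<4. (2 * m + 1) / 2 * (cnj x * y) ^ m)\<close>.
\<close>

definition is_bergman_kernel ::
    "nat \<Rightarrow> real \<Rightarrow> real \<Rightarrow> (complex^'n::finite \<Rightarrow> complex^'n \<Rightarrow> complex) \<Rightarrow> bool" where
  "is_bergman_kernel p \<alpha> \<beta> R \<longleftrightarrow>
     (\<forall>x\<in>rotated_balls p. R x \<in> bergman_space p \<alpha> \<beta> \<and>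
        (\<forall>U\<in>bergman_space p \<alpha> \<beta>. U x = bergman_inner p \<alpha> \<beta> U (R x)))"


section \<open>The extended polyharmonic Poisson kernel\<close>

definition cdot :: "complex^'n::finite \<Rightarrow> complex^'n \<Rightarrow> complex" where
  "cdot z w = (\<Sum>j\<in>UNIV. z $ j * w $ j)"

definition cnj_vec :: "complex^'n::finite \<Rightarrow> complex^'n" where
  "cnj_vec y = (\<chi> j. cnj (y $ j))"

text \<open>Here \<open>|z|\<^sup>2\<close> is the bilinear \<open>cdot z z\<close>, not the Hermitian norm; \<open>powr\<close> is the principal branch.\<close>

definition poisson_kernel :: "nat \<Rightarrow> complex^'n::finite \<Rightarrow> complex^'n \<Rightarrow> complex" where
  "poisson_kernel p x y =
     (1 - cdot x x ^ p * cdot (cnj_vec y) (cnj_vec y) ^ p) /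
     (1 - 2 * cdot x (cnj_vec y) + cdot x x * cdot (cnj_vec y) (cnj_vec y))
        powr (of_nat CARD('n) / 2)"


section \<open>Riemann--Liouville fractional derivatives\<close>

text \<open>\<open>rl_integral l\<close> is \<open>D\<^sup>-\<^sup>l\<close> for \<open>l \<ge> 0\<close>.\<close>

definition rl_integral :: "real \<Rightarrow> (real \<Rightarrow> complex) \<Rightarrow> real \<Rightarrow> complex" where
  "rl_integral l u t =
     (if l = 0 then u t
      else complex_of_real (1 / Gamma l) *
        (LINT \<tau>:{0<..<t}|lborel. u \<tau> / complex_of_real ((t - \<tau>) powr (1 - l))))"

text \<open>
  \<open>rl_deriv j l\<close> is \<open>D\<^sup>l\<close> for \<open>l > 0\<close>, computed with an integer \<open>j\<close> such that \<open>j - 1 \<le> l \<le> j\<close>;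
  for integral \<open>l\<close> there are two such \<open>j\<close>.
\<close>

definition rl_deriv :: "nat \<Rightarrow> real \<Rightarrow> (real \<Rightarrow> complex) \<Rightarrow> real \<Rightarrow> complex" where
  "rl_deriv j l u =
     ((\<lambda>f t. vector_derivative f (at t)) ^^ j) (rl_integral (real j - l) u)"

end

theory Submission
  imports Defs "HOL-Complex_Analysis.Complex_Analysis"
begin

text \<open>
  The kernel is determined by testing it against one homogeneous function for each degree \<open>m\<close>. Fix \<open>y\<close>. For every
  \<open>m\<close> there is a homogeneous polyharmonic polynomial \<open>K\<^sub>m = kernel_part p \<alpha> \<beta> m y\<close> of degree
  \<open>m\<close> whose pairing with any \<open>U\<close> in the Bergman space is the degree-\<open>m\<close> part of \<open>U\<close> at
  \<open>y\<close> (\<open>bergman_inner_kernel\<close>). Since \<open>K\<^sub>m\<close> itself lies in the space, the reproducing property at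
  \<open>x\<close> gives \<open>K\<^sub>m(x) = \<langle>K\<^sub>m, R x\<rangle>\<close>, the conjugate of the degree-\<open>m\<close> part of
  \<open>R x\<close> at \<open>y\<close>. Summation over \<open>m\<close> yields \<open>cnj (R x y) = (\<Sum>m. K\<^sub>m(x))\<close>, and this
  series is the right-hand side.

  Write \<open>n\<close> for the dimension. Up to a radial constant, \<open>K\<^sub>m\<close> is the coefficient of \<open>t\<^sup>m\<close> in the
  Poisson kernel \<open>P\<^sub>p(t x, y)\<close> (\<open>pzonal\<close>, \<open>pzonal_generating\<close>). For \<open>p = 1\<close> these
  coefficients are the zonal harmonics: they are harmonic, and integration against them over the sphere evaluates spherical harmonics of the same
  degree (\<open>zonal_harmonic\<close>, \<open>zonal_reproducing\<close>). For general \<open>p\<close>, the factor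
  \<open>1 - (|x|\<^sup>2|y|\<^sup>2)\<^sup>p\<close> is \<open>1 - |x|\<^sup>2|y|\<^sup>2\<close> times a geometric sum, so the coefficient of
  degree \<open>m\<close> is a sum of \<open>|x|\<^sup>2\<^sup>k|y|\<^sup>2\<^sup>k\<close> times zonal harmonics of degree \<open>m - 2k\<close>,
  \<open>k < p\<close>, which matches the Almansi decomposition of a polyharmonic polynomial of degree \<open>m\<close>
  (\<open>almansi_decomposition\<close>, \<open>pzonal_pairing\<close>).

  Two mechanisms separate the degrees \<open>l\<close> of \<open>U\<close> from \<open>m\<close>. On the sphere, components of different degree are
  orthogonal, so degree \<open>l\<close> contributes only if \<open>l - 2j = m - 2k\<close> for some \<open>j, k < p\<close>. For such
  \<open>l \<noteq> m\<close>, the average over the \<open>p\<close> rotated balls is a full sum of powers of the nontrivial \<open>p\<close>-th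
  root of unity \<open>exp (2 \<pi> \<i> (j - k) / p)\<close> and vanishes (\<open>root_of_unity_sum\<close>). For \<open>l = m\<close> what
  remains is the value at \<open>y\<close> times the surface area and the radial moment \<open>B((n+\<alpha>)/2 + m, \<beta>+1) / 2\<close>; the
  constant in \<open>K\<^sub>m\<close> is the reciprocal of their product. The fractional derivative multiplies \<open>t\<close> to the power
  \<open>(n+\<alpha>)/2 + \<beta> + m\<close> by
  \<open>\<Gamma>((n+\<alpha>)/2 + m + \<beta> + 1) / \<Gamma>((n+\<alpha>)/2 + m)\<close> at \<open>t = 1\<close>, the same constant up
  to the factor in front of the derivative (\<open>rl_deriv_power_series\<close>, \<open>kernel_weight_Gamma\<close>).

  The analytic difficulty is that the homogeneous expansion of \<open>U\<close> is only known to converge pointwise, while the pairing needs termwise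
  integration. This is settled by the growth estimate \<open>|q\<^sub>m(x)| \<le> M s\<^sup>-\<^sup>m\<close> on the unit ball, for every
  \<open>s < 1\<close> (\<open>coefficient_growth\<close>). The integral of \<open>u\<close> against a zonal harmonic on a ball of radius
  \<open>\<rho>\<close> involves only finitely many degrees, and termwise integration of such an integral follows by analytic continuation in a
  dilation parameter (\<open>termwise_integral\<close>). As a function of \<open>\<rho>\<close>, it is a power of \<open>\<rho>\<close> times a
  polynomial of degree less than \<open>p\<close> in \<open>\<rho>\<^sup>2\<close> whose coefficients are essentially the values of the Almansi
  components, and \<open>p\<close> radii recover them.
\<close>

section \<open>Polynomial functions and the Laplacian\<close>

text \<open>Defined inductively so that closure under derivatives, continuity and measurability are rule inductions; degrees are tracked separately by
  \<open>homogeneous_polynomial\<close>.\<close>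

inductive polyf :: "(real^'n::finite \<Rightarrow> complex) \<Rightarrow> bool" where
  polyf_const: "polyf (\<lambda>x. c)"
| polyf_coord: "polyf (\<lambda>x. complex_of_real (x $ j))"
| polyf_add: "polyf f \<Longrightarrow> polyf g \<Longrightarrow> polyf (\<lambda>x. f x + g x)"
| polyf_mult: "polyf f \<Longrightarrow> polyf g \<Longrightarrow> polyf (\<lambda>x. f x * g x)"

text \<open>\<open>partial_deriv\<close> is a total function that says nothing about differentiability, so its calculus rules are derived from this relation,
  which includes the existence of the derivative at every point.\<close>

definition has_pd :: "'n \<Rightarrow> (real^'n::finite \<Rightarrow> complex) \<Rightarrow> (real^'n \<Rightarrow> complex) \<Rightarrow> bool" where
  "has_pd j f g \<longleftrightarrow> (\<forall>x. ((\<lambda>t. f (x + t *\<^sub>R axis j 1)) has_vector_derivative g x) (at 0))"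

lemma has_pd_imp: "has_pd j f g \<Longrightarrow> partial_deriv j f = g"
  unfolding has_pd_def partial_deriv_def by (auto intro!: ext vector_derivative_at)

lemma has_pd_const: "has_pd j (\<lambda>x. c) (\<lambda>x. 0)"
  unfolding has_pd_def by auto

lemma has_pd_coord:
  fixes i j :: "'n::finite"
  shows "has_pd i (\<lambda>x. complex_of_real (x $ j)) (\<lambda>x. if i = j then 1 else 0)"
proof -
  have "((\<lambda>t. complex_of_real ((x + t *\<^sub>R axis i 1) $ j)) has_vector_derivative
      (if i = j then 1 else 0)) (at 0)" for x :: "real^'n"
  proof -
    have "((\<lambda>t. complex_of_real (x $ j + t * (if i = j then 1 else 0))) has_vector_derivative
        of_real (0 + 1 * (if i = j then 1 else 0))) (at 0)"
      by (intro has_vector_derivative_of_real) (auto intro!: derivative_eq_intros simp: has_real_derivative_iff_has_vector_derivative[symmetric])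
    then show ?thesis by (auto simp: axis_def split: if_splits)
  qed
  then show ?thesis unfolding has_pd_def by blast
qed

lemma has_pd_add: "has_pd j f f' \<Longrightarrow> has_pd j g g' \<Longrightarrow> has_pd j (\<lambda>x. f x + g x) (\<lambda>x. f' x + g' x)"
  unfolding has_pd_def by (auto intro!: has_vector_derivative_add)

lemma has_pd_mult: "has_pd j f f' \<Longrightarrow> has_pd j g g' \<Longrightarrow>
    has_pd j (\<lambda>x. f x * g x) (\<lambda>x. f x * g' x + f' x * g x)"
proof -
  assume a: "has_pd j f f'" "has_pd j g g'"
  have "((\<lambda>t. f (x + t *\<^sub>R axis j 1) * g (x + t *\<^sub>R axis j 1)) has_vector_derivative
     f x * g' x + f' x * g x) (at 0)" for x
    using has_vector_derivative_mult[of "\<lambda>t. f (x + t *\<^sub>R axis j 1)" "f' x" 0 UNIV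
       "\<lambda>t. g (x + t *\<^sub>R axis j 1)" "g' x"] a unfolding has_pd_def by simp
  then show ?thesis unfolding has_pd_def by blast
qed

lemma polyf_has_pd: "polyf f \<Longrightarrow> \<exists>g. polyf g \<and> has_pd j f g"
proof (induction rule: polyf.induct)
  case (polyf_const c) then show ?case using has_pd_const polyf.polyf_const by blast
next
  case (polyf_coord i) then show ?case using has_pd_coord polyf.polyf_const by blast
next
  case (polyf_add f g) then show ?case using has_pd_add polyf.polyf_add by blast
next
  case (polyf_mult f g)
  then obtain f' g' where "polyf f'" "has_pd j f f'" "polyf g'" "has_pd j g g'" by blast
  with polyf_mult have "polyf (\<lambda>x. f x * g' x + f' x * g x)"
      "has_pd j (\<lambda>x. f x * g x) (\<lambda>x. f x * g' x + f' x * g x)"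
    using has_pd_mult by (auto intro!: polyf.intros)
  then show ?case by blast
qed

lemma polyf_pd: "polyf f \<Longrightarrow> polyf (partial_deriv j f)"
  and has_pd_pd: "polyf f \<Longrightarrow> has_pd j f (partial_deriv j f)"
  using polyf_has_pd[of f j] has_pd_imp by metis+

lemma pd_const: "partial_deriv j (\<lambda>x. c) = (\<lambda>x. 0)"
  and pd_coord: "partial_deriv i (\<lambda>x. complex_of_real (x $ j)) = (\<lambda>x. if i = j then 1 else 0)"
  and pd_add: "polyf f \<Longrightarrow> polyf g \<Longrightarrow> partial_deriv j (\<lambda>x. f x + g x) = (\<lambda>x. partial_deriv j f x + partial_deriv j g x)"
  and pd_mult: "polyf f \<Longrightarrow> polyf g \<Longrightarrow>
     partial_deriv j (\<lambda>x. f x * g x) = (\<lambda>x. f x * partial_deriv j g x + partial_deriv j f x * g x)"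
  by (intro has_pd_imp has_pd_const has_pd_coord has_pd_add has_pd_mult has_pd_pd; assumption)+

lemma polyf_cmult: "polyf f \<Longrightarrow> polyf (\<lambda>x. c * f x)"
  by (intro polyf_mult polyf_const)

lemma pd_cmult: "polyf f \<Longrightarrow> partial_deriv j (\<lambda>x. c * f x) = (\<lambda>x. c * partial_deriv j f x)"
  by (subst pd_mult) (auto intro: polyf.intros simp: pd_const)

lemma polyf_sum: "(\<And>i. i \<in> A \<Longrightarrow> polyf (f i)) \<Longrightarrow> polyf (\<lambda>x. \<Sum>i\<in>A. f i x)"
  by (induction A rule: infinite_finite_induct) (auto intro: polyf.intros)

lemma pd_sum: "(\<And>i. i \<in> A \<Longrightarrow> polyf (f i)) \<Longrightarrow>
    partial_deriv j (\<lambda>x. \<Sum>i\<in>A. f i x) = (\<lambda>x. \<Sum>i\<in>A. partial_deriv j (f i) x)"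
proof (induction A rule: infinite_finite_induct)
  case (insert a A)
  then have "partial_deriv j (\<lambda>x. f a x + (\<Sum>i\<in>A. f i x)) = (\<lambda>x. partial_deriv j (f a) x + partial_deriv j (\<lambda>x. \<Sum>i\<in>A. f i x) x)"
    by (intro pd_add polyf_sum) auto
  with insert show ?case by simp
qed (auto simp: pd_const)

lemma polyf_power: "polyf f \<Longrightarrow> polyf (\<lambda>x. f x ^ k)"
  by (induction k) (auto intro: polyf.intros)

lemma pd_power: "polyf f \<Longrightarrow> partial_deriv j (\<lambda>x. f x ^ k) = (\<lambda>x. of_nat k * f x ^ (k - 1) * partial_deriv j f x)"
proof (induction k)
  case (Suc k)
  have "partial_deriv j (\<lambda>x. f x * f x ^ k) = (\<lambda>x. f x * (of_nat k * f x ^ (k - 1) * partial_deriv j f x) + partial_deriv j f x * f x ^ k)"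
    using Suc by (subst pd_mult) (auto intro: polyf_power)
  also have "\<dots> = (\<lambda>x. of_nat (Suc k) * f x ^ k * partial_deriv j f x)"
    by (rule ext, cases k) (auto simp: algebra_simps)
  finally show ?case by simp
qed (simp add: pd_const)

lemma polyf_continuous: "polyf f \<Longrightarrow> continuous_on S f"
  by (induction rule: polyf.induct) (auto intro!: continuous_intros)

lemma polyf_measurable: "polyf f \<Longrightarrow> f \<in> borel_measurable borel"
  by (simp add: borel_measurable_continuous_onI polyf_continuous)

lemma pd_commute: "polyf f \<Longrightarrow> partial_deriv i (partial_deriv j f) = partial_deriv j (partial_deriv i f)"
proof (induction rule: polyf.induct)
  case (polyf_const c) then show ?case by (simp add: pd_const)
next
  case (polyf_coord k) then show ?case by (simp add: pd_coord pd_const)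
next
  case (polyf_add f g) then show ?case by (simp add: pd_add polyf_pd)
next
  case (polyf_mult f g)
  then show ?case
    by (simp add: pd_mult pd_add polyf_pd polyf.intros fun_eq_iff)
qed

lemma polyf_lap: "polyf f \<Longrightarrow> polyf (laplacian f)"
  unfolding laplacian_def by (auto intro!: polyf_sum polyf_pd)

lemma polyf_lap_iter: "polyf f \<Longrightarrow> polyf ((laplacian ^^ k) f)"
  by (induction k) (auto intro: polyf_lap)

lemma lap_zero: "laplacian (\<lambda>x. 0) = (\<lambda>x. 0)"
  by (simp add: laplacian_def pd_const fun_eq_iff)

lemma lap_iter_zero: "(laplacian ^^ k) (\<lambda>x. 0) = (\<lambda>x. 0)"
  by (induction k) (auto simp: lap_zero)

lemma lap_add: "polyf f \<Longrightarrow> polyf g \<Longrightarrow> laplacian (\<lambda>x. f x + g x) = (\<lambda>x. laplacian f x + laplacian g x)"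
  by (simp add: laplacian_def pd_add polyf_pd fun_eq_iff sum.distrib)

lemma lap_cmult: "polyf f \<Longrightarrow> laplacian (\<lambda>x. c * f x) = (\<lambda>x. c * laplacian f x)"
  by (simp add: laplacian_def pd_cmult polyf_pd fun_eq_iff sum_distrib_left)

lemma lap_sum: "(\<And>i. i \<in> A \<Longrightarrow> polyf (f i)) \<Longrightarrow>
    laplacian (\<lambda>x. \<Sum>i\<in>A. f i x) = (\<lambda>x. \<Sum>i\<in>A. laplacian (f i) x)"
proof (induction A rule: infinite_finite_induct)
  case (insert a A)
  then have "laplacian (\<lambda>x. f a x + (\<Sum>i\<in>A. f i x)) = (\<lambda>x. laplacian (f a) x + laplacian (\<lambda>x. \<Sum>i\<in>A. f i x) x)"
    by (intro lap_add polyf_sum) auto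
  with insert show ?case by simp
qed (auto simp: lap_zero)

lemma lap_iter_add: "polyf f \<Longrightarrow> polyf g \<Longrightarrow> (laplacian ^^ k) (\<lambda>x. f x + g x) = (\<lambda>x. (laplacian ^^ k) f x + (laplacian ^^ k) g x)"
  by (induction k) (auto simp: lap_add polyf_lap_iter)

lemma lap_iter_cmult: "polyf f \<Longrightarrow> (laplacian ^^ k) (\<lambda>x. c * f x) = (\<lambda>x. c * (laplacian ^^ k) f x)"
  by (induction k) (auto simp: lap_cmult polyf_lap_iter)

lemma lap_iter_sum: "(\<And>i. i \<in> A \<Longrightarrow> polyf (f i)) \<Longrightarrow>
    (laplacian ^^ k) (\<lambda>x. \<Sum>i\<in>A. f i x) = (\<lambda>x. \<Sum>i\<in>A. (laplacian ^^ k) (f i) x)"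
  by (induction k) (auto simp: lap_sum polyf_lap_iter)

lemma lap_mult: "polyf f \<Longrightarrow> polyf g \<Longrightarrow> laplacian (\<lambda>x. f x * g x) =
   (\<lambda>x. f x * laplacian g x + laplacian f x * g x + 2 * (\<Sum>j\<in>UNIV. partial_deriv j f x * partial_deriv j g x))"
  by (simp add: laplacian_def pd_mult pd_add polyf_pd polyf.intros fun_eq_iff sum.distrib sum_distrib_left sum_distrib_right algebra_simps)

lemma lap_pd: "polyf f \<Longrightarrow> laplacian (partial_deriv j f) = partial_deriv j (laplacian f)"
proof -
  assume f: "polyf f"
  have "partial_deriv i (partial_deriv i (partial_deriv j f)) = partial_deriv j (partial_deriv i (partial_deriv i f))" for i
    using pd_commute[OF f, of i j] pd_commute[OF polyf_pd[OF f], of i j i] by metis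
  then show ?thesis unfolding laplacian_def
    by (subst pd_sum) (auto intro: polyf_pd f)
qed

section \<open>Homogeneous polynomials\<close>

lemma finite_multi_index: "finite {k :: 'n::finite \<Rightarrow> nat. sum k UNIV = m}"
proof -
  have "{k :: 'n \<Rightarrow> nat. sum k UNIV = m} \<subseteq> PiE UNIV (\<lambda>_. {..m})"
    by (auto simp: PiE_def) (metis UNIV_I finite_class.finite_UNIV le_add1 sum.remove)
  then show ?thesis by (rule finite_subset) (auto intro: finite_PiE)
qed

lemma polyf_monomial: "polyf (\<lambda>x. complex_of_real (monomial k x))"
proof -
  have "polyf (\<lambda>x. \<Prod>j\<in>A. complex_of_real (x $ j) ^ k j)" for A
    by (induction A rule: infinite_finite_induct) (auto intro!: polyf_const polyf_mult polyf_power polyf_coord)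
  then show ?thesis by (simp add: monomial_def)
qed

lemma monomial_scale: "monomial k (c *\<^sub>R x) = c ^ sum k UNIV * monomial k x"
  by (simp add: monomial_def power_mult_distrib prod.distrib power_sum)

lemma monomial_add: "monomial (\<lambda>j. k j + l j) x = monomial k x * monomial l x"
  by (simp add: monomial_def power_add prod.distrib)

lemma monomial_insert: "monomial k x = x $ j ^ k j * (\<Prod>i\<in>UNIV - {j}. x $ i ^ k i)"
  unfolding monomial_def by (subst prod.remove[of _ j]) auto

lemma hp_polyf: "homogeneous_polynomial m q \<Longrightarrow> polyf q"
proof -
  assume "homogeneous_polynomial m q"
  then obtain c where "q = (\<lambda>x. \<Sum>k | sum k UNIV = m. c k * complex_of_real (monomial k x))"
    unfolding homogeneous_polynomial_def by blast
  then show ?thesis by (auto intro!: polyf_sum polyf_cmult polyf_monomial)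
qed

lemma hp_scale: "homogeneous_polynomial m q \<Longrightarrow> q (c *\<^sub>R x) = complex_of_real c ^ m * q x"
  unfolding homogeneous_polynomial_def
  by (auto simp: monomial_scale sum_distrib_left algebra_simps intro!: sum.cong)

lemma hp_zero: "homogeneous_polynomial m (\<lambda>x. 0)"
  unfolding homogeneous_polynomial_def by (rule exI[of _ "\<lambda>_. 0"]) auto

lemma hp_add: "homogeneous_polynomial m f \<Longrightarrow> homogeneous_polynomial m g \<Longrightarrow> homogeneous_polynomial m (\<lambda>x. f x + g x)"
  unfolding homogeneous_polynomial_def
  apply (elim exE) subgoal for c d
    by (rule exI[of _ "\<lambda>k. c k + d k"]) (auto simp: sum.distrib algebra_simps)
  done

lemma hp_cmult: "homogeneous_polynomial m f \<Longrightarrow> homogeneous_polynomial m (\<lambda>x. a * f x)"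
  unfolding homogeneous_polynomial_def
  apply (elim exE) subgoal for c
    by (rule exI[of _ "\<lambda>k. a * c k"]) (auto simp: sum_distrib_left algebra_simps)
  done

lemma hp_sum: "(\<And>i. i \<in> A \<Longrightarrow> homogeneous_polynomial m (f i)) \<Longrightarrow> homogeneous_polynomial m (\<lambda>x. \<Sum>i\<in>A. f i x)"
  by (induction A rule: infinite_finite_induct) (auto intro: hp_zero hp_add)

lemma hp_monomial: "homogeneous_polynomial (sum k UNIV) (\<lambda>x. complex_of_real (monomial k x))"
  unfolding homogeneous_polynomial_def
  by (rule exI[of _ "\<lambda>l. if l = k then 1 else 0"])
     (auto simp: finite_multi_index sum.delta if_distrib[of "\<lambda>u. u * _"] cong: if_cong)

lemma hp_monomial': "sum k UNIV = m \<Longrightarrow> homogeneous_polynomial m (\<lambda>x. complex_of_real (monomial k x))"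
  using hp_monomial by auto

lemma hp_mult: assumes "homogeneous_polynomial m f" "homogeneous_polynomial l g"
  shows "homogeneous_polynomial (m + l) (\<lambda>x. f x * g x)"
proof -
  obtain c d where c: "\<And>x. f x = (\<Sum>k | sum k UNIV = m. c k * complex_of_real (monomial k x))"
    and d: "\<And>x. g x = (\<Sum>k | sum k UNIV = l. d k * complex_of_real (monomial k x))"
    using assms unfolding homogeneous_polynomial_def by blast
  have "(\<lambda>x. f x * g x) = (\<lambda>x. \<Sum>k | sum k UNIV = m. \<Sum>k' | sum k' UNIV = l.
      (c k * d k') * complex_of_real (monomial (\<lambda>j. k j + k' j) x))"
    by (auto simp: c d sum_product monomial_add fun_eq_iff algebra_simps)
  moreover have "homogeneous_polynomial (m + l) \<dots>"
    by (intro hp_sum hp_cmult hp_monomial') (auto simp: sum.distrib)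
  ultimately show ?thesis by simp
qed

lemma hp_const: "homogeneous_polynomial 0 (\<lambda>x. c)"
  using hp_cmult[OF hp_monomial'[of "\<lambda>_. 0" 0], of c] by (simp add: monomial_def)

lemma hp_coord:
  fixes j :: "'n::finite"
  shows "homogeneous_polynomial 1 (\<lambda>x. complex_of_real (x $ j))"
proof -
  have "monomial (\<lambda>i. if i = j then 1 else 0) x = x $ j" for x :: "real^'n"
    by (subst monomial_insert[of _ _ j]) (auto intro!: prod.neutral)
  then show ?thesis using hp_monomial'[of "\<lambda>i. if i = j then 1 else 0" 1] by simp
qed

lemma hp_power: "homogeneous_polynomial m f \<Longrightarrow> homogeneous_polynomial (k * m) (\<lambda>x. f x ^ k)"
  by (induction k) (auto intro: hp_const hp_mult)

lemma pd_monomial: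
  fixes j :: "'n::finite"
  shows "partial_deriv j (\<lambda>x. complex_of_real (monomial k x)) =
   (\<lambda>x. of_nat (k j) * complex_of_real (monomial (k(j := k j - 1)) x))"
proof (rule has_pd_imp, unfold has_pd_def, rule allI)
  fix x :: "real^'n"
  let ?P = "\<Prod>i\<in>UNIV - {j}. x $ i ^ k i"
  have eq: "monomial k (x + t *\<^sub>R axis j 1) = (x $ j + t) ^ k j * ?P" for t
    unfolding monomial_insert[of k _ j] by (auto simp: axis_def intro!: prod.cong)
  have "((\<lambda>t. (x $ j + t) ^ k j * ?P) has_vector_derivative (of_nat (k j) * (x $ j + 0) ^ (k j - 1) * ?P)) (at 0)"
    unfolding has_real_derivative_iff_has_vector_derivative[symmetric]
    by (auto intro!: derivative_eq_intros)
  then have "((\<lambda>t. complex_of_real ((x $ j + t) ^ k j * ?P)) has_vector_derivative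
      of_real (of_nat (k j) * (x $ j + 0) ^ (k j - 1) * ?P)) (at 0)"
    by (intro has_vector_derivative_of_real) (simp add: has_real_derivative_iff_has_vector_derivative)
  also have "of_nat (k j) * (x $ j + 0) ^ (k j - 1) * ?P = of_nat (k j) * monomial (k(j := k j - 1)) x"
    unfolding monomial_insert[of _ _ j] by (auto intro!: prod.cong)
  finally show "((\<lambda>t. complex_of_real (monomial k (x + t *\<^sub>R axis j 1))) has_vector_derivative
            of_nat (k j) * complex_of_real (monomial (k(j := k j - 1)) x)) (at 0)"
    by (simp add: eq)
qed

lemma sum_upd: "sum (k(j := a)) (UNIV :: 'n::finite set) + k j = sum k UNIV + (a::nat)"
  by (simp add: sum.remove[of UNIV j])

lemma hp_pd: assumes "homogeneous_polynomial m f"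
  shows "homogeneous_polynomial (m - 1) (partial_deriv j f)"
proof -
  obtain c where "f = (\<lambda>x. \<Sum>k | sum k UNIV = m. c k * complex_of_real (monomial k x))"
    using assms unfolding homogeneous_polynomial_def by blast
  then have eq: "partial_deriv j f = (\<lambda>x. \<Sum>k | sum k UNIV = m. c k * (of_nat (k j) * complex_of_real (monomial (k(j := k j - 1)) x)))"
    by (simp add: pd_sum polyf_cmult polyf_monomial pd_cmult pd_monomial)
  have "homogeneous_polynomial (m - 1) (\<lambda>x. of_nat (k j) * complex_of_real (monomial (k(j := k j - 1)) x))"
    if "sum k UNIV = m" for k
  proof (cases "k j = 0")
    case True then show ?thesis by (simp add: hp_zero)
  next
    case False
    then show ?thesis using sum_upd[of k j "k j - 1"] that by (intro hp_cmult hp_monomial') linarith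
  qed
  then show ?thesis unfolding eq by (intro hp_sum, intro hp_cmult[of _ _ "c _"]) blast
qed

lemma hp_pd_0: "homogeneous_polynomial 0 f \<Longrightarrow> partial_deriv j f = (\<lambda>x. 0)"
proof -
  assume "homogeneous_polynomial 0 f"
  then have "f x = f 0" for x using hp_scale[of 0 f 0 x] by simp
  then have "f = (\<lambda>x. f 0)" by auto
  then show ?thesis using pd_const[of j "f 0"] by metis
qed

lemma hp_0_const: "homogeneous_polynomial 0 f \<Longrightarrow> f x = f 0"
  using hp_scale[of 0 f 0 x] by simp

text \<open>Each monomial of degree \<open>m\<close> is an eigenvector of the Euler operator, because
  \<open>x\<^sub>j \<partial>\<^sub>j x\<^sup>k = k\<^sub>j x\<^sup>k\<close>.\<close>

lemma euler_identity: assumes "homogeneous_polynomial m f"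
  shows "(\<Sum>j\<in>UNIV. complex_of_real (x $ j) * partial_deriv j f x) = of_nat m * f x"
proof -
  obtain c where f: "f = (\<lambda>x. \<Sum>k | sum k UNIV = m. c k * complex_of_real (monomial k x))"
    using assms unfolding homogeneous_polynomial_def by blast
  have m: "complex_of_real (x $ j) * (of_nat (k j) * complex_of_real (monomial (k(j := k j - 1)) x)) =
        of_nat (k j) * complex_of_real (monomial k x)" for j k
  proof -
    have "x $ j * (real (k j) * monomial (k(j := k j - 1)) x) = real (k j) * monomial k x"
    proof (cases "k j")
      case (Suc i)
      have "monomial (k(j := i)) x * x $ j = monomial k x"
        unfolding monomial_insert[of _ _ j] using Suc by (auto intro!: prod.cong)
      with Suc show ?thesis by (simp add: mult.commute)
    qed simp
    then show ?thesis by (metis of_real_mult of_real_of_nat_eq)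
  qed
  have "(\<Sum>j\<in>UNIV. complex_of_real (x $ j) * partial_deriv j f x) =
     (\<Sum>j\<in>UNIV. \<Sum>k | sum k UNIV = m. c k * (of_nat (k j) * complex_of_real (monomial k x)))"
    unfolding f by (subst pd_sum) (auto simp: polyf_cmult polyf_monomial pd_cmult pd_monomial sum_distrib_left
       m[symmetric] algebra_simps intro!: sum.cong)
  also have "\<dots> = (\<Sum>k | sum k UNIV = m. c k * (of_nat (sum k UNIV) * complex_of_real (monomial k x)))"
    by (subst sum.swap) (simp only: sum_distrib_left sum_distrib_right of_nat_sum)
  also have "\<dots> = of_nat m * f x"
    unfolding f by (auto simp: sum_distrib_left algebra_simps)
  finally show ?thesis .
qed

lemma hp_lap: "homogeneous_polynomial m f \<Longrightarrow> homogeneous_polynomial (m - 2) (laplacian f)"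
  unfolding laplacian_def using hp_pd[OF hp_pd[of m f]] by (intro hp_sum) (simp add: numeral_2_eq_2)

lemma hp_lap_small: "homogeneous_polynomial m f \<Longrightarrow> m < 2 \<Longrightarrow> laplacian f = (\<lambda>x. 0)"
proof -
  assume f: "homogeneous_polynomial m f" and "m < 2"
  then have "homogeneous_polynomial 0 (partial_deriv j f)" for j
    using hp_pd[OF f, of j] by (metis One_nat_def diff_is_0_eq less_Suc_eq_le numeral_2_eq_2)
  then show ?thesis unfolding laplacian_def by (simp add: hp_pd_0)
qed

lemma hp_lap_iter: "homogeneous_polynomial m f \<Longrightarrow> homogeneous_polynomial (m - 2 * k) ((laplacian ^^ k) f)"
  by (induction k) (auto dest: hp_lap simp: diff_diff_left add.commute)

lemma hp_lap_iter_small: "homogeneous_polynomial m f \<Longrightarrow> m < 2 * k \<Longrightarrow> (laplacian ^^ k) f = (\<lambda>x. 0)"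
proof (induction k)
  case (Suc k)
  show ?case
  proof (cases "m < 2 * k")
    case True then show ?thesis using Suc by (simp add: lap_zero)
  next
    case False
    then have "m - 2 * k < 2" using Suc.prems by auto
    then show ?thesis using hp_lap_small[OF hp_lap_iter[OF Suc.prems(1), of k]] by simp
  qed
qed simp

section \<open>Powers of the norm and of linear forms\<close>

definition nsq :: "real^'n::finite \<Rightarrow> complex" where "nsq x = complex_of_real ((norm x)\<^sup>2)"

lemma nsq_eq: "nsq x = (\<Sum>j\<in>UNIV. complex_of_real (x $ j) ^ 2)"
  by (simp add: nsq_def norm_vec_def L2_set_def sum_nonneg)

lemma hp_nsq: "homogeneous_polynomial 2 nsq"
proof -
  have "homogeneous_polynomial 2 (\<lambda>x. \<Sum>j\<in>UNIV. complex_of_real (x $ j) ^ 2)"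
    using hp_power[OF hp_coord, of 2] by (intro hp_sum) simp
  then show ?thesis by (simp add: nsq_eq[abs_def])
qed

lemma pd_nsq: "partial_deriv j nsq x = 2 * complex_of_real (x $ j)"
  unfolding nsq_eq[abs_def] by (subst pd_sum)
    (auto simp: pd_power pd_coord polyf_coord polyf_power if_distrib[of "\<lambda>u. _ * u"] sum.delta cong: if_cong)

lemma lap_nsq: "laplacian (nsq :: real^'n::finite \<Rightarrow> complex) x = of_nat (2 * CARD('n))"
  unfolding laplacian_def pd_nsq[abs_def] by (simp add: pd_cmult polyf_coord pd_coord)

lemma lap_nsq_mult: assumes "homogeneous_polynomial a (h :: real^'n::finite \<Rightarrow> complex)"
  shows "laplacian (\<lambda>x. nsq x * h x) x = nsq x * laplacian h x + of_nat (4 * a + 2 * CARD('n)) * h x"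
proof -
  have "(\<Sum>j\<in>UNIV. partial_deriv j nsq x * partial_deriv j h x) = 2 * (of_nat a * h x)"
    unfolding euler_identity[OF assms, symmetric] by (simp add: pd_nsq sum_distrib_left algebra_simps)
  then show ?thesis
    unfolding fun_cong[OF lap_mult[OF hp_polyf[OF hp_nsq] hp_polyf[OF assms]]]
    by (simp add: lap_nsq ring_distribs mult_ac)
qed

lemma hp_nsq_power_mult: "homogeneous_polynomial a h \<Longrightarrow> homogeneous_polynomial (a + 2 * k) (\<lambda>x. nsq x ^ k * h x)"
  using hp_mult[OF hp_power[OF hp_nsq, of k], of a h] by (simp add: algebra_simps)

text \<open>The cross term \<open>2 \<nabla>|x|\<^sup>2 \<cdot> \<nabla>h\<close> is \<open>4 a h\<close> by Euler's identity, so multiplication by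
  \<open>|x|\<^sup>2\<close> raises and the Laplacian lowers the power with an explicit factor.\<close>

lemma lap_nsq_power_mult: assumes "homogeneous_polynomial a (h :: real^'n::finite \<Rightarrow> complex)"
  shows "laplacian (\<lambda>x. nsq x ^ k * h x) x = nsq x ^ k * laplacian h x +
     2 * of_nat k * (2 * of_nat k + 2 * of_nat a + of_nat CARD('n) - 2) * nsq x ^ (k - 1) * h x"
proof (induction k arbitrary: x)
  case (Suc k)
  have "laplacian (\<lambda>x. nsq x * (nsq x ^ k * h x)) x = nsq x * laplacian (\<lambda>x. nsq x ^ k * h x) x +
      of_nat (4 * (a + 2 * k) + 2 * CARD('n)) * (nsq x ^ k * h x)"
    by (rule lap_nsq_mult[OF hp_nsq_power_mult[OF assms]])
  then show ?case unfolding Suc.IH by (cases k) (simp_all add: algebra_simps)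
qed simp

definition lin :: "real^'n::finite \<Rightarrow> real^'n \<Rightarrow> complex" where "lin b x = complex_of_real (b \<bullet> x)"

lemma lin_eq: "lin b x = (\<Sum>j\<in>UNIV. complex_of_real (b $ j) * complex_of_real (x $ j))"
  by (simp add: lin_def inner_vec_def)

lemma hp_lin: "homogeneous_polynomial 1 (lin b)"
  unfolding lin_eq[abs_def] by (intro hp_sum hp_cmult hp_coord)

lemma pd_lin: "partial_deriv j (lin b) = (\<lambda>x. complex_of_real (b $ j))"
  unfolding lin_eq[abs_def] by (subst pd_sum)
    (auto simp: pd_cmult pd_coord polyf_coord polyf_cmult if_distrib[of "\<lambda>u. _ * u"] sum.delta cong: if_cong)

lemma hp_lin_power: "homogeneous_polynomial k (\<lambda>x. lin b x ^ k)"
  using hp_power[OF hp_lin, of k b] by simp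

lemma lap_lin_power: "laplacian (\<lambda>x. lin b x ^ k) x = of_nat k * of_nat (k - 1) * nsq b * lin b x ^ (k - 2)"
proof -
  have p: "polyf (lin b)" using hp_polyf[OF hp_lin] .
  have "partial_deriv j (partial_deriv j (\<lambda>x. lin b x ^ k)) x = of_nat k * of_nat (k - 1) * lin b x ^ (k - 2) * complex_of_real (b $ j) ^ 2" for j
  proof -
    have "partial_deriv j (\<lambda>x. lin b x ^ k) = (\<lambda>x. (of_nat k * complex_of_real (b $ j)) * lin b x ^ (k - 1))"
      using p by (simp add: pd_power pd_lin algebra_simps)
    then show ?thesis using p by (simp add: pd_cmult polyf_power pd_power pd_lin power2_eq_square numeral_2_eq_2)
  qed
  then show ?thesis unfolding laplacian_def nsq_eq by (simp add: sum_distrib_left algebra_simps)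
qed

section \<open>The Almansi decomposition\<close>

text \<open>On \<open>|x|\<^sup>2\<^sup>k h\<close> with \<open>h\<close> harmonic, each Laplacian removes one factor \<open>|x|\<^sup>2\<close> and leaves a
  positive constant; that this constant does not vanish makes the Almansi decomposition possible.\<close>

lemma lap_iter_nsq_power:
  assumes "homogeneous_polynomial a (h :: real^'n::finite \<Rightarrow> complex)" "laplacian h = (\<lambda>x. 0)"
  shows "\<exists>c. c \<noteq> 0 \<and> (laplacian ^^ k) (\<lambda>x. nsq x ^ k * h x) = (\<lambda>x. c * h x)"
proof (induction k)
  case 0 show ?case by (rule exI[of _ 1]) auto
next
  case (Suc k)
  then obtain c where c: "c \<noteq> 0" "(laplacian ^^ k) (\<lambda>x. nsq x ^ k * h x) = (\<lambda>x. c * h x)" by blast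
  let ?e = "2 * of_nat (Suc k) * (2 * of_nat (Suc k) + 2 * of_nat a + of_nat CARD('n) - 2) :: complex"
  have "laplacian (\<lambda>x. nsq x ^ Suc k * h x) = (\<lambda>x. ?e * (nsq x ^ k * h x))"
    using assms by (simp add: fun_eq_iff lap_nsq_power_mult del: power_Suc)
  then have "(laplacian ^^ Suc k) (\<lambda>x. nsq x ^ Suc k * h x) = (laplacian ^^ k) (\<lambda>x. ?e * (nsq x ^ k * h x))"
    by (simp add: funpow_swap1 del: power_Suc)
  also have "\<dots> = (\<lambda>x. ?e * (c * h x))"
    using hp_polyf[OF hp_nsq_power_mult[OF assms(1)]] by (simp add: lap_iter_cmult c)
  finally have *: "(laplacian ^^ Suc k) (\<lambda>x. nsq x ^ Suc k * h x) = (\<lambda>x. (?e * c) * h x)" by (simp add: mult.assoc)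
  have "?e = of_nat (2 * Suc k * (2 * k + 2 * a + CARD('n)))" by (simp add: algebra_simps)
  also have "\<dots> \<noteq> 0" by (simp only: of_nat_eq_0_iff) auto
  finally show ?case using * c(1) by (intro exI[of _ "?e * c"]) auto
qed

text \<open>The top component is found first: \<open>\<Delta>\<^sup>p q\<close> is harmonic if \<open>\<Delta>\<^sup>p\<^sup>+\<^sup>1 q = 0\<close>, and a
  suitable multiple of it, times \<open>|x|\<^sup>2\<^sup>p\<close>, has the same image under \<open>\<Delta>\<^sup>p\<close> as \<open>q\<close>; the
  difference has lower order. The clause for \<open>m < 2 * k\<close> excludes spurious components where the truncated subtraction
  \<open>m - 2 * k\<close> is \<open>0\<close>.\<close>

lemma almansi_decomposition:
  assumes "homogeneous_polynomial m (q :: real^'n::finite \<Rightarrow> complex)" "(laplacian ^^ p) q = (\<lambda>x. 0)"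
  shows "\<exists>h. (\<forall>k<p. homogeneous_polynomial (m - 2 * k) (h k) \<and> laplacian (h k) = (\<lambda>x. 0) \<and>
              (m < 2 * k \<longrightarrow> h k = (\<lambda>x. 0))) \<and>
             (\<forall>x. q x = (\<Sum>k<p. nsq x ^ k * h k x))"
  using assms
proof (induction p arbitrary: q)
  case 0 then show ?case by auto
next
  case (Suc p)
  show ?case
  proof (cases "m < 2 * p")
    case True
    then have "(laplacian ^^ p) q = (\<lambda>x. 0)" using Suc.prems hp_lap_iter_small by blast
    then obtain h where h: "\<forall>k<p. homogeneous_polynomial (m - 2 * k) (h k) \<and> laplacian (h k) = (\<lambda>x. 0) \<and>
              (m < 2 * k \<longrightarrow> h k = (\<lambda>x. 0))" "\<forall>x. q x = (\<Sum>k<p. nsq x ^ k * h k x)"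
      using Suc.IH Suc.prems by blast
    show ?thesis
      by (rule exI[of _ "h(p := (\<lambda>x. 0))"]) (use h in \<open>auto simp: less_Suc_eq hp_zero lap_zero\<close>)
  next
    case False
    define g where "g = (laplacian ^^ p) q"
    have g: "homogeneous_polynomial (m - 2 * p) g" "laplacian g = (\<lambda>x. 0)"
      using Suc.prems hp_lap_iter by (auto simp: g_def)
    obtain c where c: "c \<noteq> 0" "(laplacian ^^ p) (\<lambda>x. nsq x ^ p * g x) = (\<lambda>x. c * g x)"
      using lap_iter_nsq_power[OF g] by blast
    define hp where "hp = (\<lambda>x. (1 / c) * g x)"
    have hp: "homogeneous_polynomial (m - 2 * p) hp" "laplacian hp = (\<lambda>x. 0)"
      using g hp_polyf[OF g(1)] by (simp_all add: hp_def hp_cmult lap_cmult del: times_divide_eq_left)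
    have "homogeneous_polynomial (m - 2 * p + 2 * p) (\<lambda>x. nsq x ^ p * hp x)" by (rule hp_nsq_power_mult[OF hp(1)])
    with False have hm: "homogeneous_polynomial m (\<lambda>x. nsq x ^ p * hp x)" by simp
    define q' where "q' = (\<lambda>x. q x + (- 1) * (nsq x ^ p * hp x))"
    have q': "homogeneous_polynomial m q'" unfolding q'_def by (intro hp_add Suc.prems hp_cmult hm)
    have "(laplacian ^^ p) (\<lambda>x. nsq x ^ p * hp x) = (laplacian ^^ p) (\<lambda>x. (1 / c) * (nsq x ^ p * g x))"
      by (simp add: hp_def algebra_simps)
    also have "\<dots> = (\<lambda>x. (1 / c) * (c * g x))"
      using hp_polyf[OF hp_nsq_power_mult[OF g(1)]] by (subst lap_iter_cmult) (auto simp: c)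
    also have "\<dots> = g" using c by auto
    finally have "(laplacian ^^ p) q' = (\<lambda>x. 0)"
      unfolding q'_def
      using lap_iter_add[OF hp_polyf[OF Suc.prems(1)] polyf_cmult[OF hp_polyf[OF hm]], of p "- 1"]
        lap_iter_cmult[OF hp_polyf[OF hm], of p "- 1"] by (simp add: g_def)
    then obtain h where h: "\<forall>k<p. homogeneous_polynomial (m - 2 * k) (h k) \<and> laplacian (h k) = (\<lambda>x. 0) \<and>
              (m < 2 * k \<longrightarrow> h k = (\<lambda>x. 0))" "\<forall>x. q' x = (\<Sum>k<p. nsq x ^ k * h k x)"
      using Suc.IH q' by blast
    have "q x = q' x + nsq x ^ p * hp x" for x by (simp add: q'_def)
    then show ?thesis using h hp False
      by (intro exI[of _ "h(p := hp)"]) (auto simp: less_Suc_eq)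
  qed
qed

section \<open>Polar coordinates\<close>

text \<open>The integral over the unit sphere with respect to surface measure, obtained without constructing that measure: \<open>f (sgn x)\<close> is constant
  along rays, so its integral over the ball is the surface integral times
  \<open>\<integral>\<^sub>0\<^sup>1 s\<^sup>n\<^sup>-\<^sup>1 ds = 1/n\<close>.\<close>

definition sphere_integral :: "(real^'n::finite \<Rightarrow> complex) \<Rightarrow> complex" where
  "sphere_integral f = of_nat CARD('n) * (LINT x:cball 0 1|lborel. f (sgn x))"

lemma ball_borel [measurable]: "ball (a :: 'a::euclidean_space) r \<in> sets borel"
  by (rule borel_open) simp

lemma cball_borel [measurable]: "cball (a :: 'a::euclidean_space) r \<in> sets borel"
  by (rule borel_closed) simp

lemma nn_integral_scale:
  fixes h :: "real^'n::finite \<Rightarrow> ennreal" and r :: real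
  assumes "h \<in> borel_measurable borel" "r > 0"
  shows "(\<integral>\<^sup>+x. h x \<partial>lborel) = ennreal (r ^ CARD('n)) * (\<integral>\<^sup>+x. h (r *\<^sub>R x) \<partial>lborel)"
proof -
  have "(\<integral>\<^sup>+x. h x \<partial>lborel) = (\<integral>\<^sup>+x. h x \<partial>(density (distr lborel borel (\<lambda>x. 0 + r *\<^sub>R x)) (\<lambda>_. ennreal (\<bar>r\<bar>^DIM(real^'n)))))"
    using assms by (subst lborel_affine[of r 0, symmetric]) auto
  also have "\<dots> = (\<integral>\<^sup>+x. ennreal (r ^ CARD('n)) * h (r *\<^sub>R x) \<partial>lborel)"
    using assms by (subst nn_integral_density) (auto simp: nn_integral_distr)
  also have "\<dots> = ennreal (r ^ CARD('n)) * (\<integral>\<^sup>+x. h (r *\<^sub>R x) \<partial>lborel)"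
    using assms by (subst nn_integral_cmult) auto
  finally show ?thesis .
qed

lemma sgn_scale: "r > 0 \<Longrightarrow> sgn (r *\<^sub>R x) = sgn (x :: 'a::real_normed_vector)"
  by (simp add: sgn_div_norm)

lemma emeasure_cball_less_top: "emeasure lborel (cball (a :: 'a::euclidean_space) r) < top"
  using emeasure_lborel_cball_finite[of a r] by simp

text \<open>The push-forward under \<open>norm\<close> of the measure with density \<open>g (sgn x)\<close> on the ball. By scaling, the ball of radius
  \<open>a \<le> 1\<close> has mass \<open>a\<^sup>n G\<close>, which is also the mass of \<open>{..a}\<close> on the right; finite measures on the
  line that agree on half-lines are equal.\<close>

lemma polar_measure:
  fixes g :: "real^'n::finite \<Rightarrow> real" and G :: real
  assumes [measurable]: "g \<in> borel_measurable borel" and nn: "\<And>x. 0 \<le> g x" and G0: "G \<ge> 0"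
    and G: "(\<integral>\<^sup>+x. ennreal (g (sgn x)) * indicator (cball 0 1) x \<partial>lborel) = ennreal G"
  shows "distr (density lborel (\<lambda>x. ennreal (g (sgn x)) * indicator (cball 0 1) x)) borel norm =
         density lborel (\<lambda>s. ennreal (CARD('n) * G * s ^ (CARD('n) - 1)) * indicator {0..1} s)"
    (is "?M = ?N")
proof -
  let ?n = "CARD('n)"
  have n: "?n > 0" by simp
  have [measurable, simp]: "norm -` {..a} \<in> sets (borel :: (real^'n) measure)" for a
    by (intro borel_closed closed_vimage closed_atMost continuous_intros)
  have MA: "emeasure ?M {..a} = (\<integral>\<^sup>+x. ennreal (g (sgn x)) * indicator (cball 0 1) x * indicator {..a} (norm x) \<partial>lborel)" for a
    by (subst emeasure_distr, simp, simp, subst emeasure_density) (auto intro!: nn_integral_cong simp: indicator_def)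
  have NA: "emeasure ?N {..a} = (\<integral>\<^sup>+s. ennreal (?n * G * s ^ (?n - 1)) * indicator {0..1} s * indicator {..a} s \<partial>lborel)" for a
    by (subst emeasure_density) auto
  have M: "emeasure ?M {..a} = ennreal (G * (min a 1) ^ ?n)" if "a \<ge> 0" for a
  proof (cases "a = 0")
    case True
    have "(\<integral>\<^sup>+x. ennreal (g (sgn x)) * indicator (cball 0 1) x * indicator {..a} (norm x) \<partial>lborel) =
      (\<integral>\<^sup>+x. ennreal (g (sgn x)) * indicator {0} x \<partial>lborel)"
      by (intro nn_integral_cong) (auto simp: True indicator_def)
    also have "\<dots> = 0" by (intro nn_integral_null_set) auto
    finally show ?thesis using MA[of a] True n by (simp add: power_0_left)
  next
    case False
    define r where "r = min a 1"
    have r: "r > 0" "r \<le> 1" using that False by (auto simp: r_def)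
    have "(\<integral>\<^sup>+x. ennreal (g (sgn x)) * indicator (cball 0 1) x * indicator {..a} (norm x) \<partial>lborel) =
      (\<integral>\<^sup>+x. ennreal (g (sgn x)) * indicator (cball 0 r) x \<partial>lborel)"
      by (intro nn_integral_cong) (auto simp: r_def indicator_def)
    also have "\<dots> = ennreal (r ^ ?n) * (\<integral>\<^sup>+x. ennreal (g (sgn (r *\<^sub>R x))) * indicator (cball 0 r) (r *\<^sub>R x) \<partial>lborel)"
      by (rule nn_integral_scale[OF _ r(1)]) measurable
    also have "(\<integral>\<^sup>+x. ennreal (g (sgn (r *\<^sub>R x))) * indicator (cball 0 r) (r *\<^sub>R x) \<partial>lborel) =
       (\<integral>\<^sup>+x. ennreal (g (sgn x)) * indicator (cball 0 1) x \<partial>lborel)"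
      using r by (intro nn_integral_cong) (auto simp: sgn_scale[OF r(1)] indicator_def)
    finally show ?thesis using MA[of a] r G0 unfolding G by (simp add: r_def ennreal_mult' mult.commute)
  qed
  have N: "emeasure ?N {..a} = ennreal (G * (min a 1) ^ ?n)" if "a \<ge> 0" for a
  proof -
    define r where "r = min a 1"
    have r: "r \<ge> 0" "r \<le> 1" using that by (auto simp: r_def)
    have "emeasure ?N {..a} = (\<integral>\<^sup>+s. ennreal (?n * G * s ^ (?n - 1)) * indicator {0..r} s \<partial>lborel)"
      unfolding NA by (intro nn_integral_cong) (auto simp: r_def indicator_def)
    also have "\<dots> = ennreal (G * r ^ ?n - G * 0 ^ ?n)"
      using r G0 n
      by (intro nn_integral_FTC_Icc) (auto intro!: derivative_eq_intros mult_nonneg_nonneg simp: power_Suc)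
    finally show ?thesis using n by (simp add: r_def power_0_left)
  qed
  have neg: "emeasure ?M {..a} = 0" "emeasure ?N {..a} = 0" if "a < 0" for a
  proof -
    have "(\<integral>\<^sup>+x. ennreal (g (sgn x)) * indicator (cball 0 1) x * indicator {..a} (norm x) \<partial>lborel) = (\<integral>\<^sup>+x. 0 \<partial>(lborel :: (real^'n) measure))"
      using that by (intro nn_integral_cong) (auto simp: indicator_def dest: order_trans[OF norm_ge_zero])
    then show "emeasure ?M {..a} = 0" using MA[of a] by simp
    have "(\<integral>\<^sup>+s. ennreal (?n * G * s ^ (?n - 1)) * indicator {0..1} s * indicator {..a} s \<partial>lborel) = (\<integral>\<^sup>+s. 0 \<partial>(lborel :: real measure))"
      using that by (intro nn_integral_cong) (auto simp: indicator_def)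
    then show "emeasure ?N {..a} = 0" using NA[of a] by simp
  qed
  have eq: "emeasure ?M {..a} = emeasure ?N {..a}" and fin: "emeasure ?M {..a} \<noteq> \<infinity>" for a
    using M[of a] N[of a] neg[of a] by (cases "a \<ge> 0"; simp)+
  have UM: "emeasure ?M UNIV = emeasure ?M {..1}"
    unfolding MA by (subst emeasure_distr, simp, simp, subst emeasure_density)
      (auto intro!: nn_integral_cong simp: indicator_def)
  have UN: "emeasure ?N UNIV = emeasure ?N {..1}"
    unfolding NA by (subst emeasure_density) (auto intro!: nn_integral_cong simp: indicator_def)
  have c: "{a<..} = UNIV - {..a}" for a :: real by auto
  have Ma: "emeasure ?M {a<..} = emeasure ?M UNIV - emeasure ?M {..a}" for a
    using emeasure_compl[of "{..a}" ?M] fin[of a] by (simp add: c)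
  have Na: "emeasure ?N {a<..} = emeasure ?N UNIV - emeasure ?N {..a}" for a
    using emeasure_compl[of "{..a}" ?N] fin[of a] by (simp add: c eq)
  show ?thesis
  proof (rule measure_eqI_lessThan)
    fix a
    show "emeasure ?M {a<..} < \<infinity>"
      using fin[of 1] unfolding Ma UM by (simp add: less_top diff_less_top_ennreal)
    show "emeasure ?M {a<..} = emeasure ?N {a<..}"
      unfolding Ma Na UM UN eq ..
  qed auto
qed

lemma polar_nonneg:
  fixes g :: "real^'n::finite \<Rightarrow> real" and \<eta> :: "real \<Rightarrow> real"
  assumes [measurable]: "g \<in> borel_measurable borel" and nn: "\<And>x. 0 \<le> g x" and B: "\<And>x. g (sgn x) \<le> B"
    and \<eta>[measurable]: "\<eta> \<in> borel_measurable borel"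
    and int: "set_integrable lborel {0..1} (\<lambda>s. s ^ (CARD('n) - 1) * \<eta> s)"
  shows "set_integrable lborel (cball 0 1) (\<lambda>x. g (sgn x) * \<eta> (norm x))" (is ?A)
    and "(LINT x:cball 0 1|lborel. g (sgn x) * \<eta> (norm x)) =
      CARD('n) * (LINT x:cball 0 1|lborel. g (sgn x)) * (LINT s:{0..1}|lborel. s ^ (CARD('n) - 1) * \<eta> s)" (is ?B)
proof -
  define G where "G = (LINT x:cball 0 1|lborel. g (sgn x))"
  have gi: "set_integrable lborel (cball 0 1 :: (real^'n) set) (\<lambda>x. g (sgn x))"
    unfolding set_integrable_def
    by (rule integrableI_bounded_set[of "cball 0 1" _ _ B])
       (use B nn in \<open>auto simp: indicator_def emeasure_cball_less_top intro!: AE_I2\<close>)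
  have G0: "G \<ge> 0" unfolding G_def set_lebesgue_integral_def
    by (intro integral_nonneg_AE AE_I2) (auto simp: nn indicator_def)
  have G: "(\<integral>\<^sup>+x. ennreal (g (sgn x)) * indicator (cball 0 1) x \<partial>lborel) = ennreal G"
  proof -
    have "(\<integral>\<^sup>+x. ennreal (indicator (cball 0 1) x *\<^sub>R g (sgn x)) \<partial>lborel) = ennreal G"
      unfolding G_def set_lebesgue_integral_def
      using gi by (intro nn_integral_eq_integral) (auto simp: set_integrable_def nn)
    moreover have "ennreal (g (sgn x)) * indicator (cball 0 1) x = ennreal (indicator (cball 0 1) x *\<^sub>R g (sgn x))" for x
      by (auto simp: indicator_def)
    ultimately show ?thesis by simp
  qed
  have bm: "(\<lambda>x. g (sgn x) * indicat_real (cball 0 1) x) \<in> borel_measurable borel" by measurable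
  note pm = polar_measure[of g, OF assms(1) nn G0 G]
  let ?D = "density lborel (\<lambda>x. ennreal (g (sgn x)) * indicator (cball 0 1) x)"
  let ?N = "density lborel (\<lambda>s. ennreal (CARD('n) * G * s ^ (CARD('n) - 1)) * indicator {0..1} s)"
  have D: "?D = density lborel (\<lambda>x. ennreal (g (sgn x) * indicator (cball 0 1) x))"
    by (intro arg_cong[of _ _ "density lborel"] ext) (auto simp: indicator_def)
  have N: "?N = density lborel (\<lambda>s. ennreal (CARD('n) * G * s ^ (CARD('n) - 1) * indicator {0..1} s))"
    by (intro arg_cong[of _ _ "density lborel"] ext) (auto simp: indicator_def)
  have e1: "integrable ?N \<eta>"
    unfolding N
  proof (subst integrable_density)
    show "integrable lborel (\<lambda>x. (CARD('n) * G * x ^ (CARD('n) - 1) * indicator {0..1} x) *\<^sub>R \<eta> x)"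
      using integrable_mult_right[OF int[unfolded set_integrable_def], of "CARD('n) * G"]
      by (simp add: ac_simps)
  qed (use G0 in \<open>auto simp: indicator_def\<close>)
  then have "integrable (distr ?D borel norm) \<eta>" by (simp add: pm)
  then have "integrable ?D (\<lambda>x. \<eta> (norm x))" by (simp add: integrable_distr_eq)
  then show ?A unfolding D set_integrable_def
    by (subst (asm) integrable_density) (auto simp: nn bm ac_simps)
  have "(LINT x:cball 0 1|lborel. g (sgn x) * \<eta> (norm x)) = (LINT x|?D. \<eta> (norm x))"
    unfolding D set_lebesgue_integral_def by (subst integral_density) (auto simp: nn bm ac_simps)
  also have "\<dots> = (LINT s|distr ?D borel norm. \<eta> s)" by (simp add: integral_distr)
  also have "\<dots> = (LINT s|lborel. (CARD('n) * G) * (indicator {0..1} s *\<^sub>R (s ^ (CARD('n) - 1) * \<eta> s)))"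
    unfolding pm unfolding N
    by (subst integral_density) (use G0 in \<open>auto simp: ac_simps indicator_def intro!: Bochner_Integration.integral_cong\<close>)
  also have "\<dots> = CARD('n) * G * (LINT s:{0..1}|lborel. s ^ (CARD('n) - 1) * \<eta> s)"
    by (simp add: set_lebesgue_integral_def)
  finally show ?B by (simp add: G_def)
qed

lemma bounded_polyf_sphere: assumes "polyf f" shows "\<exists>B. \<forall>x. norm (f (sgn x)) \<le> B"
proof -
  have "compact (f ` cball 0 1)"
    by (intro compact_continuous_image polyf_continuous assms) auto
  then obtain B where "\<forall>y\<in>f ` cball 0 1. norm y \<le> B" using compact_imp_bounded bounded_iff by blast
  then show ?thesis by (intro exI[of _ B]) (auto simp: norm_sgn)
qed

lemma sphere_integrable: assumes "polyf f"
  shows "set_integrable lborel (cball 0 1) (\<lambda>x. f (sgn x))"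
proof -
  obtain B where "\<forall>x. norm (f (sgn x)) \<le> B" using bounded_polyf_sphere[OF assms] by blast
  moreover have [measurable]: "f \<in> borel_measurable borel" by (rule polyf_measurable[OF assms])
  ultimately show ?thesis unfolding set_integrable_def
    by (intro integrableI_bounded_set[of "cball 0 1" _ _ B]) (auto simp: emeasure_cball_less_top indicator_def intro!: AE_I2)
qed

text \<open>Polar coordinates for a product of an angular and a radial factor, reduced to nonnegative angular factors by splitting into real and imaginary,
  positive and negative parts.\<close>

lemma polar_polyf:
  fixes f :: "real^'n::finite \<Rightarrow> complex" and \<eta> :: "real \<Rightarrow> real"
  assumes f: "polyf f"
    and \<eta>[measurable]: "\<eta> \<in> borel_measurable borel"
    and int: "set_integrable lborel {0..1} (\<lambda>s. s ^ (CARD('n) - 1) * \<eta> s)"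
  shows "set_integrable lborel (cball 0 1) (\<lambda>x. f (sgn x) * complex_of_real (\<eta> (norm x)))" (is ?A)
    and "(LINT x:cball 0 1|lborel. f (sgn x) * complex_of_real (\<eta> (norm x))) =
      sphere_integral f * complex_of_real (LINT s:{0..1}|lborel. s ^ (CARD('n) - 1) * \<eta> s)" (is ?B)
proof -
  obtain B where B: "\<And>x. norm (f (sgn x)) \<le> B" using bounded_polyf_sphere[OF f] by blast
  have [measurable]: "f \<in> borel_measurable borel" by (rule polyf_measurable[OF f])
  define J where "J = (LINT s:{0..1}|lborel. s ^ (CARD('n) - 1) * \<eta> s)"
  have real: "set_integrable lborel (cball 0 1) (\<lambda>x. g (sgn x) * \<eta> (norm x)) \<and>
     set_integrable lborel (cball 0 1) (\<lambda>x. g (sgn x)) \<and>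
     (LINT x:cball 0 1|lborel. g (sgn x) * \<eta> (norm x)) = CARD('n) * (LINT x:cball 0 1|lborel. g (sgn x)) * J"
    if [measurable]: "g \<in> borel_measurable borel" and b: "\<And>x. \<bar>g (sgn x)\<bar> \<le> B" for g :: "real^'n \<Rightarrow> real"
  proof -
    let ?p = "\<lambda>x. max 0 (g x)" and ?m = "\<lambda>x. max 0 (- g x)"
    have pb: "?p (sgn x) \<le> B" "?m (sgn x) \<le> B" for x using b[of x] by auto
    note P = polar_nonneg[of ?p B \<eta>, OF _ _ pb(1) \<eta> int] and M = polar_nonneg[of ?m B \<eta>, OF _ _ pb(2) \<eta> int]
    have gi: "set_integrable lborel (cball 0 1) (\<lambda>x. h (sgn x))"
      if [measurable]: "h \<in> borel_measurable borel" and "\<And>x. 0 \<le> h x" "\<And>x. h (sgn x) \<le> B" for h :: "real^'n \<Rightarrow> real"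
      unfolding set_integrable_def
      by (rule integrableI_bounded_set[of "cball 0 1" _ _ B])
         (use that in \<open>auto simp: indicator_def emeasure_cball_less_top intro!: AE_I2\<close>)
    have pi: "set_integrable lborel (cball 0 1) (\<lambda>x. ?p (sgn x))" by (rule gi) (use pb in auto)
    have mi: "set_integrable lborel (cball 0 1) (\<lambda>x. ?m (sgn x))" by (rule gi) (use pb in auto)
    have e: "g x = ?p x - ?m x" for x by auto
    have e1: "(\<lambda>x. g (sgn x)) = (\<lambda>x. ?p (sgn x) - ?m (sgn x))" by (rule ext) (rule e)
    have e2: "g (sgn x) * \<eta> (norm x) = ?p (sgn x) * \<eta> (norm x) - ?m (sgn x) * \<eta> (norm x)" for x
      using e[of "sgn x"] by (metis left_diff_distrib)
    have a: "set_integrable lborel (cball 0 1) (\<lambda>x. g (sgn x) * \<eta> (norm x))"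
      unfolding e2 by (intro set_integral_diff P M) auto
    have b: "set_integrable lborel (cball 0 1) (\<lambda>x. g (sgn x))"
      by (subst e1, intro set_integral_diff pi mi)
    have c: "(LINT x:cball 0 1|lborel. g (sgn x) * \<eta> (norm x)) = (LINT x:cball 0 1|lborel. ?p (sgn x) * \<eta> (norm x)) - (LINT x:cball 0 1|lborel. ?m (sgn x) * \<eta> (norm x))"
      unfolding e2 by (intro set_integral_diff(2) P M) auto
    have d: "(LINT x:cball 0 1|lborel. g (sgn x)) = (LINT x:cball 0 1|lborel. ?p (sgn x)) - (LINT x:cball 0 1|lborel. ?m (sgn x))"
      by (subst e1, intro set_integral_diff(2) pi mi)
    have "(LINT x:cball 0 1|lborel. g (sgn x) * \<eta> (norm x)) = CARD('n) * (LINT x:cball 0 1|lborel. g (sgn x)) * J"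
      unfolding c d using P(2) M(2) by (simp add: J_def algebra_simps)
    with a b show ?thesis by blast
  qed
  have re: "\<bar>Re (f (sgn x))\<bar> \<le> B" "\<bar>Im (f (sgn x))\<bar> \<le> B" for x
    using B[of x] abs_Re_le_cmod abs_Im_le_cmod order_trans by blast+
  note R = real[of "\<lambda>x. Re (f x)", simplified, OF re(1)] and I = real[of "\<lambda>x. Im (f x)", simplified, OF re(2)]
  have fe: "f (sgn x) * complex_of_real (\<eta> (norm x)) = complex_of_real (Re (f (sgn x)) * \<eta> (norm x)) + \<i> * complex_of_real (Im (f (sgn x)) * \<eta> (norm x))" for x
    by (subst complex_eq[of "f (sgn x)"]) (simp add: algebra_simps)
  have fe': "f (sgn x) = complex_of_real (Re (f (sgn x))) + \<i> * complex_of_real (Im (f (sgn x)))" for x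
    by (rule complex_eq)
  have ofr: "set_integrable lborel (cball 0 1) (\<lambda>x. complex_of_real (h x))"
      "(LINT x:cball 0 1|lborel. complex_of_real (h x)) = complex_of_real (LINT x:cball 0 1|lborel. h x)"
      if "set_integrable lborel (cball 0 1) h" for h :: "real^'n \<Rightarrow> real"
    using that by (auto simp: set_integrable_def set_lebesgue_integral_def scaleR_conv_of_real simp flip: of_real_mult
       intro!: integrable_of_real)
  show ?A unfolding fe
    by (intro set_integral_add(1) set_integrable_mult_right ofr) (use R I in auto)
  have L: "(LINT x:cball 0 1|lborel. f (sgn x)) = complex_of_real (LINT x:cball 0 1|lborel. Re (f (sgn x))) + \<i> * complex_of_real (LINT x:cball 0 1|lborel. Im (f (sgn x)))"
    by (subst fe', subst set_integral_add(2)) (use R I in \<open>auto simp: ofr intro!: set_integrable_mult_right\<close>)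
  have "(LINT x:cball 0 1|lborel. f (sgn x) * complex_of_real (\<eta> (norm x))) =
      complex_of_real (LINT x:cball 0 1|lborel. Re (f (sgn x)) * \<eta> (norm x)) +
      \<i> * complex_of_real (LINT x:cball 0 1|lborel. Im (f (sgn x)) * \<eta> (norm x))"
    unfolding fe by (subst set_integral_add(2))
      (use R I in \<open>auto simp: ofr simp del: of_real_mult intro!: set_integrable_mult_right\<close>)
  also have "\<dots> = sphere_integral f * complex_of_real J"
    using R I by (simp add: L sphere_integral_def algebra_simps)
  finally show ?B by (simp add: J_def)
qed

lemma sphere_add: "polyf f \<Longrightarrow> polyf g \<Longrightarrow> sphere_integral (\<lambda>x. f x + g x) = sphere_integral f + sphere_integral g"
  by (simp add: sphere_integral_def set_integral_add(2)[OF sphere_integrable sphere_integrable] algebra_simps)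

lemma sphere_cmult: "sphere_integral (\<lambda>x. c * f x) = c * sphere_integral f"
  by (simp add: sphere_integral_def)

lemma sphere_zero: "sphere_integral (\<lambda>x. 0) = 0"
  by (simp add: sphere_integral_def)

lemma sphere_sum: "(\<And>i. i \<in> A \<Longrightarrow> polyf (f i)) \<Longrightarrow> sphere_integral (\<lambda>x. \<Sum>i\<in>A. f i x) = (\<Sum>i\<in>A. sphere_integral (f i))"
  by (induction A rule: infinite_finite_induct) (auto simp: sphere_zero sphere_add polyf_sum)

lemma sphere_cong:
  assumes f[measurable]: "f \<in> borel_measurable borel" "g \<in> borel_measurable borel"
    and eq: "\<And>x. norm x = 1 \<Longrightarrow> f x = g x"
  shows "sphere_integral f = sphere_integral (g :: real^'n::finite \<Rightarrow> complex)"
proof -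
  have "AE x in (lborel :: (real^'n) measure). x \<noteq> 0" by (rule AE_lborel_singleton)
  then have "AE x in lborel. indicat_real (cball 0 1) x *\<^sub>R f (sgn x) = indicat_real (cball 0 1) x *\<^sub>R g (sgn x)"
    by eventually_elim (simp add: eq norm_sgn)
  then show ?thesis unfolding sphere_integral_def set_lebesgue_integral_def
    by (subst integral_cong_AE) auto
qed

lemma sphere_nsq_power: assumes "polyf f" shows "sphere_integral (\<lambda>x. nsq x ^ k * f x) = sphere_integral f"
  by (rule sphere_cong)
     (use polyf_measurable[OF polyf_mult[OF polyf_power[OF hp_polyf[OF hp_nsq]] assms]] polyf_measurable[OF assms]
      in \<open>auto simp: nsq_def\<close>)

lemma hp_sgn: "homogeneous_polynomial d f \<Longrightarrow> f x = complex_of_real (norm x) ^ d * f (sgn x)"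
  using hp_scale[of d f "norm x" "sgn x"] by (simp add: sgn_div_norm)
     (cases "x = 0"; simp)

text \<open>A homogeneous factor of degree \<open>d\<close> splits as \<open>|x|\<^sup>d f(x/|x|)\<close> and shifts the exponent of the radial integral.\<close>

lemma polar_hp:
  fixes f :: "real^'n::finite \<Rightarrow> complex" and \<eta> :: "real \<Rightarrow> real"
  assumes f: "homogeneous_polynomial d f"
    and \<eta>[measurable]: "\<eta> \<in> borel_measurable borel"
    and int: "set_integrable lborel {0..1} (\<lambda>s. s ^ (CARD('n) + d - 1) * \<eta> s)"
  shows "set_integrable lborel (cball 0 1) (\<lambda>x. f x * complex_of_real (\<eta> (norm x)))"
    and "(LINT x:cball 0 1|lborel. f x * complex_of_real (\<eta> (norm x))) =
      sphere_integral f * complex_of_real (LINT s:{0..1}|lborel. s ^ (CARD('n) + d - 1) * \<eta> s)"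
proof -
  have e: "s ^ (CARD('n) + d - 1) * \<eta> s = s ^ (CARD('n) - 1) * (s ^ d * \<eta> s)" for s
    using power_add[of s "CARD('n) - 1" d] by (simp add: mult.assoc)
  have e2: "f x * complex_of_real (\<eta> (norm x)) = f (sgn x) * complex_of_real (norm x ^ d * \<eta> (norm x))" for x
    by (subst hp_sgn[OF f]) simp
  show "set_integrable lborel (cball 0 1) (\<lambda>x. f x * complex_of_real (\<eta> (norm x)))"
    "(LINT x:cball 0 1|lborel. f x * complex_of_real (\<eta> (norm x))) =
      sphere_integral f * complex_of_real (LINT s:{0..1}|lborel. s ^ (CARD('n) + d - 1) * \<eta> s)"
    unfolding e2 e
    using polar_polyf[OF hp_polyf[OF f], of "\<lambda>s. s ^ d * \<eta> s"] int unfolding e by simp_all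
qed

lemma set_integrable_Icc_continuous:
  "continuous_on {0..1} (f :: real \<Rightarrow> real) \<Longrightarrow> set_integrable lborel {0..1} f"
  by (rule borel_integrable_atLeastAtMost')

lemma integral_power01: "(LINT s:{0..1}|lborel. s ^ k) = 1 / (real k + 1)"
  using integral_power[of 0 1 k] by (simp add: set_lebesgue_integral_def mult.commute)

section \<open>Integration by parts on the sphere\<close>

text \<open>By translation invariance every difference quotient of \<open>F\<close> in direction \<open>e\<close> integrates to zero; these quotients are bounded
  and supported in a fixed ball, so the integral of their limit \<open>D\<close> is zero as well.\<close>

lemma integral_derivative_zero:
  fixes F D :: "real^'n::finite \<Rightarrow> complex"
  assumes F: "continuous_on UNIV F" and D: "continuous_on UNIV D"
    and der: "\<And>x. ((\<lambda>t. F (x + t *\<^sub>R e)) has_vector_derivative D x) (at 0)"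
    and F0: "\<And>x. norm x > 1 \<Longrightarrow> F x = 0" and D0: "\<And>x. norm x > 1 \<Longrightarrow> D x = 0"
    and e: "norm e = 1"
  shows "(LINT x|lborel. D x) = 0"
proof -
  have [measurable]: "F \<in> borel_measurable borel" "D \<in> borel_measurable borel"
    using F D by (auto intro: borel_measurable_continuous_onI)
  have "compact (D ` cball 0 1)" by (intro compact_continuous_image continuous_on_subset[OF D]) auto
  then obtain B where B': "\<forall>y\<in>D ` cball 0 1. norm y \<le> B" using compact_imp_bounded bounded_iff by blast
  then have "norm (D 0) \<le> B" by auto
  then have "0 \<le> B" using norm_ge_zero order_trans by blast
  then have B: "norm (D x) \<le> B" for x using B' D0[of x] by (cases "norm x \<le> 1") auto
  have der': "((\<lambda>t. F (x + t *\<^sub>R e)) has_vector_derivative D (x + t *\<^sub>R e)) (at t)" for x t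
  proof -
    have "((\<lambda>s. F ((x + t *\<^sub>R e) + s *\<^sub>R e)) has_vector_derivative D (x + t *\<^sub>R e)) (at (t - t))"
      using der[of "x + t *\<^sub>R e"] by simp
    moreover have "((\<lambda>u. u - t) has_vector_derivative 1) (at t)"
      by (auto intro!: derivative_eq_intros simp: has_real_derivative_iff_has_vector_derivative[symmetric])
    ultimately have "(((\<lambda>s. F ((x + t *\<^sub>R e) + s *\<^sub>R e)) \<circ> (\<lambda>u. u - t)) has_vector_derivative 1 *\<^sub>R D (x + t *\<^sub>R e)) (at t)"
      by (intro vector_diff_chain_at) auto
    moreover have "(x + t *\<^sub>R e) + (u - t) *\<^sub>R e = x + u *\<^sub>R e" for u by (simp add: algebra_simps)
    ultimately show ?thesis by (simp add: o_def)
  qed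
  \<comment> \<open>\<open>D\<close> is bounded, so \<open>F\<close> is Lipschitz along \<open>e\<close>; this is the dominating bound for the difference quotients\<close>
  have lip: "norm (F (x + t *\<^sub>R e) - F x) \<le> B * \<bar>t\<bar>" for x t
  proof -
    have "norm ((\<lambda>t. F (x + t *\<^sub>R e)) t - (\<lambda>t. F (x + t *\<^sub>R e)) 0) \<le> B * norm (t - 0)"
    proof (rule differentiable_bound[OF convex_UNIV])
      show "((\<lambda>t. F (x + t *\<^sub>R e)) has_derivative (\<lambda>h. h *\<^sub>R D (x + s *\<^sub>R e))) (at s within UNIV)" for s
        using der'[of x s] by (simp add: has_vector_derivative_def)
      show "onorm (\<lambda>h. h *\<^sub>R D (x + s *\<^sub>R e)) \<le> B" for s
        by (rule onorm_le) (use mult_left_mono[OF B[of "x + s *\<^sub>R e"] abs_ge_zero] in \<open>auto simp: mult.commute\<close>)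
    qed auto
    then show ?thesis by simp
  qed
  define f where "f k x = of_real (real (Suc k)) * (F (x + (1 / real (Suc k)) *\<^sub>R e) - F x)" for k x
  have Fint: "integrable lborel F"
  proof -
    have "compact (F ` cball 0 1)" by (intro compact_continuous_image continuous_on_subset[OF F]) auto
    then obtain M where M: "\<forall>y\<in>F ` cball 0 1. norm y \<le> M" using compact_imp_bounded bounded_iff by blast
    show ?thesis
      by (rule integrableI_bounded_set[of "cball 0 1" _ _ M])
         (use M F0 in \<open>auto simp: emeasure_cball_less_top intro!: AE_I2\<close>)
  qed
  have tr: "lborel = distr lborel borel ((+) c)" for c :: "real^'n"
    using lborel_distr_plus[of c] by simp
  have trI: "(LINT x|lborel. F (x + c)) = (LINT x|lborel. F x)" "integrable lborel (\<lambda>x. F (x + c))" for c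
  proof -
    have "(LINT x|lborel. F x) = (LINT x|distr lborel borel ((+) c). F x)" using tr[of c] by simp
    also have "\<dots> = (LINT x|lborel. F (x + c))" by (subst integral_distr) (auto simp: add.commute)
    finally show "(LINT x|lborel. F (x + c)) = (LINT x|lborel. F x)" by simp
    have "integrable (distr lborel borel ((+) c)) F" using tr[of c] Fint by simp
    then show "integrable lborel (\<lambda>x. F (x + c))" by (subst (asm) integrable_distr_eq) (auto simp: add.commute)
  qed
  have z: "(LINT x|lborel. f k x) = 0" for k
    unfolding f_def using trI Fint by simp
  have "(\<lambda>k. LINT x|lborel. f k x) \<longlonglongrightarrow> (LINT x|lborel. D x)"
  proof (rule integral_dominated_convergence)
    show "integrable lborel (\<lambda>x::real^'n. B * indicat_real (cball 0 2) x)"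
      by (intro integrable_mult_right integrable_real_indicator) (auto simp: emeasure_cball_less_top)
    show "AE x in lborel. (\<lambda>k. f k x) \<longlonglongrightarrow> D x"
    proof (rule AE_I2)
      fix x
      have "((\<lambda>t. (F (x + t *\<^sub>R e) - F x) /\<^sub>R t) \<longlongrightarrow> D x) (at 0)"
      proof (rule LIM_zero_cancel, rule tendsto_norm_zero_cancel)
        have "((\<lambda>t. norm (F (x + (0 + t) *\<^sub>R e) - F (x + 0 *\<^sub>R e) - t *\<^sub>R D x) / norm t) \<longlongrightarrow> 0) (at 0)"
          using der[of x] unfolding has_vector_derivative_def has_derivative_at by blast
        moreover have "eventually (\<lambda>t. norm (F (x + (0 + t) *\<^sub>R e) - F (x + 0 *\<^sub>R e) - t *\<^sub>R D x) / norm t =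
            norm ((F (x + t *\<^sub>R e) - F x) /\<^sub>R t - D x)) (at (0 :: real))"
        proof (rule eventually_at_filter[THEN iffD2], intro always_eventually allI impI)
          fix t :: real assume t: "t \<noteq> 0"
          have "(F (x + t *\<^sub>R e) - F x) /\<^sub>R t - D x = (F (x + t *\<^sub>R e) - F x - t *\<^sub>R D x) /\<^sub>R t"
            using t by (simp add: scaleR_diff_right)
          then show "norm (F (x + (0 + t) *\<^sub>R e) - F (x + 0 *\<^sub>R e) - t *\<^sub>R D x) / norm t =
            norm ((F (x + t *\<^sub>R e) - F x) /\<^sub>R t - D x)" by (simp add: divide_inverse mult.commute)
        qed
        ultimately show "((\<lambda>t. norm ((F (x + t *\<^sub>R e) - F x) /\<^sub>R t - D x)) \<longlongrightarrow> 0) (at 0)"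
          by (rule Lim_transform_eventually)
      qed
      moreover have "filterlim (\<lambda>k. 1 / real (Suc k)) (at 0) sequentially"
        by (rule filterlim_atI) (use LIMSEQ_Suc[OF lim_1_over_n[where 'a=real]] in auto)
      ultimately have "(\<lambda>k. (F (x + (1 / real (Suc k)) *\<^sub>R e) - F x) /\<^sub>R (1 / real (Suc k))) \<longlonglongrightarrow> D x"
        by (rule filterlim_compose)
      then show "(\<lambda>k. f k x) \<longlonglongrightarrow> D x" by (simp add: f_def scaleR_conv_of_real)
    qed
    show "AE x in lborel. norm (f k x) \<le> B * indicat_real (cball 0 2) x" for k
    proof (rule AE_I2)
      fix x
      show "norm (f k x) \<le> B * indicat_real (cball 0 2) x"
      proof (cases "norm x \<le> 2")
        case True
        have "norm (f k x) \<le> real (Suc k) * (B * \<bar>1 / real (Suc k)\<bar>)"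
          unfolding f_def norm_mult norm_of_real using lip[of x "1 / real (Suc k)"] by (intro mult_mono) (auto simp del: of_nat_Suc)
        also have "\<dots> = B" by simp
        finally show ?thesis using True by simp
      next
        case False
        have "norm x \<le> norm (x + (1 / real (Suc k)) *\<^sub>R e) + norm ((1 / real (Suc k)) *\<^sub>R e)"
          using norm_triangle_ineq4[of "x + (1 / real (Suc k)) *\<^sub>R e" "(1 / real (Suc k)) *\<^sub>R e"] by simp
        also have "norm ((1 / real (Suc k)) *\<^sub>R e) \<le> 1" by (simp add: e)
        finally have "norm (x + (1 / real (Suc k)) *\<^sub>R e) > 1" using False by simp
        then show ?thesis using F0 False by (simp add: f_def)
      qed
    qed
  qed (auto simp: f_def)
  then show ?thesis using z by (simp add: LIMSEQ_const_iff)
qed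

text \<open>Integrate the partial derivative of \<open>f(x) (1 - |x|\<^sup>2)\<^sub>+\<^sup>2\<close>, which is continuously differentiable and supported in
  the ball; the square makes the cut-off differentiable across the sphere. Polar coordinates turn the vanishing of this integral into a relation
  between the sphere integrals of \<open>\<partial>\<^sub>j f\<close> and \<open>x\<^sub>j f\<close> with explicit radial factors.\<close>

lemma sphere_ibp:
  fixes f :: "real^'n::finite \<Rightarrow> complex"
  assumes f: "homogeneous_polynomial d f"
  shows "d > 0 \<Longrightarrow> sphere_integral (partial_deriv j f) =
      of_nat (d + CARD('n) - 1) * sphere_integral (\<lambda>x. complex_of_real (x $ j) * f x)"
    and "d = 0 \<Longrightarrow> sphere_integral (\<lambda>x. complex_of_real (x $ j) * f x) = 0"
proof -
  let ?n = "CARD('n)"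
  let ?w = "\<lambda>x::real^'n. max 0 (1 - (norm x)\<^sup>2)"
  have pf: "polyf f" using hp_polyf[OF f] .
  define F where "F x = f x * complex_of_real ((?w x)\<^sup>2)" for x
  define D where "D x = partial_deriv j f x * complex_of_real ((?w x)\<^sup>2) - 4 * (complex_of_real (x $ j) * f x) * complex_of_real (?w x)" for x
  have cF: "continuous_on UNIV F" and cD: "continuous_on UNIV D"
    unfolding F_def D_def using polyf_continuous[OF pf] polyf_continuous[OF polyf_pd[OF pf]]
    by (auto intro!: continuous_intros)
  have w0: "?w x = 0" if "norm x \<ge> 1" for x
    using that by (simp add: max_def abs_square_le_1 not_le)
  \<comment> \<open>the squared positive part is differentiable also at \<open>0\<close>\<close>
  have dsq: "((\<lambda>t. (max 0 t)\<^sup>2) has_real_derivative 2 * max 0 t) (at t)" for t :: real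
  proof -
    consider "t > 0" | "t < 0" | "t = 0" by linarith
    then show ?thesis
    proof cases
      case 1
      have "((\<lambda>t. t\<^sup>2) has_real_derivative 2 * max 0 t) (at t)" using 1 by (auto intro!: derivative_eq_intros)
      moreover have "\<forall>\<^sub>F x in nhds t. x\<^sup>2 = (max 0 x)\<^sup>2"
        using eventually_nhds_in_open[of "{0<..}" t] 1 by (auto elim!: eventually_mono)
      ultimately show ?thesis using DERIV_cong_ev[of t t "\<lambda>x. x\<^sup>2" "\<lambda>x. (max 0 x)\<^sup>2"] by auto
    next
      case 2
      have "((\<lambda>t. 0) has_real_derivative 2 * max 0 t) (at t)" using 2 by (auto intro!: derivative_eq_intros)
      moreover have "\<forall>\<^sub>F x in nhds t. 0 = (max 0 x)\<^sup>2"
        using eventually_nhds_in_open[of "{..<0}" t] 2 by (auto elim!: eventually_mono)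
      ultimately show ?thesis using DERIV_cong_ev[of t t "\<lambda>x. 0" "\<lambda>x. (max 0 x)\<^sup>2"] by auto
    next
      case 3
      have "((\<lambda>h::real. (max 0 h)\<^sup>2 / h) \<longlongrightarrow> 0) (at 0)"
      proof (rule Lim_null_comparison)
        show "\<forall>\<^sub>F h in at 0. norm ((max 0 h)\<^sup>2 / h) \<le> \<bar>h\<bar>"
          by (intro always_eventually allI) (auto simp: max_def power2_eq_square)
        show "((\<lambda>h::real. \<bar>h\<bar>) \<longlongrightarrow> 0) (at 0)" by (auto intro!: tendsto_eq_intros)
      qed
      then show ?thesis unfolding 3 DERIV_def by simp
    qed
  qed
  have nrm: "(norm (x + t *\<^sub>R axis j 1))\<^sup>2 = (norm x)\<^sup>2 + 2 * t * x $ j + t\<^sup>2" for x :: "real^'n" and t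
    by (simp add: power2_norm_eq_inner inner_add_left inner_add_right inner_axis inner_axis' algebra_simps)
       (simp add: power2_eq_square)
  have der: "((\<lambda>t. F (x + t *\<^sub>R axis j 1)) has_vector_derivative D x) (at 0)" for x
  proof -
    have "((\<lambda>t. 1 - ((norm x)\<^sup>2 + 2 * t * x $ j + t\<^sup>2)) has_real_derivative (- 2 * x $ j)) (at 0)"
      by (auto intro!: derivative_eq_intros)
    then have "((\<lambda>t. (max 0 (1 - ((norm x)\<^sup>2 + 2 * t * x $ j + t\<^sup>2)))\<^sup>2) has_real_derivative
        (2 * max 0 (1 - ((norm x)\<^sup>2 + 2 * 0 * x $ j + 0\<^sup>2))) * (- 2 * x $ j)) (at 0)"
      by (rule DERIV_chain2[OF dsq])
    then have "((\<lambda>t. complex_of_real ((?w (x + t *\<^sub>R axis j 1))\<^sup>2)) has_vector_derivative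
        of_real ((2 * max 0 (1 - ((norm x)\<^sup>2 + 2 * 0 * x $ j + 0\<^sup>2))) * (- 2 * x $ j))) (at 0)"
      unfolding nrm by (rule has_vector_derivative_of_real)
    then have w: "((\<lambda>t. complex_of_real ((?w (x + t *\<^sub>R axis j 1))\<^sup>2)) has_vector_derivative
        of_real (- 4 * x $ j * ?w x)) (at 0)" by (simp add: mult_ac)
    have "((\<lambda>t. f (x + t *\<^sub>R axis j 1)) has_vector_derivative partial_deriv j f x) (at 0)"
      using has_pd_pd[OF pf] unfolding has_pd_def by blast
    from has_vector_derivative_mult[OF this w] show ?thesis
      unfolding F_def D_def by (simp add: algebra_simps)
  qed
  have z: "(LINT x|lborel. D x) = 0"
    by (rule integral_derivative_zero[OF cF cD der]) (auto simp: F_def D_def w0 norm_axis_1)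
  have D': "D x = indicator (cball 0 1) x *\<^sub>R (partial_deriv j f x * complex_of_real ((1 - (norm x)\<^sup>2)\<^sup>2)
      - 4 * (complex_of_real (x $ j) * f x * complex_of_real (1 - (norm x)\<^sup>2)))" for x
  proof (cases "norm x \<le> 1")
    case True
    then have "?w x = 1 - (norm x)\<^sup>2" by (simp add: abs_square_le_1)
    then show ?thesis using True by (simp add: D_def algebra_simps)
  next
    case False then show ?thesis using w0[of x] by (simp add: D_def)
  qed
  have xf: "homogeneous_polynomial (1 + d) (\<lambda>x. complex_of_real (x $ j) * f x)"
    by (rule hp_mult[OF hp_coord f])
  note P1 = polar_hp[OF hp_pd[OF f, of j], of "\<lambda>s. (1 - s\<^sup>2)\<^sup>2"]
  note P2 = polar_hp[OF xf, of "\<lambda>s. 1 - s\<^sup>2"]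
  have i1: "set_integrable lborel (cball 0 1) (\<lambda>x. partial_deriv j f x * complex_of_real ((1 - (norm x)\<^sup>2)\<^sup>2))"
    by (rule P1) (auto intro!: set_integrable_Icc_continuous continuous_intros)
  have i2: "set_integrable lborel (cball 0 1) (\<lambda>x. complex_of_real (x $ j) * f x * complex_of_real (1 - (norm x)\<^sup>2))"
    by (rule P2) (auto intro!: set_integrable_Icc_continuous continuous_intros)
  have "0 = (LINT x:cball 0 1|lborel. partial_deriv j f x * complex_of_real ((1 - (norm x)\<^sup>2)\<^sup>2)) -
      4 * (LINT x:cball 0 1|lborel. complex_of_real (x $ j) * f x * complex_of_real (1 - (norm x)\<^sup>2))"
    using z unfolding D' set_lebesgue_integral_def[symmetric]
    by (subst (asm) set_integral_diff(2), intro i1, intro set_integrable_mult_right i2) simp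
  also have "(LINT x:cball 0 1|lborel. complex_of_real (x $ j) * f x * complex_of_real (1 - (norm x)\<^sup>2)) =
     sphere_integral (\<lambda>x. complex_of_real (x $ j) * f x) * complex_of_real (LINT s:{0..1}|lborel. s ^ (?n + (1 + d) - 1) * (1 - s\<^sup>2))"
    by (rule P2) (auto intro!: set_integrable_Icc_continuous continuous_intros)
  also have "(LINT s:{0..1}|lborel. s ^ (?n + (1 + d) - 1) * (1 - s\<^sup>2)) = 2 / ((real (?n + d) + 1) * (real (?n + d) + 3))"
  proof -
    have "s ^ (?n + (1 + d) - 1) * (1 - s\<^sup>2) = s ^ (?n + d) - s ^ (?n + d + 2)" for s :: real
      by (simp add: algebra_simps power_add power2_eq_square)
    then have "(LINT s:{0..1}|lborel. s ^ (?n + (1 + d) - 1) * (1 - s\<^sup>2)) = (LINT s:{0..1}|lborel. s ^ (?n + d)) - (LINT s:{0..1}|lborel. s ^ (?n + d + 2) :: real)"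
      by (simp add: set_integral_diff(2) set_integrable_Icc_continuous continuous_intros)
    also have "\<dots> = 2 / ((real (?n + d) + 1) * (real (?n + d) + 3))"
      unfolding integral_power01 by (simp add: field_simps)
    finally show ?thesis .
  qed
  also have "(LINT x:cball 0 1|lborel. partial_deriv j f x * complex_of_real ((1 - (norm x)\<^sup>2)\<^sup>2)) =
     sphere_integral (partial_deriv j f) * complex_of_real (LINT s:{0..1}|lborel. s ^ (?n + (d - 1) - 1) * (1 - s\<^sup>2)\<^sup>2)"
    by (rule P1) (auto intro!: set_integrable_Icc_continuous continuous_intros)
  finally have key: "sphere_integral (partial_deriv j f) * complex_of_real (LINT s:{0..1}|lborel. s ^ (?n + (d - 1) - 1) * (1 - s\<^sup>2)\<^sup>2) =
     sphere_integral (\<lambda>x. complex_of_real (x $ j) * f x) * complex_of_real (8 / ((real (?n + d) + 1) * (real (?n + d) + 3)))"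
    by simp
  \<comment> \<open>in degree zero the derivative term of the relation is absent\<close>
  show "sphere_integral (\<lambda>x. complex_of_real (x $ j) * f x) = 0" if "d = 0"
  proof -
    have "partial_deriv j f = (\<lambda>x. 0)" using hp_pd_0 f that by blast
    with key that have "sphere_integral (\<lambda>x. complex_of_real (x $ j) * f x) * complex_of_real (8 / ((real ?n + 1) * (real ?n + 3))) = 0"
      by (simp add: sphere_zero)
    moreover have "8 / ((real ?n + 1) * (real ?n + 3)) \<noteq> 0" by simp
    ultimately show ?thesis by (metis mult_eq_0_iff of_real_eq_0_iff)
  qed
  show "sphere_integral (partial_deriv j f) =
      of_nat (d + CARD('n) - 1) * sphere_integral (\<lambda>x. complex_of_real (x $ j) * f x)" if "d > 0"
  proof -
    define k where "k = ?n + d - 2"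
    have nd: "?n + d \<ge> 2" using that by (metis One_nat_def Suc_leI add_mono one_add_one zero_less_card_finite)
    then have k: "?n + (d - 1) - 1 = k" "real (?n + d) = real k + 2" "d + ?n - 1 = Suc k"
      using that by (auto simp: k_def)
    have "s ^ k * (1 - s\<^sup>2)\<^sup>2 = s ^ k - 2 * s ^ (k + 2) + s ^ (k + 4)" for s :: real
      by (simp add: algebra_simps power_add power2_eq_square power4_eq_xxxx)
    then have "(LINT s:{0..1}|lborel. s ^ k * (1 - s\<^sup>2)\<^sup>2) = (LINT s:{0..1}|lborel. s ^ k) - 2 * (LINT s:{0..1}|lborel. s ^ (k + 2)) + (LINT s:{0..1}|lborel. s ^ (k + 4) :: real)"
      by (simp add: set_integral_diff(2) set_integral_add(2) set_integral_diff(1) set_integrable_Icc_continuous continuous_intros)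
    also have "\<dots> = 8 / ((real k + 1) * (real k + 3) * (real k + 5))"
      unfolding integral_power01 by (simp add: divide_simps) (simp add: algebra_simps)
    finally have i: "(LINT s:{0..1}|lborel. s ^ k * (1 - s\<^sup>2)\<^sup>2) = 8 / ((real k + 1) * (real k + 3) * (real k + 5))" .
    have n2: "8 / ((real (?n + d) + 1) * (real (?n + d) + 3)) = real (Suc k) * (8 / ((real k + 1) * (real k + 3) * (real k + 5)))"
      unfolding k(2) by (simp add: divide_simps) (simp add: algebra_simps)
    have "sphere_integral (partial_deriv j f) * complex_of_real (8 / ((real k + 1) * (real k + 3) * (real k + 5))) =
       sphere_integral (\<lambda>x. complex_of_real (x $ j) * f x) * complex_of_real (real (Suc k) * (8 / ((real k + 1) * (real k + 3) * (real k + 5))))"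
      using key unfolding k(1) i n2 .
    moreover have "8 / ((real k + 1) * (real k + 3) * (real k + 5)) > 0"
      by (intro divide_pos_pos mult_pos_pos) auto
    then have "complex_of_real (8 / ((real k + 1) * (real k + 3) * (real k + 5))) \<noteq> 0"
      by (metis less_irrefl of_real_eq_0_iff)
    ultimately show ?thesis unfolding k(3) of_real_mult by (simp only: mult.assoc[symmetric] mult_cancel_right) (simp add: mult.commute)
  qed
qed

section \<open>Orthogonality of spherical harmonics\<close>

lemma hp_pd_Suc: "homogeneous_polynomial (Suc m) f \<Longrightarrow> homogeneous_polynomial m (partial_deriv j f)"
  using hp_pd[of "Suc m" f j] by simp

text \<open>Green's identity on the sphere: integration by parts for \<open>h1 \<partial>\<^sub>j h2\<close>, summed over \<open>j\<close>, gives the radial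
  derivative \<open>b h1 h2\<close> by Euler's identity on one side, and the term \<open>h1 \<Delta>h2\<close> drops out on the other.\<close>

lemma sphere_green:
  fixes h1 h2 :: "real^'n::finite \<Rightarrow> complex"
  assumes h1: "homogeneous_polynomial a h1" and h2: "homogeneous_polynomial b h2"
    and harm: "laplacian h2 = (\<lambda>x. 0)" and ab: "a + b \<ge> 2"
  shows "of_nat (a + b + CARD('n) - 2) * of_nat b * sphere_integral (\<lambda>x. h1 x * h2 x) =
    sphere_integral (\<lambda>x. \<Sum>j\<in>UNIV. partial_deriv j h1 x * partial_deriv j h2 x)"
proof (cases b)
  case 0
  then show ?thesis using hp_pd_0[of h2] h2 by (simp add: sphere_zero)
next
  case (Suc b')
  have p1: "polyf h1" and p2: "polyf h2" using h1 h2 hp_polyf by auto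
  have f: "homogeneous_polynomial (a + b') (\<lambda>x. h1 x * partial_deriv j h2 x)" for j
    using h2 Suc by (intro hp_mult h1 hp_pd_Suc) auto
  have pos: "a + b' > 0" and nn: "a + b' + CARD('n) - 1 = a + b + CARD('n) - 2" using ab Suc by auto
  have i: "sphere_integral (partial_deriv j (\<lambda>x. h1 x * partial_deriv j h2 x)) = of_nat (a + b + CARD('n) - 2) *
     sphere_integral (\<lambda>x. complex_of_real (x $ j) * (h1 x * partial_deriv j h2 x))" for j
    using sphere_ibp(1)[OF f pos, of j] unfolding nn .
  have e: "(\<lambda>x. \<Sum>j\<in>UNIV. partial_deriv j (\<lambda>x. h1 x * partial_deriv j h2 x) x) =
     (\<lambda>x. \<Sum>j\<in>UNIV. partial_deriv j h1 x * partial_deriv j h2 x)"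
    using harm p1 p2 by (simp add: pd_mult polyf_pd sum.distrib sum_distrib_left[symmetric] laplacian_def fun_eq_iff)
  have "sphere_integral (\<lambda>x. \<Sum>j\<in>UNIV. partial_deriv j (\<lambda>x. h1 x * partial_deriv j h2 x) x) =
     of_nat (a + b + CARD('n) - 2) * (\<Sum>j\<in>UNIV. sphere_integral (\<lambda>x. complex_of_real (x $ j) * (h1 x * partial_deriv j h2 x)))"
    using p1 p2 by (subst sphere_sum) (auto simp: i sum_distrib_left intro!: polyf_pd polyf_mult)
  also have "(\<Sum>j\<in>UNIV. sphere_integral (\<lambda>x. complex_of_real (x $ j) * (h1 x * partial_deriv j h2 x))) =
     sphere_integral (\<lambda>x. \<Sum>j\<in>UNIV. complex_of_real (x $ j) * (h1 x * partial_deriv j h2 x))"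
    using p1 p2 by (subst sphere_sum) (auto intro!: polyf_mult polyf_pd polyf_coord)
  also have "(\<lambda>x. \<Sum>j\<in>UNIV. complex_of_real (x $ j) * (h1 x * partial_deriv j h2 x)) = (\<lambda>x. of_nat b * (h1 x * h2 x))"
  proof
    fix x
    have "(\<Sum>j\<in>UNIV. complex_of_real (x $ j) * (h1 x * partial_deriv j h2 x)) = h1 x * (\<Sum>j\<in>UNIV. complex_of_real (x $ j) * partial_deriv j h2 x)"
      by (simp add: sum_distrib_left mult_ac)
    then show "(\<Sum>j\<in>UNIV. complex_of_real (x $ j) * (h1 x * partial_deriv j h2 x)) = of_nat b * (h1 x * h2 x)"
      unfolding euler_identity[OF h2] by (simp add: mult_ac)
  qed
  finally show ?thesis unfolding e by (simp add: sphere_cmult mult_ac)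
qed

text \<open>The right-hand side of Green's identity is symmetric in \<open>h1\<close> and \<open>h2\<close>, so the factors \<open>a\<close> and \<open>b\<close>
  on the left can be exchanged. Degrees with \<open>a + b < 2\<close> leave only linear polynomials, whose integral over the sphere is zero.\<close>

lemma harmonic_orthogonal:
  fixes h1 h2 :: "real^'n::finite \<Rightarrow> complex"
  assumes h1: "homogeneous_polynomial a h1" "laplacian h1 = (\<lambda>x. 0)"
    and h2: "homogeneous_polynomial b h2" "laplacian h2 = (\<lambda>x. 0)" and ab: "a \<noteq> b"
  shows "sphere_integral (\<lambda>x. h1 x * h2 x) = 0"
proof (cases "a + b \<ge> 2")
  case True
  have c: "(\<lambda>x. h2 x * h1 x) = (\<lambda>x. h1 x * h2 x)"
    "(\<lambda>x. \<Sum>j\<in>UNIV. partial_deriv j h2 x * partial_deriv j h1 x) = (\<lambda>x. \<Sum>j\<in>UNIV. partial_deriv j h1 x * partial_deriv j h2 x)"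
    by (simp_all only: mult.commute)
  have ba: "b + a \<ge> 2" using True by simp
  have "of_nat (a + b + CARD('n) - 2) * of_nat b * sphere_integral (\<lambda>x. h1 x * h2 x) =
     of_nat (a + b + CARD('n) - 2) * of_nat a * sphere_integral (\<lambda>x. h1 x * h2 x)"
    using sphere_green[OF h1(1) h2(1) h2(2) True]
      sphere_green[OF h2(1) h1(1) h1(2) ba, unfolded c add.commute[of b a]] by (rule trans[OF _ sym])
  moreover have "a + b + CARD('n) - 2 \<noteq> 0"
  proof -
    have "CARD('n) > 0" by simp
    with True show ?thesis by linarith
  qed
  then have "complex_of_nat (a + b + CARD('n) - 2) \<noteq> 0" by (metis of_nat_eq_0_iff)
  ultimately show ?thesis using ab by auto
next
  case False
  have deg1: "sphere_integral g = 0" if g: "homogeneous_polynomial 1 g" for g :: "real^'n \<Rightarrow> complex"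
  proof -
    have "g x = (\<Sum>j\<in>UNIV. complex_of_real (x $ j) * partial_deriv j g 0)" for x
    proof -
      have "partial_deriv j g x = partial_deriv j g 0" for j
        using hp_0_const[of "partial_deriv j g" x] hp_pd[OF g, of j] by simp
      then have "(\<Sum>j\<in>UNIV. complex_of_real (x $ j) * partial_deriv j g x) = (\<Sum>j\<in>UNIV. complex_of_real (x $ j) * partial_deriv j g 0)"
        by metis
      then show ?thesis unfolding euler_identity[OF g] by simp
    qed
    then have "g = (\<lambda>x. \<Sum>j\<in>UNIV. complex_of_real (x $ j) * partial_deriv j g 0)" by blast
    moreover have "sphere_integral (\<lambda>x. \<Sum>j\<in>UNIV. complex_of_real (x $ j) * partial_deriv j g 0) = 0"
      by (subst sphere_sum) (auto intro!: polyf.intros simp: sphere_ibp(2)[OF hp_const])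
    ultimately show ?thesis by simp
  qed
  have "a + b = 1" using False ab by linarith
  then show ?thesis using deg1[of "\<lambda>x. h1 x * h2 x"] hp_mult[OF h1(1) h2(1)] by simp
qed

section \<open>Powers of linear forms against harmonic polynomials\<close>

definition dir_deriv :: "real^'n::finite \<Rightarrow> (real^'n \<Rightarrow> complex) \<Rightarrow> real^'n \<Rightarrow> complex" where
  "dir_deriv b f x = (\<Sum>j\<in>UNIV. complex_of_real (b $ j) * partial_deriv j f x)"

lemma hp_dir_deriv: "homogeneous_polynomial (Suc m) f \<Longrightarrow> homogeneous_polynomial m (dir_deriv b f)"
  unfolding dir_deriv_def by (intro hp_sum hp_cmult hp_pd_Suc)

lemma dir_deriv_harmonic: assumes "polyf f" "laplacian f = (\<lambda>x. 0)" shows "laplacian (dir_deriv b f) = (\<lambda>x. 0)"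
  unfolding dir_deriv_def
  by (subst lap_sum) (auto simp: assms polyf_pd polyf_cmult lap_cmult lap_pd pd_const)

lemma sphere_lin_mult:
  fixes f :: "real^'n::finite \<Rightarrow> complex"
  assumes f: "homogeneous_polynomial d f" and d: "d > 0"
  shows "of_nat (d + CARD('n) - 1) * sphere_integral (\<lambda>x. lin b x * f x) = sphere_integral (dir_deriv b f)"
proof -
  have p: "polyf f" using hp_polyf[OF f] .
  have "(\<lambda>x. lin b x * f x) = (\<lambda>x. \<Sum>j\<in>UNIV. complex_of_real (b $ j) * (complex_of_real (x $ j) * f x))"
    by (simp add: lin_eq sum_distrib_right sum_distrib_left mult_ac)
  then have "sphere_integral (\<lambda>x. lin b x * f x) = (\<Sum>j\<in>UNIV. complex_of_real (b $ j) * sphere_integral (\<lambda>x. complex_of_real (x $ j) * f x))"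
    using p by (simp add: sphere_sum sphere_cmult polyf_cmult polyf_mult polyf_coord)
  moreover have "sphere_integral (dir_deriv b f) = (\<Sum>j\<in>UNIV. complex_of_real (b $ j) * sphere_integral (partial_deriv j f))"
    unfolding dir_deriv_def using p by (subst sphere_sum) (auto simp: polyf_cmult polyf_pd sphere_cmult)
  ultimately show ?thesis by (simp only: sphere_ibp(1)[OF f d] sum_distrib_left) (simp add: mult_ac)
qed

lemma dir_deriv_lin_power_mult:
  assumes "polyf h"
  shows "dir_deriv b (\<lambda>x. lin b x ^ k * h x) = (\<lambda>x. of_nat k * nsq b * (lin b x ^ (k - 1) * h x) + lin b x ^ k * dir_deriv b h x)"
proof
  fix x
  have pl: "polyf (lin b)" using hp_polyf[OF hp_lin] .
  have "dir_deriv b (\<lambda>x. lin b x ^ k * h x) x =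
    (\<Sum>j\<in>UNIV. complex_of_real (b $ j) * (lin b x ^ k * partial_deriv j h x + of_nat k * lin b x ^ (k - 1) * complex_of_real (b $ j) * h x))"
    unfolding dir_deriv_def using assms pl
    by (simp add: pd_mult polyf_power pd_power pd_lin)
  also have "\<dots> = lin b x ^ k * dir_deriv b h x + of_nat k * lin b x ^ (k - 1) * h x * nsq b"
    by (simp add: dir_deriv_def nsq_eq ring_distribs sum.distrib sum_distrib_left power2_eq_square mult_ac)
  finally show "dir_deriv b (\<lambda>x. lin b x ^ k * h x) x =
    of_nat k * nsq b * (lin b x ^ (k - 1) * h x) + lin b x ^ k * dir_deriv b h x" by (simp add: mult_ac)
qed

text \<open>Integration by parts in direction \<open>b\<close>; differentiation either lowers the power of the linear form or replaces \<open>h\<close> by its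
  derivative along \<open>b\<close>.\<close>

lemma sphere_lin_power_step:
  fixes h :: "real^'n::finite \<Rightarrow> complex"
  assumes h: "homogeneous_polynomial a h" and pos: "k + a > 0"
  shows "of_nat (k + a + CARD('n) - 1) * sphere_integral (\<lambda>x. lin b x ^ Suc k * h x) =
    of_nat k * nsq b * sphere_integral (\<lambda>x. lin b x ^ (k - 1) * h x) + sphere_integral (\<lambda>x. lin b x ^ k * dir_deriv b h x)"
proof -
  have f: "homogeneous_polynomial (k + a) (\<lambda>x. lin b x ^ k * h x)"
    by (intro hp_mult hp_lin_power h)
  have pd: "polyf (dir_deriv b h)" unfolding dir_deriv_def by (auto intro!: polyf_sum polyf_cmult polyf_pd hp_polyf[OF h])
  have ph: "polyf h" using hp_polyf[OF h] .
  have "of_nat (k + a + CARD('n) - 1) * sphere_integral (\<lambda>x. lin b x * (lin b x ^ k * h x)) =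
     sphere_integral (dir_deriv b (\<lambda>x. lin b x ^ k * h x))" using sphere_lin_mult[OF f pos] .
  also have "\<dots> = sphere_integral (\<lambda>x. of_nat k * nsq b * (lin b x ^ (k - 1) * h x)) + sphere_integral (\<lambda>x. lin b x ^ k * dir_deriv b h x)"
    unfolding dir_deriv_lin_power_mult[OF ph]
    by (intro sphere_add polyf_cmult polyf_mult pd ph hp_polyf[OF hp_lin_power])
  finally show ?thesis by (simp add: sphere_cmult mult_ac)
qed

lemma sphere_lin_power_small:
  fixes h :: "real^'n::finite \<Rightarrow> complex"
  assumes "homogeneous_polynomial a h" "laplacian h = (\<lambda>x. 0)" "k < a"
  shows "sphere_integral (\<lambda>x. lin b x ^ k * h x) = 0"
  using assms
proof (induction k arbitrary: a h rule: less_induct)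
  case (less k)
  show ?case
  proof (cases k)
    case 0
    have "sphere_integral (\<lambda>x. 1 * h x) = 0"
      by (rule harmonic_orthogonal[OF hp_const _ less.prems(1,2)])
         (use less.prems(3) in \<open>auto simp: laplacian_def pd_const\<close>)
    then show ?thesis using 0 by simp
  next
    case (Suc l)
    obtain a' where a': "a = Suc a'" using less.prems(3) by (cases a) auto
    have "sphere_integral (\<lambda>x. lin b x ^ (l - 1) * h x) = 0"
      using less.IH[of "l - 1" a h] less.prems Suc by auto
    moreover have "sphere_integral (\<lambda>x. lin b x ^ l * dir_deriv b h x) = 0"
      using less.IH[of l a' "dir_deriv b h"] less.prems Suc a' hp_dir_deriv[of a' h]
        dir_deriv_harmonic[OF hp_polyf] by auto
    moreover have "complex_of_nat (l + a + CARD('n) - 1) \<noteq> 0"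
      using a' by (simp only: of_nat_eq_0_iff) auto
    ultimately show ?thesis using sphere_lin_power_step[OF less.prems(1), of l b] a' Suc by auto
  qed
qed

text \<open>The power \<open>(b \<cdot> x)\<^sup>a\<close> represents evaluation at \<open>b\<close> on harmonic polynomials of degree \<open>a\<close>, up to a
  constant. Each integration by parts replaces \<open>h\<close> by \<open>\<partial>\<^sub>b h\<close>, which is again harmonic and has the value
  \<open>a h(b)\<close> at \<open>b\<close>; the other term has too small a power of the linear form to contribute.\<close>

lemma sphere_lin_power_eq:
  fixes h :: "real^'n::finite \<Rightarrow> complex"
  assumes "homogeneous_polynomial a h" "laplacian h = (\<lambda>x. 0)"
  shows "2 ^ a * pochhammer (of_nat CARD('n) / 2) a * sphere_integral (\<lambda>x. lin b x ^ a * h x) =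
    fact a * sphere_integral (\<lambda>x::real^'n. 1) * h b"
  using assms
proof (induction a arbitrary: h)
  case 0
  have "sphere_integral h = sphere_integral (\<lambda>x::real^'n. h b * 1)"
    by (rule arg_cong[of _ _ sphere_integral], rule ext) (metis hp_0_const[OF 0(1)] mult.right_neutral)
  also have "\<dots> = h b * sphere_integral (\<lambda>x::real^'n. 1)" by (rule sphere_cmult)
  finally show ?case by (simp add: mult.commute)
next
  case (Suc a)
  have "sphere_integral (\<lambda>x. lin b x ^ (a - 1) * h x) = 0"
    using sphere_lin_power_small[OF Suc.prems, of "a - 1"] by auto
  with sphere_lin_power_step[OF Suc.prems(1), of a b]
  have st: "of_nat (a + Suc a + CARD('n) - 1) * sphere_integral (\<lambda>x. lin b x ^ Suc a * h x) = sphere_integral (\<lambda>x. lin b x ^ a * dir_deriv b h x)"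
    by simp
  have IH: "2 ^ a * pochhammer (of_nat CARD('n) / 2) a * sphere_integral (\<lambda>x. lin b x ^ a * dir_deriv b h x) =
    fact a * sphere_integral (\<lambda>x::real^'n. 1) * dir_deriv b h b"
    by (rule Suc.IH) (intro hp_dir_deriv Suc.prems dir_deriv_harmonic hp_polyf[OF Suc.prems(1)])+
  have eu: "dir_deriv b h b = of_nat (Suc a) * h b"
    using euler_identity[OF Suc.prems(1), of b] by (simp add: dir_deriv_def)
  have "2 ^ Suc a * pochhammer (of_nat CARD('n) / 2) (Suc a) * sphere_integral (\<lambda>x. lin b x ^ Suc a * h x) =
    2 ^ a * pochhammer (of_nat CARD('n) / 2) a * (of_nat (a + Suc a + CARD('n) - 1) * sphere_integral (\<lambda>x. lin b x ^ Suc a * h x))"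
    by (simp add: pochhammer_Suc field_simps)
  also have "\<dots> = fact (Suc a) * sphere_integral (\<lambda>x::real^'n. 1) * h b"
    unfolding st IH eu by (simp add: field_simps)
  finally show ?case .
qed

section \<open>Zonal polynomials\<close>

definition geg_coef :: "complex \<Rightarrow> nat \<Rightarrow> nat \<Rightarrow> complex" where
  "geg_coef l b k = (- 1) ^ k * pochhammer l (b + k) * 2 ^ b / (fact k * fact b)"

text \<open>The Gegenbauer polynomial \<open>C\<^sub>a\<^sup>l(u)\<close> made homogeneous: \<open>v\<close> has weight two and compensates the drop in the power
  of \<open>u\<close>. It is the coefficient of \<open>t\<^sup>a\<close> in \<open>(1 - 2 u t + v t\<^sup>2)\<^sup>-\<^sup>l\<close>; below,
  \<open>u = b \<cdot> x\<close> and \<open>v = |b|\<^sup>2|x|\<^sup>2\<close>.\<close>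

definition geg :: "complex \<Rightarrow> nat \<Rightarrow> complex \<Rightarrow> complex \<Rightarrow> complex" where
  "geg l a u v = (\<Sum>k\<le>a div 2. geg_coef l (a - 2 * k) k * u ^ (a - 2 * k) * v ^ k)"

text \<open>The coefficient of \<open>t\<^sup>m\<close> in \<open>(1 - (v t\<^sup>2)\<^sup>p) (1 - 2 u t + v t\<^sup>2)\<^sup>-\<^sup>l\<close>, the
  Poisson kernel along a ray when \<open>l\<close> is half the dimension. For \<open>p = 1\<close> this is the zonal harmonic, with coefficients
  \<open>zonal_coef\<close>.\<close>

definition pzonal :: "complex \<Rightarrow> nat \<Rightarrow> nat \<Rightarrow> complex \<Rightarrow> complex \<Rightarrow> complex" where
  "pzonal l p m u v = geg l m u v - (if 2 * p \<le> m then v ^ p * geg l (m - 2 * p) u v else 0)"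

definition zonal_coef :: "complex \<Rightarrow> nat \<Rightarrow> nat \<Rightarrow> complex" where
  "zonal_coef l b k = geg_coef l b k - (if k = 0 then 0 else geg_coef l b (k - 1))"

lemma zonal_expand: "pzonal l 1 a u v = (\<Sum>k\<le>a div 2. zonal_coef l (a - 2 * k) k * u ^ (a - 2 * k) * v ^ k)"
proof -
  have "(if 2 * 1 \<le> a then v ^ 1 * geg l (a - 2 * 1) u v else 0) =
    (\<Sum>k\<le>a div 2. (if k = 0 then 0 else geg_coef l (a - 2 * k) (k - 1)) * u ^ (a - 2 * k) * v ^ k)"
  proof (cases "2 \<le> a")
    case True
    then obtain N where N: "a div 2 = Suc N" "(a - 2) div 2 = N" by (metis Suc_pred div_greater_zero_iff le_div_geq pos2 diff_Suc_1)
    have "(\<Sum>k\<le>a div 2. (if k = 0 then 0 else geg_coef l (a - 2 * k) (k - 1)) * u ^ (a - 2 * k) * v ^ k) =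
       (\<Sum>k\<le>N. geg_coef l (a - 2 * Suc k) k * u ^ (a - 2 * Suc k) * v ^ Suc k)"
      unfolding N(1) by (subst sum.atMost_Suc_shift) simp
    also have "\<dots> = v * geg l (a - 2) u v" unfolding geg_def N(2)
      by (simp add: sum_distrib_left mult_ac)
    finally show ?thesis using True by simp
  next
    case False then show ?thesis by simp
  qed
  then show ?thesis unfolding pzonal_def geg_def zonal_coef_def
    by (simp only: left_diff_distrib sum_subtractf)
qed

text \<open>From \<open>1 - X\<^sup>p = (1 - X) (1 + X + \<dots> + X\<^sup>p\<^sup>-\<^sup>1)\<close> in the generating function: the kernel of order
  \<open>p\<close> is displayed in its Almansi decomposition.\<close>

lemma pzonal_telescope: "pzonal l p m u v = (\<Sum>k<p. if 2 * k \<le> m then v ^ k * pzonal l 1 (m - 2 * k) u v else 0)"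
proof (induction p)
  case 0 then show ?case by (simp add: pzonal_def)
next
  case (Suc p)
  have "pzonal l (Suc p) m u v - pzonal l p m u v = (if 2 * p \<le> m then v ^ p * pzonal l 1 (m - 2 * p) u v else 0)"
    by (auto simp: pzonal_def algebra_simps)
  then show ?case using Suc by (simp add: algebra_simps)
qed

text \<open>The left-hand side is the coefficient of \<open>|x|\<^sup>2\<^sup>k\<close> times the \<open>b\<close>-th power of the linear form in the Laplacian of
  a zonal polynomial, when \<open>l\<close> is half the dimension.\<close>

lemma zonal_coef_rec:
  "zonal_coef l (b + 2) k * of_nat (b + 2) * of_nat (b + 1) + zonal_coef l b (Suc k) * (2 * of_nat (Suc k) * (2 * of_nat k + 2 * of_nat b + 2 * l)) = 0"
proof -
  have nz: "1 + complex_of_nat k \<noteq> 0" "1 + complex_of_nat b \<noteq> 0" "2 + complex_of_nat b \<noteq> 0" for k b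
    using of_nat_neq_0[of k, where 'a=complex] of_nat_neq_0[of b, where 'a=complex] of_nat_neq_0[of "Suc b", where 'a=complex] by simp_all
  have z1: "zonal_coef l b (Suc k) * fact (Suc k) * fact b = (- 1) ^ Suc k * 2 ^ b * pochhammer l (b + k) * (l + of_nat b + 2 * of_nat k + 1)"
  proof -
    have "geg_coef l b k * fact (Suc k) * fact b = (- 1) ^ k * pochhammer l (b + k) * 2 ^ b * of_nat (Suc k)"
      unfolding geg_coef_def by simp
    moreover have "geg_coef l b (Suc k) * fact (Suc k) * fact b = (- 1) ^ Suc k * (pochhammer l (b + k) * (l + of_nat (b + k))) * 2 ^ b"
      unfolding geg_coef_def by (simp add: pochhammer_Suc nz)
    ultimately show ?thesis unfolding zonal_coef_def by (simp only: left_diff_distrib) (simp add: algebra_simps)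
  qed
  have z2: "zonal_coef l (b + 2) k * fact k * fact (b + 2) = (- 1) ^ k * 2 ^ (b + 2) * pochhammer l (Suc (b + k)) * (l + of_nat b + 2 * of_nat k + 1)"
  proof (cases k)
    case 0 then show ?thesis unfolding zonal_coef_def geg_coef_def by (simp add: pochhammer_Suc mult_ac nz)
  next
    case (Suc i)
    have "geg_coef l (b + 2) i * fact (Suc i) * fact (b + 2) = (- 1) ^ i * pochhammer l (b + 2 + i) * 2 ^ (b + 2) * of_nat (Suc i)"
      unfolding geg_coef_def by (simp add: nz)
    moreover have "geg_coef l (b + 2) (Suc i) * fact (Suc i) * fact (b + 2) = (- 1) ^ Suc i * (pochhammer l (b + 2 + i) * (l + of_nat (b + 2 + i))) * 2 ^ (b + 2)"
      unfolding geg_coef_def by (simp add: pochhammer_Suc nz)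
    ultimately show ?thesis unfolding zonal_coef_def Suc by (simp only: left_diff_distrib) (simp add: algebra_simps)
  qed
  have f: "fact (b + 2) = of_nat (b + 2) * of_nat (b + 1) * (fact b :: complex)" by (simp add: algebra_simps)
  have fs: "fact (Suc k) = of_nat (Suc k) * (fact k :: complex)" by simp
  have "(zonal_coef l (b + 2) k * of_nat (b + 2) * of_nat (b + 1) + zonal_coef l b (Suc k) * (2 * of_nat (Suc k) * (2 * of_nat k + 2 * of_nat b + 2 * l))) * (fact k * fact b) =
     zonal_coef l (b + 2) k * fact k * fact (b + 2) + zonal_coef l b (Suc k) * fact (Suc k) * fact b * (2 * (2 * (of_nat k + of_nat b + l)))"
    unfolding f fs by (simp only: ring_distribs) (simp only: mult_ac)
  also have "\<dots> = 0" unfolding z1 z2 by (simp add: pochhammer_Suc)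
  finally show ?thesis by simp
qed

lemma hp_lin_nsq_term:
  fixes b :: "real^'n::finite"
  shows "2 * k \<le> m \<Longrightarrow> homogeneous_polynomial m (\<lambda>x. c * lin b x ^ (m - 2 * k) * (nsq b * nsq x) ^ k)"
proof -
  assume "2 * k \<le> m"
  have "homogeneous_polynomial (m - 2 * k + 2 * k) (\<lambda>x. nsq x ^ k * ((c * nsq b ^ k) * lin b x ^ (m - 2 * k)))"
    by (intro hp_nsq_power_mult hp_cmult hp_lin_power)
  with \<open>2 * k \<le> m\<close> show ?thesis by (simp add: power_mult_distrib mult_ac)
qed

lemma hp_geg: "homogeneous_polynomial m (\<lambda>x. geg l m (lin b x) (nsq b * nsq x))"
  unfolding geg_def by (intro hp_sum hp_lin_nsq_term) auto

lemma hp_pzonal: "homogeneous_polynomial m (\<lambda>x. pzonal l p m (lin b x) (nsq b * nsq x))"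
proof -
  have "homogeneous_polynomial m (\<lambda>x. (if 2 * p \<le> m then (nsq b * nsq x) ^ p * geg l (m - 2 * p) (lin b x) (nsq b * nsq x) else 0))"
  proof (cases "2 * p \<le> m")
    case True
    have "homogeneous_polynomial (m - 2 * p + 2 * p) (\<lambda>x. nsq x ^ p * (nsq b ^ p * geg l (m - 2 * p) (lin b x) (nsq b * nsq x)))"
      by (intro hp_nsq_power_mult hp_cmult hp_geg)
    with True show ?thesis by (simp add: power_mult_distrib mult_ac)
  qed (simp add: hp_zero)
  then have "homogeneous_polynomial m (\<lambda>x. geg l m (lin b x) (nsq b * nsq x) + (- 1) * (if 2 * p \<le> m then (nsq b * nsq x) ^ p * geg l (m - 2 * p) (lin b x) (nsq b * nsq x) else 0))"
    by (intro hp_add hp_geg hp_cmult)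
  then show ?thesis by (simp add: pzonal_def)
qed

text \<open>The Laplacian of \<open>|x|\<^sup>2\<^sup>k (b \<cdot> x)\<^sup>e\<close> has two terms, \<open>A k\<close> from the linear form and
  \<open>B k\<close> from the norm; \<open>A k\<close> cancels against \<open>B (Suc k)\<close>, and the two unpaired terms have vanishing
  factors.\<close>

lemma zonal_harmonic:
  "laplacian (\<lambda>x::real^'n::finite. pzonal (of_nat CARD('n) / 2) 1 a (lin b x) (nsq b * nsq x)) = (\<lambda>x. 0)"
proof
  fix x :: "real^'n"
  let ?l = "of_nat CARD('n) / 2 :: complex" let ?z = "zonal_coef ?l" let ?N = "a div 2"
  let ?t = "\<lambda>k x. (?z (a - 2 * k) k * nsq b ^ k) * (nsq x ^ k * lin b x ^ (a - 2 * k))"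
  define A where "A k = ?z (a - 2 * k) k * nsq b ^ k * (nsq x ^ k * (of_nat (a - 2 * k) * of_nat (a - 2 * k - 1) * nsq b * lin b x ^ (a - 2 * k - 2)))" for k
  define B where "B k = ?z (a - 2 * k) k * nsq b ^ k * (2 * of_nat k * (2 * of_nat k + 2 * of_nat (a - 2 * k) + of_nat CARD('n) - 2) * nsq x ^ (k - 1) * lin b x ^ (a - 2 * k))" for k
  have pt: "polyf (\<lambda>x. nsq x ^ k * lin b x ^ e)" for k e
    by (rule hp_polyf[OF hp_nsq_power_mult[OF hp_lin_power]])
  have "(\<lambda>x. pzonal ?l 1 a (lin b x) (nsq b * nsq x)) = (\<lambda>x. \<Sum>k\<le>?N. ?t k x)"
    by (simp add: zonal_expand power_mult_distrib mult_ac del: One_nat_def)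
  then have "laplacian (\<lambda>x. pzonal ?l 1 a (lin b x) (nsq b * nsq x)) x = (\<Sum>k\<le>?N. laplacian (?t k) x)"
    by (simp only:) (subst lap_sum, intro polyf_cmult pt, rule refl)
  also have "\<dots> = (\<Sum>k\<le>?N. A k + B k)"
    by (intro sum.cong refl, subst lap_cmult[OF pt], subst lap_nsq_power_mult[OF hp_lin_power], subst lap_lin_power)
       (simp add: A_def B_def algebra_simps)
  also have "\<dots> = B 0 + A ?N + (\<Sum>k<?N. A k + B (Suc k))"
  proof -
    have "(\<Sum>k\<le>N. A k + B k) = B 0 + A N + (\<Sum>k<N. A k + B (Suc k))" for N
      by (induction N) (auto simp: algebra_simps)
    then show ?thesis .
  qed
  also have "B 0 = 0" by (simp add: B_def)
  also have "A ?N = 0"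
  proof -
    have "a - 2 * ?N = 0 \<or> a - 2 * ?N - 1 = 0" by presburger
    then show ?thesis by (auto simp: A_def)
  qed
  also have "(\<Sum>k<?N. A k + B (Suc k)) = 0"
  proof (rule sum.neutral, safe)
    fix k assume "k < ?N"
    define e where "e = a - 2 * Suc k"
    have e: "a - 2 * k = e + 2" "a - 2 * Suc k = e" using \<open>k < ?N\<close> by (auto simp: e_def)
    have c: "2 * of_nat (Suc k) + 2 * of_nat e + of_nat CARD('n) - 2 = 2 * of_nat k + 2 * of_nat e + 2 * ?l" by simp
    have "A k + B (Suc k) = (?z (e + 2) k * of_nat (e + 2) * of_nat (e + 1) + ?z e (Suc k) * (2 * of_nat (Suc k) * (2 * of_nat k + 2 * of_nat e + 2 * ?l))) *
       (nsq b ^ Suc k * nsq x ^ k * lin b x ^ e)"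
      unfolding A_def B_def e c by (simp only: add_diff_cancel_right' diff_Suc_1 ring_distribs) (simp add: algebra_simps)
    then show "A k + B (Suc k) = 0" unfolding zonal_coef_rec by simp
  qed
  finally show "laplacian (\<lambda>x. pzonal ?l 1 a (lin b x) (nsq b * nsq x)) x = 0" by simp
qed

text \<open>On the sphere the powers of \<open>|x|\<^sup>2\<close> disappear, and only the leading power \<open>(b \<cdot> x)\<^sup>a\<close> is not orthogonal
  to \<open>h\<close>. Its coefficient \<open>2\<^sup>a (n/2)\<^sub>a / a!\<close> is the reciprocal of the constant in
  \<open>sphere_lin_power_eq\<close>. The case \<open>a \<noteq> c\<close> is orthogonality.\<close>

lemma zonal_reproducing:
  fixes h :: "real^'n::finite \<Rightarrow> complex"
  assumes h: "homogeneous_polynomial a h" "laplacian h = (\<lambda>x. 0)"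
  shows "sphere_integral (\<lambda>x. h x * pzonal (of_nat CARD('n) / 2) 1 c (lin b x) (nsq b * nsq x)) =
    (if a = c then sphere_integral (\<lambda>x::real^'n. 1) * h b else 0)"
proof (cases "a = c")
  case False
  then show ?thesis using harmonic_orthogonal[OF h hp_pzonal zonal_harmonic] by simp
next
  case True
  let ?l = "of_nat CARD('n) / 2 :: complex" let ?z = "zonal_coef ?l"
  have p: "polyf (\<lambda>x. lin b x ^ e * h x)" for e
    by (intro polyf_mult hp_polyf[OF h(1)] hp_polyf[OF hp_lin_power])
  have p2: "polyf (\<lambda>x. nsq x ^ k * (lin b x ^ e * h x))" for e k
    by (intro polyf_mult p hp_polyf[OF hp_power[OF hp_nsq]])
  have "(\<lambda>x. h x * pzonal ?l 1 c (lin b x) (nsq b * nsq x)) =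
     (\<lambda>x. \<Sum>k\<le>a div 2. (?z (a - 2 * k) k * nsq b ^ k) * (nsq x ^ k * (lin b x ^ (a - 2 * k) * h x)))"
    unfolding zonal_expand by (simp add: True sum_distrib_left power_mult_distrib mult_ac)
  then have "sphere_integral (\<lambda>x. h x * pzonal ?l 1 c (lin b x) (nsq b * nsq x)) =
     (\<Sum>k\<le>a div 2. (?z (a - 2 * k) k * nsq b ^ k) * sphere_integral (\<lambda>x. lin b x ^ (a - 2 * k) * h x))"
    by (simp only:) (subst sphere_sum, intro polyf_cmult p2, simp only: sphere_cmult sphere_nsq_power[OF p])
  also have "\<dots> = (\<Sum>k\<le>a div 2. if k = 0 then ?z a 0 * sphere_integral (\<lambda>x. lin b x ^ a * h x) else 0)"
  proof (rule sum.cong[OF refl])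
    fix k assume k: "k \<in> {..a div 2}"
    show "(?z (a - 2 * k) k * nsq b ^ k) * sphere_integral (\<lambda>x. lin b x ^ (a - 2 * k) * h x) =
      (if k = 0 then ?z a 0 * sphere_integral (\<lambda>x. lin b x ^ a * h x) else 0)"
    proof (cases "k = 0")
      case False
      then have "a - 2 * k < a" using k by auto
      then show ?thesis using sphere_lin_power_small[OF h] False by simp
    qed simp
  qed
  also have "\<dots> = ?z a 0 * sphere_integral (\<lambda>x. lin b x ^ a * h x)" by (simp add: sum.delta)
  also have "?z a 0 = pochhammer ?l a * 2 ^ a / fact a" by (simp add: zonal_coef_def geg_coef_def)
  also have "pochhammer ?l a * 2 ^ a / fact a * sphere_integral (\<lambda>x. lin b x ^ a * h x) =
    (2 ^ a * pochhammer ?l a * sphere_integral (\<lambda>x. lin b x ^ a * h x)) / fact a" by simp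
  also have "\<dots> = sphere_integral (\<lambda>x::real^'n. 1) * h b"
    unfolding sphere_lin_power_eq[OF h] by simp
  finally show ?thesis using True by simp
qed

lemma pzonal_polyharmonic:
  "(laplacian ^^ p) (\<lambda>x::real^'n::finite. pzonal (of_nat CARD('n) / 2) p m (lin b x) (nsq b * nsq x)) = (\<lambda>x. 0)"
proof -
  let ?l = "of_nat CARD('n) / 2 :: complex"
  let ?Z = "\<lambda>c x::real^'n. pzonal ?l 1 c (lin b x) (nsq b * nsq x)"
  have lapk: "(laplacian ^^ j) (\<lambda>x. nsq x ^ k * g x) = (\<lambda>x. 0)"
    if g: "homogeneous_polynomial a g" "laplacian g = (\<lambda>x. 0)" and kj: "k < j" for k j a and g :: "real^'n \<Rightarrow> complex"
  proof -
    obtain c where c: "(laplacian ^^ k) (\<lambda>x. nsq x ^ k * g x) = (\<lambda>x. c * g x)"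
      using lap_iter_nsq_power[OF g] by blast
    obtain i where i: "j = i + Suc k" using kj by (metis Suc_leI le_add_diff_inverse2)
    have "(laplacian ^^ j) (\<lambda>x. nsq x ^ k * g x) = (laplacian ^^ i) (laplacian ((laplacian ^^ k) (\<lambda>x. nsq x ^ k * g x)))"
      unfolding i funpow_add by simp
    also have "\<dots> = (\<lambda>x. 0)" unfolding c lap_cmult[OF hp_polyf[OF g(1)]] g(2) by (simp add: lap_iter_zero)
    finally show ?thesis .
  qed
  have e: "(\<lambda>x. pzonal ?l p m (lin b x) (nsq b * nsq x)) =
     (\<lambda>x. \<Sum>k<p. (if 2 * k \<le> m then nsq b ^ k else 0) * (nsq x ^ k * ?Z (m - 2 * k) x))"
    by (subst pzonal_telescope) (auto simp: power_mult_distrib mult_ac simp del: One_nat_def intro!: sum.cong)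
  show ?thesis unfolding e
    by (subst lap_iter_sum, intro polyf_cmult hp_polyf[OF hp_nsq_power_mult[OF hp_pzonal]],
        simp add: lap_iter_cmult[OF hp_polyf[OF hp_nsq_power_mult[OF hp_pzonal]]] lapk[OF hp_pzonal zonal_harmonic] del: One_nat_def)
qed

text \<open>Both factors are expanded in harmonics, \<open>q\<close> by Almansi and the kernel by telescoping, so the integral is a double sum in which the terms
  with unequal degrees \<open>m - 2i \<noteq> m' - 2k\<close> vanish. For \<open>m = m'\<close> the diagonal reassembles \<open>q b\<close>.\<close>

lemma pzonal_pairing:
  fixes q :: "real^'n::finite \<Rightarrow> complex"
  assumes q: "homogeneous_polynomial m q" "(laplacian ^^ p) q = (\<lambda>x. 0)"
  shows "m = m' \<Longrightarrow> sphere_integral (\<lambda>x. q x * pzonal (of_nat CARD('n) / 2) p m' (lin b x) (nsq b * nsq x)) =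
      sphere_integral (\<lambda>x::real^'n. 1) * q b" (is "_ \<Longrightarrow> ?A")
    and "(\<And>i k. i < p \<Longrightarrow> k < p \<Longrightarrow> m + 2 * k \<noteq> m' + 2 * i) \<Longrightarrow>
      sphere_integral (\<lambda>x. q x * pzonal (of_nat CARD('n) / 2) p m' (lin b x) (nsq b * nsq x)) = 0" (is "PROP _ \<Longrightarrow> ?B")
proof -
  let ?l = "of_nat CARD('n) / 2 :: complex"
  let ?Z = "\<lambda>c x::real^'n. pzonal ?l 1 c (lin b x) (nsq b * nsq x)"
  obtain h where h: "\<And>k. k < p \<Longrightarrow> homogeneous_polynomial (m - 2 * k) (h k)" "\<And>k. k < p \<Longrightarrow> laplacian (h k) = (\<lambda>x. 0)"
      "\<And>k. k < p \<Longrightarrow> m < 2 * k \<Longrightarrow> h k = (\<lambda>x. 0)" and qe: "\<And>x. q x = (\<Sum>k<p. nsq x ^ k * h k x)"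
    using almansi_decomposition[OF q] by blast
  \<comment> \<open>the value of the \<open>(i, k)\<close> term, which survives only if \<open>m - 2 * i = m' - 2 * k\<close> without truncation\<close>
  define J where "J i k = (if 2 * i \<le> m \<and> 2 * k \<le> m' \<and> m + 2 * k = m' + 2 * i then nsq b ^ k * (sphere_integral (\<lambda>x::real^'n. 1) * h i b) else 0)" for i k
  have t: "polyf (\<lambda>x. h i x * ?Z c x)" if "i < p" for i c
    using that by (intro polyf_mult hp_polyf[OF h(1)] hp_polyf[OF hp_pzonal])
  have t2: "polyf (\<lambda>x. nsq x ^ e * (h i x * ?Z c x))" if "i < p" for i c e
    using that by (intro polyf_mult[OF _ t] hp_polyf[OF hp_power[OF hp_nsq]])
  have "(\<lambda>x. q x * pzonal ?l p m' (lin b x) (nsq b * nsq x)) =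
    (\<lambda>x. \<Sum>i<p. \<Sum>k<p. (if 2 * k \<le> m' then nsq b ^ k else 0) * (nsq x ^ (i + k) * (h i x * ?Z (m' - 2 * k) x)))"
    unfolding qe by (subst pzonal_telescope) (auto simp: sum_product power_mult_distrib power_add mult_ac fun_eq_iff simp del: One_nat_def intro!: sum.cong)
  then have "sphere_integral (\<lambda>x. q x * pzonal ?l p m' (lin b x) (nsq b * nsq x)) =
    (\<Sum>i<p. sphere_integral (\<lambda>x. \<Sum>k<p. (if 2 * k \<le> m' then nsq b ^ k else 0) * (nsq x ^ (i + k) * (h i x * ?Z (m' - 2 * k) x))))"
    by (simp only:) (rule sphere_sum, intro polyf_sum polyf_cmult t2, simp)
  also have "\<dots> = (\<Sum>i<p. \<Sum>k<p. (if 2 * k \<le> m' then nsq b ^ k else 0) * sphere_integral (\<lambda>x. h i x * ?Z (m' - 2 * k) x))"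
  proof (rule sum.cong[OF refl])
    fix i assume "i \<in> {..<p}"
    then have i: "i < p" by simp
    show "sphere_integral (\<lambda>x. \<Sum>k<p. (if 2 * k \<le> m' then nsq b ^ k else 0) * (nsq x ^ (i + k) * (h i x * ?Z (m' - 2 * k) x))) =
      (\<Sum>k<p. (if 2 * k \<le> m' then nsq b ^ k else 0) * sphere_integral (\<lambda>x. h i x * ?Z (m' - 2 * k) x))"
      by (subst sphere_sum, intro polyf_cmult t2 i) (simp only: sphere_cmult sphere_nsq_power[OF t[OF i]])
  qed
  also have "\<dots> = (\<Sum>i<p. \<Sum>k<p. J i k)"
  proof (intro sum.cong refl)
    fix i k assume "i \<in> {..<p}" "k \<in> {..<p}"
    then have ik: "i < p" "k < p" by auto
    show "(if 2 * k \<le> m' then nsq b ^ k else 0) * sphere_integral (\<lambda>x. h i x * ?Z (m' - 2 * k) x) = J i k"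
    proof (cases "2 * i \<le> m")
      case True
      have "m - 2 * i = m' - 2 * k \<longleftrightarrow> m + 2 * k = m' + 2 * i" if "2 * k \<le> m'" using True that by linarith
      then show ?thesis using True unfolding J_def zonal_reproducing[OF h(1,2)[OF ik(1)]] by auto
    next
      case False
      then show ?thesis using h(3)[OF ik(1)] by (simp add: J_def sphere_zero)
    qed
  qed
  finally have S: "sphere_integral (\<lambda>x. q x * pzonal ?l p m' (lin b x) (nsq b * nsq x)) = (\<Sum>i<p. \<Sum>k<p. J i k)" .
  show ?B if "\<And>i k. i < p \<Longrightarrow> k < p \<Longrightarrow> m + 2 * k \<noteq> m' + 2 * i"
    unfolding S using that by (intro sum.neutral ballI) (auto simp: J_def)
  show ?A if "m = m'"
  proof -
    have "(\<Sum>k<p. J i k) = sphere_integral (\<lambda>x::real^'n. 1) * (nsq b ^ i * h i b)" if "i < p" for i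
    proof -
      have "(\<Sum>k<p. J i k) = (\<Sum>k<p. if k = i then sphere_integral (\<lambda>x::real^'n. 1) * (nsq b ^ i * h i b) else 0)"
        using h(3)[OF that] \<open>m = m'\<close> by (intro sum.cong) (auto simp: J_def mult_ac)
      then show ?thesis using that by simp
    qed
    then show ?thesis unfolding S qe[of b] by (simp add: sum_distrib_left)
  qed
qed

lemma sphere_one: "sphere_integral (\<lambda>x::real^'n::finite. 1) = complex_of_real (real CARD('n) * unit_ball_vol (real CARD('n)))"
proof -
  have "(LINT x:cball (0::real^'n) 1|lborel. (1::complex)) = complex_of_real (measure lborel (cball (0::real^'n) 1))"
    by (simp add: set_lebesgue_integral_def scaleR_conv_of_real)
  also have "measure lborel (cball (0::real^'n) 1) = unit_ball_vol (real CARD('n))"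
    using content_cball[of 1 "0::real^'n"] by simp
  finally show ?thesis by (simp add: sphere_integral_def)
qed

section \<open>Multivariate power series and their homogeneous parts\<close>

text \<open>Power series at the origin, absolutely convergent up to the closed cube of half side \<open>\<rho>\<close>. A cube is used because absolute
  convergence on it is a single condition on the coefficients, namely at a corner.\<close>

definition ps_repr :: "real \<Rightarrow> (('n::finite \<Rightarrow> nat) \<Rightarrow> complex) \<Rightarrow> (real^'n \<Rightarrow> complex) \<Rightarrow> bool" where
  "ps_repr \<rho> c f \<longleftrightarrow> \<rho> > 0 \<and> (\<lambda>k. norm (c k) * \<rho> ^ sum k UNIV) summable_on UNIV \<and>
     (\<forall>x. (\<forall>j. \<bar>x $ j\<bar> < \<rho>) \<longrightarrow> ((\<lambda>k. c k * complex_of_real (monomial k x)) has_sum f x) UNIV)"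

lemma analytic_ps_repr:
  assumes "real_analytic_on u S" "a \<in> S"
  shows "\<exists>\<rho> c. ps_repr \<rho> c (\<lambda>h. u (a + h :: real^'n::finite)) \<and> (\<forall>h. (\<forall>j. \<bar>h $ j\<bar> \<le> \<rho>) \<longrightarrow>
     ((\<lambda>k. c k * complex_of_real (monomial k h)) has_sum u (a + h)) UNIV)"
proof -
  obtain r c where r: "r > 0" and c: "\<And>x. x \<in> ball a r \<Longrightarrow> ((\<lambda>k. c k * complex_of_real (monomial k (x - a))) has_sum u x) UNIV"
    using assms unfolding real_analytic_on_def by blast
  \<comment> \<open>small enough for the closed cube of half side \<open>\<rho>\<close> to lie in the ball of convergence\<close>
  define \<rho> where "\<rho> = r / (2 * CARD('n))"
  have \<rho>: "\<rho> > 0" using r by (simp add: \<rho>_def)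
  have hs: "((\<lambda>k. c k * complex_of_real (monomial k h)) has_sum u (a + h)) UNIV" if "\<forall>j. \<bar>h $ j\<bar> \<le> \<rho>" for h :: "real^'n"
  proof -
    have "norm h \<le> (\<Sum>j\<in>UNIV. \<bar>h $ j\<bar>)" by (rule norm_le_l1_cart)
    also have "\<dots> \<le> (\<Sum>j\<in>(UNIV::'n set). \<rho>)" using that by (intro sum_mono) auto
    also have "\<dots> < r" using r by (simp add: \<rho>_def)
    finally have "a + h \<in> ball a r" by (simp add: dist_norm)
    from c[OF this] show ?thesis by simp
  qed
  have "(\<lambda>k. norm (c k * complex_of_real (monomial k (\<chi> j. \<rho>)))) summable_on UNIV"
    using hs[of "\<chi> j. \<rho>"] \<rho> by (simp add: summable_on_iff_abs_summable_on_complex[symmetric] has_sum_imp_summable)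
  moreover have "monomial k (\<chi> j. \<rho>) = \<rho> ^ sum k UNIV" for k :: "'n \<Rightarrow> nat"
    by (simp add: monomial_def power_sum)
  ultimately have "(\<lambda>k. norm (c k) * \<rho> ^ sum k UNIV) summable_on UNIV" using \<rho> by (simp add: norm_mult norm_power)
  moreover have "((\<lambda>k. c k * complex_of_real (monomial k x)) has_sum u (a + x)) UNIV" if "\<forall>j. \<bar>x $ j\<bar> < \<rho>" for x :: "real^'n"
    using hs[of x] that less_imp_le by blast
  ultimately show ?thesis using hs \<rho> unfolding ps_repr_def by blast
qed

lemma ps_repr_mono: "ps_repr \<rho> c f \<Longrightarrow> 0 < \<rho>' \<Longrightarrow> \<rho>' \<le> \<rho> \<Longrightarrow> ps_repr \<rho>' c f"
proof -
  assume a: "ps_repr \<rho> c f" "0 < \<rho>'" "\<rho>' \<le> \<rho>"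
  have "(\<lambda>k. norm (c k) * \<rho>' ^ sum k UNIV) summable_on UNIV"
    by (rule summable_on_comparison_test[of "\<lambda>k. norm (c k) * \<rho> ^ sum k UNIV"])
       (use a in \<open>auto simp: ps_repr_def intro!: mult_left_mono power_mono\<close>)
  with a show ?thesis unfolding ps_repr_def by (meson less_le_trans)
qed

lemma ps_repr_add: assumes "ps_repr \<rho> c f" "ps_repr \<rho> d g"
  shows "ps_repr \<rho> (\<lambda>k. c k + d k) (\<lambda>x. f x + g x)"
proof -
  have "(\<lambda>k. norm (c k) * \<rho> ^ sum k UNIV + norm (d k) * \<rho> ^ sum k UNIV) summable_on UNIV"
    using assms by (intro summable_on_add) (auto simp: ps_repr_def)
  then have "(\<lambda>k. norm (c k + d k) * \<rho> ^ sum k UNIV) summable_on UNIV"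
    using assms by (elim summable_on_comparison_test)
      (auto simp: ps_repr_def distrib_right[symmetric] intro!: mult_right_mono norm_triangle_ineq)
  then show ?thesis using assms unfolding ps_repr_def by (auto simp: distrib_right intro: has_sum_add)
qed

lemma ps_repr_zero: "\<rho> > 0 \<Longrightarrow> ps_repr \<rho> (\<lambda>k. 0) (\<lambda>x. 0)"
  unfolding ps_repr_def by auto

lemma ps_repr_sum: "finite A \<Longrightarrow> \<rho> > 0 \<Longrightarrow> (\<And>i. i \<in> A \<Longrightarrow> ps_repr \<rho> (c i) (f i)) \<Longrightarrow> ps_repr \<rho> (\<lambda>k. \<Sum>i\<in>A. c i k) (\<lambda>x. \<Sum>i\<in>A. f i x)"
  by (induction A rule: finite_induct) (auto intro: ps_repr_zero ps_repr_add)

definition pd_coef :: "'n \<Rightarrow> (('n \<Rightarrow> nat) \<Rightarrow> complex) \<Rightarrow> ('n \<Rightarrow> nat) \<Rightarrow> complex" where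
  "pd_coef j c k = of_nat (Suc (k j)) * c (k(j := Suc (k j)))"

lemma suc_half_power: "real (Suc m) * (1 / 2) ^ Suc m \<le> 1"
proof -
  have "Suc m \<le> 2 ^ Suc m" by (rule less_imp_le) (rule less_exp)
  then have "real (Suc m) \<le> 2 ^ Suc m" by (metis of_nat_le_iff of_nat_numeral of_nat_power)
  then show ?thesis by (simp add: field_simps)
qed

lemma sum_upd_Suc: "sum (k(j := Suc (k j))) (UNIV :: 'n::finite set) = Suc (sum k UNIV)"
  using sum_upd[of k j "Suc (k j)"] by simp

lemma bij_upd_Suc: "bij_betw (\<lambda>k. k(j := Suc (k j))) UNIV {k :: 'n \<Rightarrow> nat. k j > 0}"
  by (rule bij_betw_byWitness[of _ "\<lambda>k. k(j := k j - 1)"]) auto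

text \<open>Halving the side absorbs the factor \<open>k\<^sub>j + 1\<close> produced by differentiation, as
  \<open>(N + 1) 2\<^sup>-\<^sup>N\<^sup>-\<^sup>1 \<le> 1\<close>. With the other variables fixed, the series extends to a complex variable near
  \<open>x\<^sub>j\<close>, where uniform limits may be differentiated termwise.\<close>

lemma ps_repr_pd:
  assumes ps: "ps_repr \<rho> c (f :: real^'n::finite \<Rightarrow> complex)"
  shows "ps_repr (\<rho> / 2) (pd_coef j c) (partial_deriv j f)"
proof -
  have \<rho>: "\<rho> > 0" and sm: "(\<lambda>k. norm (c k) * \<rho> ^ sum k UNIV) summable_on UNIV"
    and hs: "\<And>x. (\<And>j. \<bar>x $ j\<bar> < \<rho>) \<Longrightarrow> ((\<lambda>k. c k * complex_of_real (monomial k x)) has_sum f x) UNIV"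
    using ps unfolding ps_repr_def by auto
  have "(\<lambda>k. norm (c k) * \<rho> ^ sum k UNIV) summable_on {k. k j > 0}"
    by (rule summable_on_subset_banach[OF sm]) auto
  then have "(\<lambda>k. norm (c (k(j := Suc (k j)))) * \<rho> ^ sum (k(j := Suc (k j))) UNIV) summable_on UNIV"
    using summable_on_reindex_bij_betw[OF bij_upd_Suc[of j], of "\<lambda>k. norm (c k) * \<rho> ^ sum k UNIV"] by simp
  then have "(\<lambda>k. 2 / \<rho> * (norm (c (k(j := Suc (k j)))) * \<rho> ^ sum (k(j := Suc (k j))) UNIV)) summable_on UNIV"
    by (rule summable_on_cmult_right)
  then have s1: "(\<lambda>k. norm (pd_coef j c k) * (\<rho> / 2) ^ sum k UNIV) summable_on UNIV"
  proof (rule summable_on_comparison_test)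
    fix k :: "'n \<Rightarrow> nat"
    have "k j \<le> sum k UNIV" by (simp add: member_le_sum)
    then have "real (Suc (k j)) \<le> real (Suc (sum k UNIV))" by (metis Suc_le_mono of_nat_le_iff)
    then have "real (Suc (k j)) * (1/2) ^ Suc (sum k UNIV) \<le> real (Suc (sum k UNIV)) * (1/2) ^ Suc (sum k UNIV)"
      by (intro mult_right_mono) auto
    also have "\<dots> \<le> 1" by (rule suc_half_power)
    finally have q: "real (Suc (k j)) * (1/2) ^ Suc (sum k UNIV) \<le> 1" .
    have "norm (pd_coef j c k) * (\<rho> / 2) ^ sum k UNIV = (2 / \<rho> * (norm (c (k(j := Suc (k j)))) * \<rho> ^ Suc (sum k UNIV))) *
        (real (Suc (k j)) * (1/2) ^ Suc (sum k UNIV))"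
      using \<rho> by (simp add: pd_coef_def norm_mult power_divide field_simps del: of_nat_Suc)
    also have "\<dots> \<le> 2 / \<rho> * (norm (c (k(j := Suc (k j)))) * \<rho> ^ Suc (sum k UNIV))"
      using q \<rho> by (intro mult_right_le_one_le) auto
    finally show "norm (pd_coef j c k) * (\<rho> / 2) ^ sum k UNIV \<le> 2 / \<rho> * (norm (c (k(j := Suc (k j)))) * \<rho> ^ sum (k(j := Suc (k j))) UNIV)"
      unfolding sum_upd_Suc .
  qed (use \<rho> in auto)
  have s2: "((\<lambda>k. pd_coef j c k * complex_of_real (monomial k x)) has_sum partial_deriv j f x) UNIV"
    if x: "\<And>i. \<bar>x $ i\<bar> < \<rho> / 2" for x :: "real^'n"
  proof -
    define P where "P k = (\<Prod>i\<in>UNIV - {j}. x $ i ^ k i)" for k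
    define \<phi> where "\<phi> k s = c k * complex_of_real (P k) * s ^ k j" for k s
    define \<phi>' where "\<phi>' k s = c k * complex_of_real (P k) * (of_nat (k j) * s ^ (k j - 1))" for k s
    have Pb: "\<bar>P k\<bar> * \<rho> ^ k j \<le> \<rho> ^ sum k UNIV" for k
    proof -
      have "\<bar>P k\<bar> \<le> (\<Prod>i\<in>UNIV - {j}. \<rho> ^ k i)"
        unfolding P_def abs_prod power_abs[symmetric]
      proof (rule prod_mono, safe)
        fix i show "0 \<le> \<bar>x $ i ^ k i\<bar>" by simp
        have "\<bar>x $ i\<bar> \<le> \<rho>" using x[of i] \<rho> by simp
        then show "\<bar>x $ i ^ k i\<bar> \<le> \<rho> ^ k i" by (simp add: power_abs power_mono)
      qed
      then have "\<bar>P k\<bar> * \<rho> ^ k j \<le> (\<Prod>i\<in>UNIV - {j}. \<rho> ^ k i) * \<rho> ^ k j" using \<rho> by (intro mult_right_mono) auto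
      also have "\<dots> = \<rho> ^ sum k UNIV"
        by (subst power_sum, subst prod.remove[of UNIV j]) auto
      finally show ?thesis .
    qed
    have bound: "norm (\<phi> k s) \<le> norm (c k) * \<rho> ^ sum k UNIV" if "s \<in> cball (complex_of_real (x $ j)) (\<rho> / 2)" for k s
    proof -
      have "norm s \<le> \<bar>x $ j\<bar> + \<rho> / 2"
        using that norm_triangle_ineq2[of s "complex_of_real (x $ j)"] by (simp add: dist_norm norm_minus_commute)
      then have "norm s \<le> \<rho>" using x[of j] by simp
      then have "norm (\<phi> k s) \<le> norm (c k) * (\<bar>P k\<bar> * \<rho> ^ k j)"
        unfolding \<phi>_def by (simp add: norm_mult norm_power mult.assoc mult_left_mono power_mono)
      also have "\<dots> \<le> norm (c k) * \<rho> ^ sum k UNIV" using Pb by (intro mult_left_mono) auto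
      finally show ?thesis .
    qed
    define F where "F s = (\<Sum>\<^sub>\<infinity>k. \<phi> k s)" for s
    have ul: "uniform_limit (cball (complex_of_real (x $ j)) (\<rho> / 2)) (\<lambda>X s. \<Sum>k\<in>X. \<phi> k s) F (finite_subsets_at_top UNIV)"
      unfolding F_def by (rule Weierstrass_m_test_general[OF bound sm]) auto
    have der: "(\<phi> k has_field_derivative \<phi>' k s) (at s)" for k s
      unfolding \<phi>_def \<phi>'_def by (auto intro!: derivative_eq_intros)
    have ev: "\<forall>\<^sub>F X in finite_subsets_at_top UNIV. continuous_on (cball (complex_of_real (x $ j)) (\<rho> / 2)) (\<lambda>s. \<Sum>k\<in>X. \<phi> k s) \<and>
       (\<forall>w\<in>ball (complex_of_real (x $ j)) (\<rho> / 2). ((\<lambda>s. \<Sum>k\<in>X. \<phi> k s) has_field_derivative (\<Sum>k\<in>X. \<phi>' k w)) (at w))"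
      by (intro always_eventually allI conjI ballI DERIV_sum der continuous_on_sum) (auto simp: \<phi>_def intro!: continuous_intros)
    have "\<rho> / 2 > 0" using \<rho> by simp
    from has_complex_derivative_uniform_limit[OF ev ul finite_subsets_at_top_neq_bot this]
    obtain g' where g': "\<And>w. w \<in> ball (complex_of_real (x $ j)) (\<rho> / 2) \<Longrightarrow> (F has_field_derivative g' w) (at w) \<and>
        ((\<lambda>X. \<Sum>k\<in>X. \<phi>' k w) \<longlongrightarrow> g' w) (finite_subsets_at_top UNIV)"
      by blast
    let ?s = "complex_of_real (x $ j)"
    have g: "(F has_field_derivative g' ?s) (at ?s)" "((\<lambda>k. \<phi>' k ?s) has_sum g' ?s) UNIV"
      using g'[of ?s] \<rho> by (auto simp: has_sum_def)
    have dF: "((\<lambda>t. F (complex_of_real (x $ j + t))) has_vector_derivative g' ?s) (at 0)"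
    proof -
      have "((\<lambda>t. F (of_real t)) has_vector_derivative g' ?s) (at (x $ j))"
        using g(1) by (rule has_vector_derivative_real_field)
      then have "((\<lambda>t. F (of_real t)) has_vector_derivative g' ?s) (at (x $ j + 0))" by simp
      moreover have "((\<lambda>t. x $ j + t) has_vector_derivative 1) (at 0)"
        by (auto intro!: derivative_eq_intros simp: has_real_derivative_iff_has_vector_derivative[symmetric])
      ultimately have "((\<lambda>t. F (of_real t)) \<circ> (\<lambda>t. x $ j + t) has_vector_derivative 1 *\<^sub>R g' ?s) (at 0)"
        by (intro vector_diff_chain_at) auto
      then show ?thesis by (simp add: o_def)
    qed
    have feq: "f (x + t *\<^sub>R axis j 1) = F (complex_of_real (x $ j + t))" if t: "t \<in> {-(\<rho>/2)<..<\<rho>/2}" for t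
    proof -
      have "\<bar>(x + t *\<^sub>R axis j 1) $ i\<bar> < \<rho>" for i
        using x[of i] t \<rho> by (cases "i = j") (auto simp: axis_def)
      then have "((\<lambda>k. c k * complex_of_real (monomial k (x + t *\<^sub>R axis j 1))) has_sum f (x + t *\<^sub>R axis j 1)) UNIV" by (rule hs)
      moreover have "c k * complex_of_real (monomial k (x + t *\<^sub>R axis j 1)) = \<phi> k (complex_of_real (x $ j + t))" for k
        unfolding \<phi>_def P_def monomial_insert[of k _ j] by (auto simp: axis_def intro!: prod.cong)
      ultimately show ?thesis unfolding F_def by (simp add: infsumI)
    qed
    from dF have "((\<lambda>t. f (x + t *\<^sub>R axis j 1)) has_vector_derivative g' ?s) (at 0)"
      by (rule has_vector_derivative_transform_within_open[where S = "{-(\<rho>/2)<..<\<rho>/2}"])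
         (use \<rho> feq in auto)
    then have pdx: "partial_deriv j f x = g' ?s" unfolding partial_deriv_def by (rule vector_derivative_at)
    have "((\<lambda>k. \<phi>' k ?s) has_sum g' ?s) {k. k j > 0}"
      using g(2) by (subst has_sum_cong_neutral[of UNIV "{k. k j > 0}"]) (auto simp: \<phi>'_def)
    then have "((\<lambda>k. \<phi>' (k(j := Suc (k j))) ?s) has_sum g' ?s) UNIV"
      using has_sum_reindex_bij_betw[OF bij_upd_Suc[of j], of "\<lambda>k. \<phi>' k ?s"] by simp
    moreover have "\<phi>' (k(j := Suc (k j))) ?s = pd_coef j c k * complex_of_real (monomial k x)" for k
    proof -
      have "P (k(j := Suc (k j))) = P k" unfolding P_def by (auto intro!: prod.cong)
      then show ?thesis unfolding \<phi>'_def pd_coef_def monomial_insert[of k _ j] by (simp add: P_def)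
    qed
    ultimately show ?thesis by (simp add: pdx)
  qed
  show ?thesis unfolding ps_repr_def using \<rho> s1 s2 by auto
qed

definition lap_coef :: "(('n::finite \<Rightarrow> nat) \<Rightarrow> complex) \<Rightarrow> ('n \<Rightarrow> nat) \<Rightarrow> complex" where
  "lap_coef c k = (\<Sum>j\<in>UNIV. pd_coef j (pd_coef j c) k)"

lemma ps_repr_lap: "ps_repr \<rho> c f \<Longrightarrow> ps_repr (\<rho> / 4) (lap_coef c) (laplacian f)"
proof -
  assume a: "ps_repr \<rho> c f"
  then have "\<rho> > 0" by (simp add: ps_repr_def)
  have "ps_repr (\<rho> / 4) (pd_coef j (pd_coef j c)) (partial_deriv j (partial_deriv j f))" for j
    using ps_repr_pd[OF ps_repr_pd[OF a]] by simp
  then show ?thesis unfolding lap_coef_def[abs_def] laplacian_def[abs_def]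
    by (intro ps_repr_sum) (use \<open>\<rho> > 0\<close> in auto)
qed

lemma ps_repr_lap_iter: "ps_repr \<rho> c f \<Longrightarrow> ps_repr (\<rho> / 4 ^ p) ((lap_coef ^^ p) c) ((laplacian ^^ p) f)"
  by (induction p) (use ps_repr_lap in \<open>fastforce simp: field_simps\<close>)+

lemma partial_deriv_zero:
  assumes "open S" "x \<in> S" "\<And>y. y \<in> S \<Longrightarrow> f y = 0"
  shows "partial_deriv j f x = 0"
proof -
  have o: "open ((\<lambda>t. x + t *\<^sub>R axis j 1) -` S)" by (intro open_vimage assms continuous_intros)
  have "((\<lambda>t. f (x + t *\<^sub>R axis j 1)) has_vector_derivative 0) (at 0)"
    by (rule has_vector_derivative_transform_within_open[where f = "\<lambda>_. 0", OF has_vector_derivative_const o])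
       (use assms in auto)
  then show ?thesis unfolding partial_deriv_def by (rule vector_derivative_at)
qed

lemma open_cube: "open {x :: real^'n::finite. \<forall>j. \<bar>x $ j\<bar> < \<rho>}"
proof -
  have "{x :: real^'n. \<forall>j. \<bar>x $ j\<bar> < \<rho>} = (\<Inter>j. {x. \<bar>x $ j\<bar> < \<rho>})" by auto
  also have "open \<dots>" by (intro open_INT) (auto intro!: open_Collect_less continuous_intros)
  finally show ?thesis .
qed

text \<open>Induction on \<open>|k|\<close>: differentiating once in a variable that occurs in \<open>x\<^sup>k\<close> turns the coefficient of
  \<open>x\<^sup>k\<close> into that of a monomial of lower degree.\<close>

lemma ps_repr_unique_zero:
  assumes "ps_repr \<rho> c (f :: real^'n::finite \<Rightarrow> complex)" "\<And>x :: real^'n. (\<And>j. \<bar>x $ j\<bar> < \<rho>) \<Longrightarrow> f x = 0"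
  shows "c k = 0"
  using assms
proof (induction "sum k UNIV" arbitrary: \<rho> c f k)
  case 0
  then have k: "k = (\<lambda>_. 0)" by auto
  have \<rho>: "\<rho> > 0" using 0 by (simp add: ps_repr_def)
  then have hs: "((\<lambda>k. c k * complex_of_real (monomial k 0)) has_sum f 0) UNIV"
    using 0 by (auto simp: ps_repr_def)
  have z: "monomial l (0 :: real^'n) = 0" if ne: "l \<noteq> (\<lambda>_. 0)" for l
  proof -
    obtain j where "l j \<noteq> 0" using ne[unfolded fun_eq_iff] by blast
    then show ?thesis unfolding monomial_insert[of l _ j] by simp
  qed
  have "((\<lambda>k. c k * complex_of_real (monomial k (0 :: real^'n))) has_sum c (\<lambda>_. 0)) UNIV"
    by (rule has_sum_finite_neutralI[of "{\<lambda>_. 0}"]) (auto simp: z monomial_def)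
  with hs have "c (\<lambda>_. 0) = f 0" by (metis has_sum_unique)
  then show ?case using 0 \<rho> k by auto
next
  case (Suc m)
  then obtain j where j: "k j > 0" by (metis (mono_tags, lifting) gr0I nat.distinct(1) sum.neutral)
  define k' where "k' = k(j := k j - 1)"
  have k: "k = k'(j := Suc (k' j))" using j by (auto simp: k'_def)
  have m: "m = sum k' UNIV" using Suc(2) sum_upd_Suc[of k' j] k by simp
  have "pd_coef j c k' = 0"
  proof (rule Suc.hyps(1)[OF m ps_repr_pd[OF Suc.prems(1)]])
    fix x :: "real^'n" assume x: "\<And>j. \<bar>x $ j\<bar> < \<rho> / 2"
    have "\<rho> > 0" using Suc.prems by (simp add: ps_repr_def)
    have "\<bar>x $ j\<bar> < \<rho>" for j using x[of j] \<open>\<rho> > 0\<close> by simp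
    then show "partial_deriv j f x = 0"
      by (intro partial_deriv_zero[OF open_cube[of \<rho>]]) (use Suc.prems(2) in auto)
  qed
  then show ?case using k by (simp add: pd_coef_def del: of_nat_Suc)
qed

definition degree_part :: "nat \<Rightarrow> (('n::finite \<Rightarrow> nat) \<Rightarrow> complex) \<Rightarrow> ('n \<Rightarrow> nat) \<Rightarrow> complex" where
  "degree_part m c k = (if sum k UNIV = m then c k else 0)"

lemma pd_coef_twice: "pd_coef j (pd_coef j c) k = of_nat (Suc (k j)) * of_nat (Suc (Suc (k j))) * c (k(j := Suc (Suc (k j))))"
  by (simp add: pd_coef_def)

lemma degree_part_upd2: "degree_part m c (k(j := Suc (Suc (k j)))) = (if sum k UNIV + 2 = m then c (k(j := Suc (Suc (k j)))) else 0)"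
proof -
  have "sum (k(j := Suc (Suc (k j)))) UNIV = sum k UNIV + 2"
    using sum_upd[of k j "Suc (Suc (k j))"] by linarith
  then show ?thesis by (simp only: degree_part_def)
qed

lemma lap_coef_degree_part: "lap_coef (degree_part m c) k = (if sum k UNIV + 2 = m then lap_coef c k else 0)"
  unfolding lap_coef_def pd_coef_twice degree_part_upd2 by simp

lemma lap_coef_iter_degree_part: "(lap_coef ^^ p) (degree_part m c) k = (if sum k UNIV + 2 * p = m then (lap_coef ^^ p) c k else 0)"
proof (induction p arbitrary: k)
  case 0 then show ?case by (simp add: degree_part_def)
next
  case (Suc p)
  have "(lap_coef ^^ p) (degree_part m c) = (if m \<ge> 2 * p then degree_part (m - 2 * p) ((lap_coef ^^ p) c) else (\<lambda>k. 0))"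
    by (auto simp: fun_eq_iff Suc.IH degree_part_def)
  moreover have "lap_coef (\<lambda>k. 0) = (\<lambda>k :: 'a \<Rightarrow> nat. 0)" by (simp add: lap_coef_def pd_coef_def fun_eq_iff)
  ultimately show ?case by (auto simp: lap_coef_degree_part)
qed

lemma ps_repr_degree_part:
  assumes "\<rho> > 0"
  shows "ps_repr \<rho> (degree_part m c) (\<lambda>x :: real^'n::finite. \<Sum>k | sum k UNIV = m. c k * complex_of_real (monomial k x))"
proof -
  have "((\<lambda>k. degree_part m c k * complex_of_real (monomial k x)) has_sum (\<Sum>k | sum k UNIV = m. c k * complex_of_real (monomial k x))) UNIV" for x :: "real^'n"
    by (rule has_sum_finite_neutralI[of "{k. sum k UNIV = m}"]) (auto simp: finite_multi_index degree_part_def)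
  moreover have "((\<lambda>k :: 'n \<Rightarrow> nat. norm (degree_part m c k) * \<rho> ^ sum k UNIV) has_sum (\<Sum>k | sum k UNIV = m. norm (c k) * \<rho> ^ sum k UNIV)) UNIV"
    by (rule has_sum_finite_neutralI[of "{k. sum k UNIV = m}"]) (auto simp: finite_multi_index degree_part_def)
  ultimately show ?thesis unfolding ps_repr_def using assms by (auto intro: has_sum_imp_summable)
qed

lemma powser_coeff_zero:
  fixes a :: "nat \<Rightarrow> complex"
  assumes "r > 0" and s: "\<And>t::real. \<bar>t\<bar> < r \<Longrightarrow> (\<lambda>n. a n * complex_of_real t ^ n) sums 0"
  shows "a n = 0"
proof (rule ccontr)
  assume n: "a n \<noteq> 0"
  define f where "f z = (\<Sum>n. a n * z ^ n)" for z :: complex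
  have sm: "(\<lambda>n. a n * z ^ n) sums f z" if "norm z < r / 2" for z
  proof -
    have "\<bar>r / 2\<bar> < r" using \<open>r > 0\<close> by simp
    then have "summable (\<lambda>n. a n * complex_of_real (r / 2) ^ n)" by (intro sums_summable[OF s])
    moreover have "norm z < norm (complex_of_real (r / 2))" using that \<open>r > 0\<close> by simp
    ultimately have "summable (\<lambda>n. a n * z ^ n)" by (rule powser_inside)
    then show ?thesis unfolding f_def by (rule summable_sums)
  qed
  have fz: "f (complex_of_real t) = 0" if "\<bar>t\<bar> < r" for t using sums_unique[OF s[OF that]] unfolding f_def by (rule sym)
  have "(\<lambda>n. a n * 0 ^ n) sums 0" using s[of 0] \<open>r > 0\<close> by (simp only: of_real_0 abs_zero)
  then have a0: "a 0 = 0" by (rule sums_unique2[OF powser_sums_zero[of a]])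
  have n0: "n > 0" using n a0 by (cases n) auto
  have r2: "r / 2 > 0" using \<open>r > 0\<close> by simp
  have A: "(\<lambda>n. a n * (x - 0) ^ n) sums f x" if "norm (x - 0) < r / 2" for x
    using sm[of x] that by simp
  have f0: "f 0 = 0" using fz[of 0] \<open>r > 0\<close> by simp
  \<comment> \<open>zeros of a nonzero power series are isolated, but \<open>f\<close> vanishes on a real interval\<close>
  have "\<exists>e>0. \<forall>z\<in>cball 0 e - {0}. f z \<noteq> 0"
  proof (rule powser_0_nonzero[OF r2 A f0 n n0])
    fix e assume e: "0 < e" "\<And>z. z \<in> cball 0 e - {0} \<Longrightarrow> f z \<noteq> 0"
    show ?thesis using e(1) by (intro exI[of _ e] conjI ballI e(2))
  qed
  then obtain e where e: "e > 0" "\<And>z. z \<in> cball 0 e - {0} \<Longrightarrow> f z \<noteq> 0" by blast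
  define t where "t = min e (r / 2)"
  have t: "t > 0" "t \<le> e" "t < r" using e \<open>r > 0\<close> by (auto simp: t_def)
  then show False using e(2)[of "complex_of_real t"] fz[of t] by auto
qed

text \<open>Near the origin the \<open>q\<^sub>m\<close> are the groupings by degree of the Taylor series of \<open>u\<close>, by uniqueness of one-variable power
  series along rays. On coefficients, the iterated Laplacian lowers the degree by \<open>2p\<close>, so \<open>\<Delta>\<^sup>p u = 0\<close> holds
  degree by degree.\<close>

lemma homogeneous_part_polyharmonic:
  fixes u :: "real^'n::finite \<Rightarrow> complex"
  assumes u: "real_analytic_on u (ball 0 1)" and lap: "\<And>x. x \<in> ball 0 1 \<Longrightarrow> (laplacian ^^ p) u x = 0"
    and q: "\<And>m. homogeneous_polynomial m (q m)" and s: "\<And>x. x \<in> ball 0 1 \<Longrightarrow> (\<lambda>m. q m x) sums u x"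
  shows "(laplacian ^^ p) (q m) = (\<lambda>x. 0)"
proof -
  obtain \<rho>0 c where c0: "ps_repr \<rho>0 c u" using analytic_ps_repr[OF u, of 0] by auto
  define \<rho> where "\<rho> = min \<rho>0 (1 / (2 * CARD('n)))"
  have c: "ps_repr \<rho> c u" by (rule ps_repr_mono[OF c0]) (use c0 in \<open>auto simp: \<rho>_def ps_repr_def\<close>)
  have \<rho>: "\<rho> > 0" using c by (simp add: ps_repr_def)
  have cube: "x \<in> ball 0 1" if "\<And>j. \<bar>x $ j\<bar> < \<rho>" for x :: "real^'n"
  proof -
    have "norm x \<le> (\<Sum>j\<in>UNIV. \<bar>x $ j\<bar>)" by (rule norm_le_l1_cart)
    also have "\<dots> \<le> (\<Sum>j\<in>(UNIV::'n set). \<rho>)" using that by (intro sum_mono less_imp_le) auto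
    also have "\<dots> = CARD('n) * \<rho>" by simp
    also have "\<dots> \<le> CARD('n) * (1 / (2 * CARD('n)))" unfolding \<rho>_def by (intro mult_left_mono) auto
    also have "\<dots> < 1" by simp
    finally show ?thesis by simp
  qed
  define g where "g m x = (\<Sum>k | sum k UNIV = m. c k * complex_of_real (monomial k x))" for m and x :: "real^'n"
  have lap_coef0: "(lap_coef ^^ p) c k = 0" for k
  proof (rule ps_repr_unique_zero[OF ps_repr_lap_iter[OF c]])
    fix x :: "real^'n" assume x: "\<And>j. \<bar>x $ j\<bar> < \<rho> / 4 ^ p"
    have "\<rho> / 4 ^ p \<le> \<rho>" using \<rho> by (simp add: field_simps)
    then show "(laplacian ^^ p) u x = 0" using x by (intro lap cube) (meson less_le_trans)
  qed
  have hg: "homogeneous_polynomial m (g m)" for m unfolding homogeneous_polynomial_def g_def by blast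
  have gsum: "(\<lambda>m. g m x) sums u x" if x: "\<And>j. \<bar>x $ j\<bar> < \<rho>" for x :: "real^'n"
  proof -
    have "((\<lambda>k. c k * complex_of_real (monomial k x)) has_sum u x) UNIV" using c x by (auto simp: ps_repr_def)
    moreover have "bij_betw (\<lambda>k::'n \<Rightarrow> nat. (sum k UNIV, k)) UNIV (SIGMA m:UNIV. {k. sum k UNIV = m})"
      by (rule bij_betw_byWitness[of _ snd]) auto
    ultimately have "((\<lambda>(m, k). c k * complex_of_real (monomial k x)) has_sum u x) (SIGMA m:UNIV. {k. sum k UNIV = m})"
      using has_sum_reindex_bij_betw[of "\<lambda>k. (sum k UNIV, k)" UNIV "SIGMA m:UNIV. {k. sum k UNIV = m}" "\<lambda>(m, k). c k * complex_of_real (monomial k x)" "u x"] by simp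
    then have "((\<lambda>m. g m x) has_sum u x) UNIV"
      by (rule has_sum_SigmaD) (auto simp: g_def intro!: has_sum_finite finite_multi_index)
    then show ?thesis by (rule has_sum_imp_sums)
  qed
  have qg: "q m x = g m x" if x: "\<And>j. \<bar>x $ j\<bar> < \<rho>" for m and x :: "real^'n"
  proof -
    have "q m x - g m x = 0"
    proof (rule powser_coeff_zero[of 1])
      fix t :: real assume t: "\<bar>t\<bar> < 1"
      have tx: "\<bar>(t *\<^sub>R x) $ j\<bar> < \<rho>" for j
        using mult_left_le_one_le[of "\<bar>x $ j\<bar>" "\<bar>t\<bar>"] t x[of j] by (simp add: abs_mult)
      have "(\<lambda>m. q m (t *\<^sub>R x) - g m (t *\<^sub>R x)) sums (u (t *\<^sub>R x) - u (t *\<^sub>R x))"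
        using s[OF cube[OF tx]] gsum[OF tx] by (rule sums_diff)
      then show "(\<lambda>m. (q m x - g m x) * complex_of_real t ^ m) sums 0"
        by (simp add: hp_scale[OF q] hp_scale[OF hg] algebra_simps)
    qed simp
    then show ?thesis by simp
  qed
  \<comment> \<open>homogeneous functions that agree near the origin agree everywhere\<close>
  have scale: "f1 = f2" if f: "homogeneous_polynomial d f1" "homogeneous_polynomial d f2" and eq: "\<And>x :: real^'n. (\<And>j. \<bar>x $ j\<bar> < \<rho>') \<Longrightarrow> f1 x = f2 x"
    and "\<rho>' > 0" for f1 f2 :: "real^'n \<Rightarrow> complex" and d \<rho>'
  proof
    fix x :: "real^'n"
    define t where "t = \<rho>' / (norm x + 1)"
    have t: "t > 0" using \<open>\<rho>' > 0\<close> by (auto simp: t_def add_nonneg_pos)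
    have "\<bar>(t *\<^sub>R x) $ j\<bar> < \<rho>'" for j
    proof -
      have "\<bar>(t *\<^sub>R x) $ j\<bar> \<le> norm (t *\<^sub>R x)" by (rule component_le_norm_cart)
      also have "\<dots> = \<rho>' * (norm x / (norm x + 1))" using t \<open>\<rho>' > 0\<close> by (simp add: t_def)
      also have "\<dots> < \<rho>'" using \<open>\<rho>' > 0\<close> by (simp add: divide_less_eq add_nonneg_pos)
      finally show ?thesis .
    qed
    then have "f1 (t *\<^sub>R x) = f2 (t *\<^sub>R x)" by (rule eq)
    then show "f1 x = f2 x" using t by (simp add: hp_scale[OF f(1)] hp_scale[OF f(2)])
  qed
  have "q m = g m" by (rule scale[OF q hg qg \<rho>])
  moreover have "(laplacian ^^ p) (g m) = (\<lambda>x. 0)"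
  proof (rule scale[OF hp_lap_iter[OF hg] hp_zero])
    have ps: "ps_repr (\<rho> / 4 ^ p) (\<lambda>k. 0) ((laplacian ^^ p) (g m))"
    proof -
      have "(lap_coef ^^ p) (degree_part m c) = (\<lambda>k. 0)" by (simp add: fun_eq_iff lap_coef_iter_degree_part lap_coef0)
      moreover have "(\<lambda>x. \<Sum>k | sum k UNIV = m. c k * complex_of_real (monomial k x)) = g m" by (rule ext) (simp add: g_def)
      ultimately show ?thesis using ps_repr_lap_iter[OF ps_repr_degree_part[OF \<rho>, of m c], of p] by simp
    qed
    show "(laplacian ^^ p) (g m) x = 0" if "\<And>j. \<bar>x $ j\<bar> < \<rho> / 4 ^ p" for x :: "real^'n"
      using ps that unfolding ps_repr_def by (metis (mono_tags, lifting) has_sum_0 has_sum_unique mult_zero_left)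
    show "\<rho> / 4 ^ p > 0" using \<rho> by simp
  qed
  ultimately show ?thesis by simp
qed

section \<open>Series and holomorphic families under the integral sign\<close>

text \<open>Termwise integration against \<open>\<phi>\<close>, which carries the integrability; the geometric bound on the series is required only where
  \<open>\<phi>\<close> does not vanish.\<close>

lemma sums_integral_geometric:
  fixes b :: "nat \<Rightarrow> 'a \<Rightarrow> complex"
  assumes \<phi>: "integrable M \<phi>" and [measurable]: "\<And>j. b j \<in> borel_measurable M"
    and \<theta>: "0 \<le> \<theta>" "\<theta> < 1" and C: "0 \<le> C"
    and bound: "\<And>j x. \<phi> x \<noteq> 0 \<Longrightarrow> norm (b j x) \<le> C * \<theta> ^ j"
    and F: "\<And>x. \<phi> x \<noteq> 0 \<Longrightarrow> (\<lambda>j. b j x) sums F x"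
  shows "(\<lambda>j. LINT x|M. b j x * \<phi> x) sums (LINT x|M. F x * \<phi> x)"
    and "integrable M (\<lambda>x. F x * \<phi> x)" and "\<And>j. integrable M (\<lambda>x. b j x * \<phi> x)"
proof -
  have [measurable]: "\<phi> \<in> borel_measurable M" using \<phi> by auto
  have nb: "norm (b j x * \<phi> x) \<le> (C * \<theta> ^ j) * norm (\<phi> x)" for j x
    using bound[of x j] by (cases "\<phi> x = 0") (auto simp: norm_mult mult_right_mono)
  have I: "integrable M (\<lambda>x. b j x * \<phi> x)" for j
    by (rule Bochner_Integration.integrable_bound[of M "\<lambda>x. (C * \<theta> ^ j) * norm (\<phi> x)"])
       (use nb[of j] \<phi> C \<theta> in \<open>auto intro!: AE_I2 integrable_mult_right simp: abs_mult\<close>)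
  have sg: "summable (\<lambda>j. (C * \<theta> ^ j) * c)" for c :: real
    using \<theta> by (intro summable_mult summable_mult2 summable_geometric) auto
  have S1: "AE x in M. summable (\<lambda>j. norm (b j x * \<phi> x))"
    by (intro AE_I2 summable_comparison_test'[OF sg]) (use nb in auto)
  have S2: "summable (\<lambda>j. LINT x|M. norm (b j x * \<phi> x))"
  proof (rule summable_comparison_test'[OF sg[of "LINT x|M. norm (\<phi> x)"]])
    fix j :: nat
    have "(LINT x|M. norm (b j x * \<phi> x)) \<le> (LINT x|M. (C * \<theta> ^ j) * norm (\<phi> x))"
      by (intro integral_mono integrable_norm I integrable_mult_right \<phi> nb)
    then show "norm (LINT x|M. norm (b j x * \<phi> x)) \<le> C * \<theta> ^ j * (LINT x|M. norm (\<phi> x))"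
      by (simp add: integral_nonneg_AE)
  qed
  have s: "(\<Sum>j. b j x * \<phi> x) = F x * \<phi> x" for x
    using sums_mult2[OF F, of x "\<phi> x"] by (cases "\<phi> x = 0") (auto simp: sums_iff)
  have "(\<lambda>j. LINT x|M. b j x * \<phi> x) sums (LINT x|M. (\<Sum>j. b j x * \<phi> x))"
    using integral_suminf[OF I S1 S2] summable_integral[OF I S1 S2] by (simp add: sums_iff)
  then show "(\<lambda>j. LINT x|M. b j x * \<phi> x) sums (LINT x|M. F x * \<phi> x)" by (simp add: s)
  show "integrable M (\<lambda>x. F x * \<phi> x)" using integrable_suminf[OF I S1 S2] by (simp add: s)
  show "\<And>j. integrable M (\<lambda>x. b j x * \<phi> x)" by (rule I)
qed

text \<open>Derivatives in the parameter are limits of difference quotients, hence measurable in the other variable.\<close>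

lemma measurable_deriv_parameter:
  fixes f :: "complex \<Rightarrow> 'a \<Rightarrow> complex"
  assumes "\<And>x. x \<in> A \<Longrightarrow> (\<lambda>w. f w x) holomorphic_on ball z r"
    and m: "\<And>w. w \<in> ball z r \<Longrightarrow> (\<lambda>x. if x \<in> A then f w x else 0) \<in> borel_measurable M"
    and w: "w \<in> ball z r"
  shows "(\<lambda>x. if x \<in> A then (deriv ^^ j) (\<lambda>w. f w x) w else 0) \<in> borel_measurable M"
  using w
proof (induction j arbitrary: w)
  case 0
  then show ?case using m[OF 0] by (simp only: funpow_0)
next
  case (Suc j)
  define g where "g w x = (if x \<in> A then (deriv ^^ j) (\<lambda>w. f w x) w else 0)" for w x
  have hol: "(deriv ^^ j) (\<lambda>w. f w x) holomorphic_on ball z r" if "x \<in> A" for x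
    by (intro holomorphic_higher_deriv assms that) auto
  obtain e where e: "e > 0" "cball w e \<subseteq> ball z r" using Suc.prems open_contains_cball open_ball by blast
  define h where "h k = e / real (Suc k)" for k
  have h: "h k \<noteq> 0" "h k > 0" "h k \<le> e" for k
    using e by (auto simp: h_def field_simps)
  have hlim: "h \<longlonglongrightarrow> 0"
    unfolding h_def using tendsto_mult_left[OF LIMSEQ_Suc[OF lim_1_over_n[where 'a=real]], of e] by simp
  have wh: "w + of_real (h k) \<in> ball z r" for k
    using e(2) h[of k] by (auto simp: dist_norm subset_iff)
  have lim: "(\<lambda>k. (g (w + of_real (h k)) x - g w x) / of_real (h k)) \<longlonglongrightarrow> (if x \<in> A then (deriv ^^ Suc j) (\<lambda>w. f w x) w else 0)" for x
  proof (cases "x \<in> A")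
    case True
    have "((deriv ^^ j) (\<lambda>w. f w x) has_field_derivative deriv ((deriv ^^ j) (\<lambda>w. f w x)) w) (at w)"
      using hol[OF True] Suc.prems holomorphic_derivI open_ball by blast
    then have "((\<lambda>t. ((deriv ^^ j) (\<lambda>w. f w x) (w + t) - (deriv ^^ j) (\<lambda>w. f w x) w) / t) \<longlongrightarrow> deriv ((deriv ^^ j) (\<lambda>w. f w x)) w) (at 0)"
      by (simp add: DERIV_def)
    moreover have "filterlim (\<lambda>k. complex_of_real (h k)) (at 0) sequentially"
      by (rule filterlim_atI) (use tendsto_of_real[OF hlim, where 'a=complex] h in auto)
    ultimately have "(\<lambda>k. ((deriv ^^ j) (\<lambda>w. f w x) (w + of_real (h k)) - (deriv ^^ j) (\<lambda>w. f w x) w) / of_real (h k)) \<longlonglongrightarrow> deriv ((deriv ^^ j) (\<lambda>w. f w x)) w"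
      by (rule filterlim_compose)
    then show ?thesis using True by (simp add: g_def)
  qed (simp add: g_def)
  have gm: "g w \<in> borel_measurable M" "g (w + of_real (h k)) \<in> borel_measurable M" for k
    using Suc.IH[OF Suc.prems] Suc.IH[OF wh] by (simp_all add: g_def[abs_def])
  show ?case
    by (rule borel_measurable_LIMSEQ_metric[OF _ lim]) (use gm in measurable)
qed

text \<open>Cauchy's inequality bounds the Taylor coefficients at the centre uniformly in \<open>x\<close> by a geometric sequence on the disc of half the radius,
  so the Taylor series may be integrated termwise.\<close>

lemma holomorphic_integral_parameter:
  fixes f :: "complex \<Rightarrow> 'a \<Rightarrow> complex"
  assumes hol: "\<And>x. x \<in> A \<Longrightarrow> (\<lambda>w. f w x) holomorphic_on ball z r"
    and m: "\<And>w. w \<in> ball z r \<Longrightarrow> (\<lambda>x. if x \<in> A then f w x else 0) \<in> borel_measurable M"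
    and r: "r > 0" and bound: "\<And>w x. w \<in> ball z r \<Longrightarrow> x \<in> A \<Longrightarrow> norm (f w x) \<le> B"
    and \<phi>: "integrable M \<phi>" and \<phi>A: "\<And>x. x \<notin> A \<Longrightarrow> \<phi> x = 0" and B: "B \<ge> 0"
  shows "(\<lambda>w. LINT x|M. f w x * \<phi> x) holomorphic_on ball z (r / 2)"
    and "\<And>w. w \<in> ball z (r / 2) \<Longrightarrow> (\<lambda>j. (LINT x|M. (deriv ^^ j) (\<lambda>w. f w x) z / fact j * \<phi> x) * (w - z) ^ j) sums (LINT x|M. f w x * \<phi> x)"
proof -
  define b where "b j x = (if x \<in> A then (deriv ^^ j) (\<lambda>w. f w x) z else 0) / fact j" for j x
  have [measurable]: "b j \<in> borel_measurable M" for j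
    unfolding b_def[abs_def] by (intro borel_measurable_divide measurable_deriv_parameter[OF hol m] borel_measurable_const) (use r in auto)
  have bb: "norm (b j x) \<le> B / (r / 2) ^ j" for j x
  proof (cases "x \<in> A")
    case True
    have "norm ((deriv ^^ j) (\<lambda>w. f w x) z) \<le> fact j * B / (r / 2) ^ j"
    proof (rule Cauchy_inequality)
      show "(\<lambda>w. f w x) holomorphic_on ball z (r / 2)" by (rule holomorphic_on_subset[OF hol[OF True]]) (use r in auto)
      show "continuous_on (cball z (r / 2)) (\<lambda>w. f w x)"
        by (rule holomorphic_on_imp_continuous_on, rule holomorphic_on_subset[OF hol[OF True]]) (use r in auto)
      show "norm (f y x) \<le> B" if "norm (z - y) = r / 2" for y
        by (rule bound) (use that r True in \<open>auto simp: dist_norm\<close>)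
    qed (use r in auto)
    then show ?thesis using True by (simp add: b_def norm_divide field_simps)
  qed (use B r in \<open>auto simp: b_def\<close>)
  have eqb: "b j x * \<phi> x = (deriv ^^ j) (\<lambda>w. f w x) z / fact j * \<phi> x" for j x
    using \<phi>A[of x] by (auto simp: b_def)
  show sums: "(\<lambda>j. (LINT x|M. (deriv ^^ j) (\<lambda>w. f w x) z / fact j * \<phi> x) * (w - z) ^ j) sums (LINT x|M. f w x * \<phi> x)"
    if w: "w \<in> ball z (r / 2)" for w
  proof -
    have "(\<lambda>j. LINT x|M. (b j x * (w - z) ^ j) * \<phi> x) sums (LINT x|M. f w x * \<phi> x)"
    proof (rule sums_integral_geometric(1)[OF \<phi>, of _ "norm (w - z) / (r / 2)" B])
      show "norm (w - z) / (r / 2) < 1" using w r by (simp add: dist_norm norm_minus_commute field_simps)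
      show "norm (b j x * (w - z) ^ j) \<le> B * (norm (w - z) / (r / 2)) ^ j" for j x
        using mult_right_mono[OF bb[of j x], of "norm (w - z) ^ j"] by (simp add: norm_mult norm_power power_divide mult_ac)
      fix x assume "\<phi> x \<noteq> 0"
      then have x: "x \<in> A" using \<phi>A by blast
      have "(\<lambda>n. (deriv ^^ n) (\<lambda>w. f w x) z / fact n * (w - z) ^ n) sums f w x"
        by (rule holomorphic_power_series[OF hol[OF x]]) (use w r in auto)
      then show "(\<lambda>j. b j x * (w - z) ^ j) sums f w x" using x by (simp add: b_def)
    qed (use r B in auto)
    moreover have "(LINT x|M. (b j x * (w - z) ^ j) * \<phi> x) = (LINT x|M. (deriv ^^ j) (\<lambda>w. f w x) z / fact j * \<phi> x) * (w - z) ^ j" for j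
    proof -
      have "(LINT x|M. (b j x * (w - z) ^ j) * \<phi> x) = (LINT x|M. (b j x * \<phi> x) * (w - z) ^ j)" by (simp add: mult_ac)
      also have "\<dots> = (LINT x|M. b j x * \<phi> x) * (w - z) ^ j" by (rule integral_mult_left_zero)
      finally show ?thesis unfolding eqb .
    qed
    ultimately show ?thesis by simp
  qed
  show "(\<lambda>w. LINT x|M. f w x * \<phi> x) holomorphic_on ball z (r / 2)"
    by (rule power_series_holomorphic[OF sums])
qed

section \<open>Analytic continuation along rays\<close>

text \<open>Convergence of \<open>\<Sum>m. q m x\<close> to \<open>u x\<close> is assumed pointwise only. The function \<open>\<Phi> w x\<close> below is
  \<open>u (w x)\<close> for real \<open>w\<close>, extended holomorphically to complex dilations \<open>w\<close>.\<close>

locale homogeneous_expansion =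
  fixes u :: "real^'n::finite \<Rightarrow> complex" and q :: "nat \<Rightarrow> real^'n \<Rightarrow> complex"
  assumes analytic: "real_analytic_on u (ball 0 1)"
    and hp: "\<And>m. homogeneous_polynomial m (q m)"
    and expansion: "\<And>x. x \<in> ball 0 1 \<Longrightarrow> (\<lambda>m. q m x) sums u x"
begin

definition \<Phi> :: "complex \<Rightarrow> real^'n \<Rightarrow> complex" where "\<Phi> w x = (\<Sum>m. q m x * w ^ m)"

lemma Phi_sums:
  assumes "norm x \<le> r" "norm w < 1 / r" "r > 0"
  shows "(\<lambda>m. q m x * w ^ m) sums \<Phi> w x"
proof -
  \<comment> \<open>a real dilation strictly larger than \<open>norm w\<close> that still maps \<open>x\<close> into the unit ball\<close>
  define t where "t = (norm w + 1 / r) / 2"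
  have t: "norm w < t" "t < 1 / r" "t > 0" using assms by (auto simp: t_def add_nonneg_pos)
  have "norm (t *\<^sub>R x) \<le> t * r" using assms t by (simp add: mult_left_mono)
  also have "\<dots> < 1" using t assms by (simp add: field_simps)
  finally have "(\<lambda>m. q m (t *\<^sub>R x)) sums u (t *\<^sub>R x)" by (intro expansion) simp
  then have "summable (\<lambda>m. q m x * complex_of_real t ^ m)"
    unfolding hp_scale[OF hp] by (simp add: mult.commute sums_iff)
  moreover have "norm w < norm (complex_of_real t)" using t by simp
  ultimately have "summable (\<lambda>m. q m x * w ^ m)" by (rule powser_inside)
  then show ?thesis unfolding \<Phi>_def by (rule summable_sums)
qed

lemma Phi_real: assumes "norm (t *\<^sub>R x) < 1" shows "\<Phi> (complex_of_real t) x = u (t *\<^sub>R x)"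
proof -
  have "(\<lambda>m. q m (t *\<^sub>R x)) sums u (t *\<^sub>R x)" using assms by (intro expansion) simp
  then show ?thesis unfolding hp_scale[OF hp] \<Phi>_def by (simp add: mult.commute sums_iff)
qed

lemma Phi_holomorphic: "norm x \<le> r \<Longrightarrow> r > 0 \<Longrightarrow> (\<lambda>w. \<Phi> w x) holomorphic_on ball 0 (1 / r)"
  by (rule power_series_holomorphic[where a = "\<lambda>m. q m x"]) (use Phi_sums in auto)

lemma Phi_measurable: assumes "norm w < 1 / r" "r > 0"
  shows "(\<lambda>x. if x \<in> cball 0 r then \<Phi> w x else 0) \<in> borel_measurable lborel"
proof (rule borel_measurable_LIMSEQ_metric)
  show "(\<lambda>x. if x \<in> cball 0 r then \<Sum>m<k. q m x * w ^ m else 0) \<in> borel_measurable lborel" for k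
    using polyf_measurable[OF hp_polyf[OF hp]] borel_closed[OF closed_cball, of 0 r]
    by (intro measurable_If_set) (auto intro!: borel_measurable_sum borel_measurable_times)
  show "(\<lambda>k. if x \<in> cball 0 r then \<Sum>m<k. q m x * w ^ m else 0) \<longlonglongrightarrow> (if x \<in> cball 0 r then \<Phi> w x else 0)" for x
    using Phi_sums[of x r w] assms by (auto simp: sums_def)
qed

text \<open>Along each ray the expansion gives holomorphy in \<open>w\<close> but no bound uniform in \<open>x\<close>. Such a bound comes from the Taylor series
  of \<open>u\<close> at \<open>s x0\<close>: evaluated at complex points near \<open>s x0\<close> it is bounded by the sum \<open>M\<close> of the
  absolute values of its terms at a corner of the cube, and it coincides with \<open>\<Phi> w x\<close> because both are holomorphic in
  \<open>w\<close> and equal to \<open>u (w x)\<close> for real \<open>w\<close>.\<close>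

lemma Phi_locally_bounded:
  assumes r: "0 < r" and s: "0 \<le> s" "s < 1 / r" and x0: "norm x0 \<le> r"
  shows "\<exists>\<delta>>0. \<exists>\<epsilon>>0. \<exists>M. \<delta> \<le> 1 / r - s \<and> (\<forall>x\<in>cball 0 r. dist x x0 < \<epsilon> \<longrightarrow> (\<forall>w\<in>ball (complex_of_real s) \<delta>. norm (\<Phi> w x) \<le> M))"
proof -
  define a where "a = s *\<^sub>R x0"
  have "norm a \<le> s * r" using x0 s by (simp add: a_def mult_left_mono)
  also have "\<dots> < 1" using s r by (simp add: field_simps)
  finally have "a \<in> ball 0 1" by simp
  from analytic_ps_repr[OF analytic this] obtain \<rho> c where ps: "ps_repr \<rho> c (\<lambda>h. u (a + h))"
    and hs': "\<forall>h. (\<forall>j. \<bar>h $ j\<bar> \<le> \<rho>) \<longrightarrow> ((\<lambda>k. c k * complex_of_real (monomial k h)) has_sum u (a + h)) UNIV"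
    by (elim exE conjE) rule
  have hs: "((\<lambda>k. c k * complex_of_real (monomial k h)) has_sum u (a + h)) UNIV" if "\<And>j. \<bar>h $ j\<bar> \<le> \<rho>" for h :: "real^'n"
    using hs' that by simp
  have \<rho>: "\<rho> > 0" and sm: "(\<lambda>k. norm (c k) * \<rho> ^ sum k UNIV) summable_on UNIV"
    using ps by (auto simp: ps_repr_def)
  define M where "M = (\<Sum>\<^sub>\<infinity>k. norm (c k) * \<rho> ^ sum k UNIV)"
  define \<delta> where "\<delta> = min (\<rho> / (2 * r)) (1 / r - s)"
  define \<epsilon> where "\<epsilon> = \<rho> / (2 * (s + 1))"
  have \<delta>: "\<delta> > 0" "\<delta> * r \<le> \<rho> / 2" "\<delta> \<le> 1 / r - s"
  proof -
    show "\<delta> > 0" "\<delta> \<le> 1 / r - s" using \<rho> r s by (auto simp: \<delta>_def)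
    have "\<delta> * r \<le> \<rho> / (2 * r) * r" using r by (intro mult_right_mono) (auto simp: \<delta>_def)
    then show "\<delta> * r \<le> \<rho> / 2" using r by simp
  qed
  have \<epsilon>: "\<epsilon> > 0" "s * \<epsilon> \<le> \<rho> / 2"
    using \<rho> s by (auto simp: \<epsilon>_def field_simps)
  have "norm (\<Phi> w x) \<le> M" if x: "x \<in> cball 0 r" "dist x x0 < \<epsilon>" and w: "w \<in> ball (complex_of_real s) \<delta>" for x w
  proof -
    \<comment> \<open>the displacement of the complex point \<open>w x\<close> from \<open>a\<close>; \<open>\<delta>\<close> and \<open>\<epsilon>\<close> each contribute
      \<open>\<rho> / 2\<close> to its bound\<close>
    define z where "z w j = w * complex_of_real (x $ j) - complex_of_real (a $ j)" for w j
    have zb: "norm (z w j) \<le> \<rho>" if w: "w \<in> cball (complex_of_real s) \<delta>" for w j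
    proof -
      have "z w j = (w - of_real s) * of_real (x $ j) + of_real (s * (x $ j - x0 $ j))"
        by (simp add: z_def a_def algebra_simps)
      then have "norm (z w j) \<le> norm (w - of_real s) * \<bar>x $ j\<bar> + s * \<bar>x $ j - x0 $ j\<bar>"
        using norm_triangle_ineq[of "(w - of_real s) * of_real (x $ j)" "of_real (s * (x $ j - x0 $ j))"] s
        by (simp add: norm_mult abs_mult del: of_real_mult of_real_diff)
      also have "\<dots> \<le> \<delta> * r + s * \<epsilon>"
      proof (intro add_mono mult_mono mult_left_mono)
        show "norm (w - of_real s) \<le> \<delta>" using w by (simp add: dist_norm norm_minus_commute)
        show "\<bar>x $ j\<bar> \<le> r" using component_le_norm_cart[of x j] x by simp
        show "\<bar>x $ j - x0 $ j\<bar> \<le> \<epsilon>" using component_le_norm_cart[of "x - x0" j] x by (simp add: dist_norm)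
      qed (use s \<delta> in auto)
      also have "\<dots> \<le> \<rho>" using \<delta> \<epsilon> by simp
      finally show ?thesis .
    qed
    define \<phi> where "\<phi> k w = c k * (\<Prod>j\<in>UNIV. z w j ^ k j)" for k w
    have \<phi>b: "norm (\<phi> k w) \<le> norm (c k) * \<rho> ^ sum k UNIV" if w: "w \<in> cball (complex_of_real s) \<delta>" for w k
    proof -
      have "norm (\<Prod>j\<in>UNIV. z w j ^ k j) \<le> (\<Prod>j\<in>UNIV. \<rho> ^ k j)"
        unfolding prod_norm[symmetric] by (intro prod_mono) (auto simp: norm_power intro!: power_mono zb[OF w])
      then show ?thesis unfolding \<phi>_def norm_mult power_sum by (intro mult_left_mono) auto
    qed
    define G where "G w = (\<Sum>\<^sub>\<infinity>k. \<phi> k w)" for w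
    have ul: "uniform_limit (cball (complex_of_real s) \<delta>) (\<lambda>X w. \<Sum>k\<in>X. \<phi> k w) G (finite_subsets_at_top UNIV)"
      unfolding G_def by (rule Weierstrass_m_test_general[OF \<phi>b sm]) auto
    have \<phi>h: "\<phi> k holomorphic_on S" for k S
      unfolding \<phi>_def[abs_def] z_def by (intro holomorphic_intros)
    have ev: "\<forall>\<^sub>F X in finite_subsets_at_top UNIV. continuous_on (cball (complex_of_real s) \<delta>) (\<lambda>w. \<Sum>k\<in>X. \<phi> k w) \<and>
        (\<lambda>w. \<Sum>k\<in>X. \<phi> k w) holomorphic_on ball (complex_of_real s) \<delta>"
      using \<phi>h by (intro always_eventually allI conjI holomorphic_on_imp_continuous_on holomorphic_on_sum) auto
    have holG: "G holomorphic_on ball (complex_of_real s) \<delta>"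
      by (rule holomorphic_uniform_limit[OF ev ul]) auto
    have GM: "norm (G w) \<le> M" if w: "w \<in> ball (complex_of_real s) \<delta>" for w
    proof -
      have w': "w \<in> cball (complex_of_real s) \<delta>" using w by auto
      have "(\<lambda>k. norm (\<phi> k w)) summable_on UNIV"
      proof (rule summable_on_comparison_test[OF sm])
        fix k show "norm (\<phi> k w) \<le> norm (c k) * \<rho> ^ sum k UNIV" by (rule \<phi>b[OF w'])
        show "0 \<le> norm (\<phi> k w)" by simp
      qed
      then have "((\<lambda>k. \<phi> k w) has_sum G w) UNIV" unfolding G_def by (rule has_sum_infsum[OF abs_summable_summable])
      then show ?thesis unfolding M_def by (rule norm_infsum_le[OF _ has_sum_infsum[OF sm]]) (rule \<phi>b[OF w'])
    qed
    have sub: "ball (complex_of_real s) \<delta> \<subseteq> ball 0 (1 / r)"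
    proof
      fix w assume "w \<in> ball (complex_of_real s) \<delta>"
      then have "norm w < s + \<delta>" using norm_triangle_ineq2[of w "complex_of_real s"] s by (simp add: dist_norm norm_minus_commute)
      then show "w \<in> ball 0 (1 / r)" using \<delta> by simp
    qed
    have hol: "(\<lambda>w. \<Phi> w x) holomorphic_on ball (complex_of_real s) \<delta>"
      by (rule holomorphic_on_subset[OF Phi_holomorphic[of x r] sub]) (use x r in auto)
    have "\<Phi> w x - G w = 0"
    proof (rule analytic_continuation[where f = "\<lambda>w. \<Phi> w x - G w" and S = "ball (complex_of_real s) \<delta>" and U = "complex_of_real ` {s<..<s+\<delta>}" and \<xi> = "complex_of_real s"])
      show "(\<lambda>w. \<Phi> w x - G w) holomorphic_on ball (complex_of_real s) \<delta>"
        by (intro holomorphic_on_diff hol holG)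
      show "complex_of_real ` {s<..<s+\<delta>} \<subseteq> ball (complex_of_real s) \<delta>"
      proof safe
        fix t assume "t \<in> {s<..<s+\<delta>}"
        then show "complex_of_real t \<in> ball (complex_of_real s) \<delta>"
          by (simp add: dist_norm flip: of_real_diff)
      qed
      show "complex_of_real s islimpt complex_of_real ` {s<..<s+\<delta>}"
        unfolding islimpt_approachable
      proof (intro allI impI)
        fix e :: real assume "e > 0"
        define t where "t = s + min e \<delta> / 2"
        have t: "t \<in> {s<..<s+\<delta>}" "\<bar>t - s\<bar> < e" using \<open>e > 0\<close> \<delta>(1) by (auto simp: t_def)
        then show "\<exists>x'\<in>complex_of_real ` {s<..<s+\<delta>}. x' \<noteq> complex_of_real s \<and> dist x' (complex_of_real s) < e"
          by (intro bexI[of _ "complex_of_real t"]) (auto simp: dist_norm simp flip: of_real_diff)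
      qed
      fix y assume "y \<in> complex_of_real ` {s<..<s+\<delta>}"
      then obtain t where t: "y = complex_of_real t" "s < t" "t < s + \<delta>" by auto
      have yb: "y \<in> cball (complex_of_real s) \<delta>" using t by (simp add: dist_norm flip: of_real_diff)
      have "norm (t *\<^sub>R x) \<le> t * r" using x t s by (simp add: mult_left_mono)
      also have "\<dots> < 1 / r * r" using t \<delta> r by (intro mult_strict_right_mono) auto
      finally have tx: "norm (t *\<^sub>R x) < 1" using r by simp
      have ze: "z y j = complex_of_real ((t *\<^sub>R x - a) $ j)" for j by (simp add: z_def t)
      have "\<bar>(t *\<^sub>R x - a) $ j\<bar> \<le> \<rho>" for j using zb[OF yb, of j] unfolding ze norm_of_real .
      from hs[OF this] have "((\<lambda>k. c k * complex_of_real (monomial k (t *\<^sub>R x - a))) has_sum u (t *\<^sub>R x)) UNIV" by simp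
      moreover have "\<phi> k y = c k * complex_of_real (monomial k (t *\<^sub>R x - a))" for k
        unfolding \<phi>_def ze monomial_def by simp
      ultimately have "G y = u (t *\<^sub>R x)" unfolding G_def by (simp add: infsumI)
      then show "\<Phi> y x - G y = 0" using Phi_real[OF tx] t by simp
    qed (use w \<delta> in auto)
    then show ?thesis using GM[OF w] by simp
  qed
  then show ?thesis using \<delta> \<epsilon> by blast
qed

lemma Phi_bounded:
  assumes r: "0 < r" and s: "0 \<le> s" "s < 1 / r"
  shows "\<exists>\<delta>>0. \<exists>M. \<delta> \<le> 1 / r - s \<and> (\<forall>x\<in>cball 0 r. \<forall>w\<in>ball (complex_of_real s) \<delta>. norm (\<Phi> w x) \<le> M)"
proof -
  \<comment> \<open>the three numbers \<open>\<delta>\<close>, \<open>\<epsilon>\<close>, \<open>M\<close> are packed into one tuple to choose them simultaneously\<close>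
  define Q where "Q x0 t \<longleftrightarrow> fst t > 0 \<and> fst (snd t) > 0 \<and> fst t \<le> 1 / r - s \<and>
     (\<forall>x\<in>cball 0 r. dist x x0 < fst (snd t) \<longrightarrow> (\<forall>w\<in>ball (complex_of_real s) (fst t). norm (\<Phi> w x) \<le> snd (snd t)))"
    for x0 :: "real^'n" and t :: "real \<times> real \<times> real"
  have "\<forall>x0\<in>cball 0 r. \<exists>t. Q x0 t"
  proof
    fix x0 :: "real^'n" assume "x0 \<in> cball 0 r"
    then have "norm x0 \<le> r" by simp
    from Phi_locally_bounded[OF r s this] obtain \<delta> \<epsilon> M where "\<delta> > 0" "\<epsilon> > 0" "\<delta> \<le> 1 / r - s"
      "\<forall>x\<in>cball 0 r. dist x x0 < \<epsilon> \<longrightarrow> (\<forall>w\<in>ball (complex_of_real s) \<delta>. norm (\<Phi> w x) \<le> M)"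
      by (elim exE conjE) rule
    then show "\<exists>t. Q x0 t" unfolding Q_def by (intro exI[of _ "(\<delta>, \<epsilon>, M)"]) simp
  qed
  then obtain t where t: "\<forall>x0\<in>cball 0 r. Q x0 (t x0)" by (rule bchoice[THEN exE])
  define \<delta> where "\<delta> x = fst (t x)" for x
  define \<epsilon> where "\<epsilon> x = fst (snd (t x))" for x
  define M where "M x = snd (snd (t x))" for x
  have D: "\<delta> x0 > 0 \<and> \<epsilon> x0 > 0 \<and> \<delta> x0 \<le> 1 / r - s \<and>
     (\<forall>x\<in>cball 0 r. dist x x0 < \<epsilon> x0 \<longrightarrow> (\<forall>w\<in>ball (complex_of_real s) (\<delta> x0). norm (\<Phi> w x) \<le> M x0))"
    if "norm x0 \<le> r" for x0
  proof -
    have "Q x0 (t x0)" using t that by simp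
    then show ?thesis unfolding Q_def \<delta>_def \<epsilon>_def M_def .
  qed
  have cov: "cball (0::real^'n) r \<subseteq> (\<Union>x\<in>cball 0 r. ball x (\<epsilon> x))"
  proof
    fix x :: "real^'n" assume x: "x \<in> cball 0 r"
    then have "\<epsilon> x > 0" using D[of x] by simp
    then show "x \<in> (\<Union>x\<in>cball 0 r. ball x (\<epsilon> x))" using x by (intro UN_I[of x]) auto
  qed
  obtain X where X: "X \<subseteq> cball 0 r" "finite X" "cball (0::real^'n) r \<subseteq> (\<Union>x\<in>X. ball x (\<epsilon> x))"
    by (rule compactE_image[OF compact_cball open_ball cov])
  have ne: "X \<noteq> {}"
  proof
    assume "X = {}"
    then have "cball (0::real^'n) r = {}" using X(3) by simp
    then show False using r by simp
  qed
  define d where "d = Min (\<delta> ` X)"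
  have dle: "d \<le> \<delta> x" if "x \<in> X" for x using X(2) that by (simp add: d_def)
  have "d \<in> \<delta> ` X" unfolding d_def using X(2) ne by (intro Min_in) auto
  then obtain x1 where x1: "x1 \<in> X" "d = \<delta> x1" by blast
  then have d: "d > 0" "d \<le> 1 / r - s" using D[of x1] X(1) by auto
  define K where "K = Max (M ` X)"
  have Kge: "M x \<le> K" if "x \<in> X" for x using X(2) that by (simp add: K_def)
  have "norm (\<Phi> w x) \<le> K" if x: "x \<in> cball 0 r" and w: "w \<in> ball (complex_of_real s) d" for x w
  proof -
    obtain x0 where x0: "x0 \<in> X" "x \<in> ball x0 (\<epsilon> x0)" using X(3) x by blast
    have n: "norm x0 \<le> r" using X(1) x0(1) by auto
    have dd: "dist x x0 < \<epsilon> x0" using x0(2) by (simp add: dist_commute)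
    have ww: "w \<in> ball (complex_of_real s) (\<delta> x0)" using w dle[OF x0(1)] by auto
    have "norm (\<Phi> w x) \<le> M x0" by (rule D[OF n, THEN conjunct2, THEN conjunct2, THEN conjunct2, rule_format, OF x dd ww])
    then show ?thesis using Kge[OF x0(1)] by linarith
  qed
  then show ?thesis using d by blast
qed

lemma Phi_coefficients:
  assumes r: "0 < r" and x: "norm x \<le> r"
  shows "(deriv ^^ j) (\<lambda>w. \<Phi> w x) 0 / fact j = q j x"
proof -
  have "(deriv ^^ j) (\<lambda>w. \<Phi> w x) 0 / fact j - q j x = 0"
  proof (rule powser_coeff_zero[of "1 / r"])
    fix t :: real assume t: "\<bar>t\<bar> < 1 / r"
    have "(\<lambda>n. (deriv ^^ n) (\<lambda>w. \<Phi> w x) 0 / fact n * (complex_of_real t - 0) ^ n) sums \<Phi> (complex_of_real t) x"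
      by (rule holomorphic_power_series[OF Phi_holomorphic[OF x r]]) (use t in auto)
    moreover have "(\<lambda>n. q n x * complex_of_real t ^ n) sums \<Phi> (complex_of_real t) x"
      by (rule Phi_sums[OF x _ r]) (use t in auto)
    ultimately have "(\<lambda>n. (deriv ^^ n) (\<lambda>w. \<Phi> w x) 0 / fact n * (complex_of_real t - 0) ^ n - q n x * complex_of_real t ^ n) sums
        (\<Phi> (complex_of_real t) x - \<Phi> (complex_of_real t) x)" by (rule sums_diff)
    then show "(\<lambda>n. ((deriv ^^ n) (\<lambda>w. \<Phi> w x) 0 / fact n - q n x) * complex_of_real t ^ n) sums 0"
      by (simp add: left_diff_distrib)
  qed (use r in auto)
  then show ?thesis by simp
qed

text \<open>\<open>w \<mapsto> \<integral> \<Phi> w x \<phi>(x) dx\<close> is holomorphic near the segment \<open>[0,1]\<close>, and near \<open>0\<close>,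
  where termwise integration is legitimate, it is a polynomial because all but finitely many degrees integrate to zero. The identity theorem carries
  this to \<open>w = 1\<close>.\<close>

lemma termwise_integral:
  assumes r: "0 < r" "r < 1" and \<phi>: "integrable lborel \<phi>" and \<phi>0: "\<And>x. norm x > r \<Longrightarrow> \<phi> x = 0"
    and vanish: "\<And>m. m > N \<Longrightarrow> (LINT x|lborel. q m x * \<phi> x) = 0"
  shows "(LINT x|lborel. u x * \<phi> x) = (\<Sum>m\<le>N. LINT x|lborel. q m x * \<phi> x)"
proof -
  have r1: "1 < 1 / r" using r by (simp add: field_simps)
  define Q where "Q s t \<longleftrightarrow> fst t > 0 \<and> fst t \<le> 1 / r - s \<and>
     (\<forall>x\<in>cball 0 r. \<forall>w\<in>ball (complex_of_real s) (fst t). norm (\<Phi> w x) \<le> snd t)" for s and t :: "real \<times> real"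
  have "\<forall>s\<in>{0..1}. \<exists>t. Q s t"
  proof
    fix s :: real assume "s \<in> {0..1}"
    then have s: "0 \<le> s" "s < 1 / r" using r1 by auto
    obtain \<delta> M where "\<delta> > 0" "\<delta> \<le> 1 / r - s"
      "\<forall>x\<in>cball 0 r. \<forall>w\<in>ball (complex_of_real s) \<delta>. norm (\<Phi> w x) \<le> M"
      using Phi_bounded[OF r(1) s] by blast
    then show "\<exists>t. Q s t" unfolding Q_def by (intro exI[of _ "(\<delta>, M)"]) simp
  qed
  then obtain t where t: "\<forall>s\<in>{0..1}. Q s (t s)" by (rule bchoice[THEN exE])
  define \<delta> where "\<delta> x = fst (t x)" for x
  define M where "M x = snd (t x)" for x
  have D: "\<delta> s > 0 \<and> \<delta> s \<le> 1 / r - s \<and>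
     (\<forall>x\<in>cball 0 r. \<forall>w\<in>ball (complex_of_real s) (\<delta> s). norm (\<Phi> w x) \<le> M s)" if "0 \<le> s" "s \<le> 1" for s
  proof -
    have "Q s (t s)" using t that by simp
    then show ?thesis unfolding Q_def \<delta>_def M_def .
  qed
  define H where "H w = (LINT x|lborel. \<Phi> w x * \<phi> x)" for w
  define P where "P w = (\<Sum>m\<le>N. (LINT x|lborel. q m x * \<phi> x) * w ^ m)" for w
  have local: "H holomorphic_on ball (complex_of_real s) (\<delta> s / 2)"
      "w \<in> ball (complex_of_real s) (\<delta> s / 2) \<Longrightarrow> (\<lambda>j. (LINT x|lborel. (deriv ^^ j) (\<lambda>w. \<Phi> w x) (complex_of_real s) / fact j * \<phi> x) * (w - complex_of_real s) ^ j) sums H w"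
    if s: "0 \<le> s" "s \<le> 1" for s w
  proof -
    note Ds = D[OF s]
    have sub: "ball (complex_of_real s) (\<delta> s) \<subseteq> ball 0 (1 / r)"
    proof
      fix w assume "w \<in> ball (complex_of_real s) (\<delta> s)"
      then have "norm w < s + \<delta> s" using norm_triangle_ineq2[of w "complex_of_real s"] s by (simp add: dist_norm norm_minus_commute)
      then show "w \<in> ball 0 (1 / r)" using Ds by simp
    qed
    have a1: "(\<lambda>w. \<Phi> w x) holomorphic_on ball (complex_of_real s) (\<delta> s)" if "x \<in> cball 0 r" for x
      by (rule holomorphic_on_subset[OF Phi_holomorphic[of x r] sub]) (use that r in auto)
    have a2: "(\<lambda>x. if x \<in> cball 0 r then \<Phi> w x else 0) \<in> borel_measurable lborel" if "w \<in> ball (complex_of_real s) (\<delta> s)" for w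
      by (rule Phi_measurable) (use subsetD[OF sub that] r in auto)
    have a3: "norm (\<Phi> w x) \<le> max (M s) 0" if "w \<in> ball (complex_of_real s) (\<delta> s)" "x \<in> cball 0 r" for w x
      using Ds that by (meson max.coboundedI1)
    have a4: "\<phi> x = 0" if "x \<notin> cball 0 r" for x using \<phi>0[of x] that by simp
    note L = holomorphic_integral_parameter[where f = \<Phi> and A = "cball 0 r", OF a1 a2 _ a3 \<phi> a4]
    show "H holomorphic_on ball (complex_of_real s) (\<delta> s / 2)"
      unfolding H_def[abs_def] by (rule L(1)) (use Ds in auto)
    show "w \<in> ball (complex_of_real s) (\<delta> s / 2) \<Longrightarrow> (\<lambda>j. (LINT x|lborel. (deriv ^^ j) (\<lambda>w. \<Phi> w x) (complex_of_real s) / fact j * \<phi> x) * (w - complex_of_real s) ^ j) sums H w"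
      unfolding H_def by (rule L(2)) (use Ds in auto)
  qed
  \<comment> \<open>a connected neighbourhood of the segment on which \<open>H\<close> is holomorphic\<close>
  define S where "S = (\<Union>s\<in>{0..1}. ball (complex_of_real s) (\<delta> s / 2))"
  have seg: "complex_of_real s \<in> S" if "s \<in> {0..1}" for s
    using D[of s] that unfolding S_def by (intro UN_I[of s]) auto
  have conn: "connected S"
  proof -
    let ?I = "complex_of_real ` {0..1}"
    have ci: "connected ?I" by (intro connected_continuous_image continuous_intros) auto
    have "S = (\<Union>s\<in>{0..1}. ball (complex_of_real s) (\<delta> s / 2) \<union> ?I)"
      using seg unfolding S_def by blast
    moreover have "connected (\<Union>s\<in>{0..1}. ball (complex_of_real s) (\<delta> s / 2) \<union> ?I)"
    proof (rule connected_Union)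
      fix T assume "T \<in> (\<lambda>s. ball (complex_of_real s) (\<delta> s / 2) \<union> ?I) ` {0..1}"
      then obtain s where s: "s \<in> {0..1}" "T = ball (complex_of_real s) (\<delta> s / 2) \<union> ?I" by blast
      have "complex_of_real s \<in> ball (complex_of_real s) (\<delta> s / 2) \<inter> ?I" using D[of s] s by auto
      then show "connected T" unfolding s(2) by (intro connected_Un ci connected_ball) blast
    next
      have "complex_of_real 0 \<in> \<Inter> ((\<lambda>s. ball (complex_of_real s) (\<delta> s / 2) \<union> ?I) ` {0..1})"
        by (auto intro!: image_eqI[of _ _ 0])
      then show "\<Inter> ((\<lambda>s. ball (complex_of_real s) (\<delta> s / 2) \<union> ?I) ` {0..1}) \<noteq> {}" by blast
    qed
    ultimately show ?thesis by simp
  qed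
  have "H 1 - P 1 = 0"
  proof (rule analytic_continuation[where f = "\<lambda>w. H w - P w" and S = S and U = "ball 0 (\<delta> 0 / 2)" and \<xi> = 0])
    show "(\<lambda>w. H w - P w) holomorphic_on S"
    proof (intro holomorphic_on_diff)
      show "H holomorphic_on S" unfolding S_def by (rule holomorphic_on_UN_open) (use local in auto)
      show "P holomorphic_on S" unfolding P_def[abs_def] by (intro holomorphic_intros)
    qed
    show "open S" unfolding S_def by auto
    show "ball 0 (\<delta> 0 / 2) \<subseteq> S" unfolding S_def using UN_upper[of 0 "{0..1}" "\<lambda>s. ball (complex_of_real s) (\<delta> s / 2)"] by simp
    show "(0::complex) islimpt ball 0 (\<delta> 0 / 2)" using D[of 0] by (simp add: islimpt_ball)
    fix w :: complex assume "w \<in> ball 0 (\<delta> 0 / 2)"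
    then have "(\<lambda>j. (LINT x|lborel. (deriv ^^ j) (\<lambda>w. \<Phi> w x) 0 / fact j * \<phi> x) * w ^ j) sums H w"
      using local(2)[of 0 w] by simp
    moreover have "(LINT x|lborel. (deriv ^^ j) (\<lambda>w. \<Phi> w x) 0 / fact j * \<phi> x) = (LINT x|lborel. q j x * \<phi> x)" for j
    proof (rule Bochner_Integration.integral_cong[OF refl])
      fix x
      show "(deriv ^^ j) (\<lambda>w. \<Phi> w x) 0 / fact j * \<phi> x = q j x * \<phi> x"
        using Phi_coefficients[OF r(1), of x j] \<phi>0[of x] by (cases "norm x \<le> r") auto
    qed
    ultimately have "(\<lambda>j. (LINT x|lborel. q j x * \<phi> x) * w ^ j) sums H w" by (simp only:)
    moreover have "(\<lambda>j. (LINT x|lborel. q j x * \<phi> x) * w ^ j) sums P w"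
      unfolding P_def by (rule sums_finite) (use vanish in auto)
    ultimately show "H w - P w = 0" using sums_unique2 by fastforce
  qed (use conn seg[of 0] seg[of 1] in auto)
  moreover have "H 1 = (LINT x|lborel. u x * \<phi> x)"
    unfolding H_def
  proof (rule Bochner_Integration.integral_cong[OF refl])
    fix x show "\<Phi> 1 x * \<phi> x = u x * \<phi> x"
      using Phi_real[of 1 x] \<phi>0[of x] r by (cases "norm x \<le> r") auto
  qed
  ultimately show ?thesis by (simp add: P_def)
qed

end

section \<open>The generating function of the zonal polynomials\<close>

text \<open>The coefficients of \<open>(1 - z)\<^sup>-\<^sup>l\<close>.\<close>

definition neg_binomial_coef :: "complex \<Rightarrow> nat \<Rightarrow> complex" where "neg_binomial_coef l i = pochhammer l i / fact i"

definition binomial_fps :: "complex \<Rightarrow> complex \<Rightarrow> complex fps" where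
  "binomial_fps l z = Abs_fps (\<lambda>i. neg_binomial_coef l i * z ^ i)"

lemma neg_binomial_coef_Suc: "of_nat (Suc i) * neg_binomial_coef l (Suc i) = (l + of_nat i) * neg_binomial_coef l i"
  by (simp add: neg_binomial_coef_def pochhammer_Suc del: of_nat_Suc)

lemma binomial_fps_deriv:
  "(1 - fps_const z * fps_X) * fps_deriv (binomial_fps l z) = fps_const (l * z) * binomial_fps l z"
proof (rule fps_ext)
  fix i
  have g: "of_nat (Suc i) * neg_binomial_coef l (Suc i) = (l + of_nat i) * neg_binomial_coef l i" by (rule neg_binomial_coef_Suc)
  have "fps_nth ((1 - fps_const z * fps_X) * fps_deriv (binomial_fps l z)) i =
     of_nat (Suc i) * neg_binomial_coef l (Suc i) * z ^ Suc i - z * (of_nat i * (neg_binomial_coef l i * z ^ i))"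
    by (cases i) (simp_all add: left_diff_distrib mult.assoc binomial_fps_def fps_deriv_def del: of_nat_Suc)
  also have "\<dots> = fps_nth (fps_const (l * z) * binomial_fps l z) i"
    unfolding g by (simp add: binomial_fps_def algebra_simps)
  finally show "fps_nth ((1 - fps_const z * fps_X) * fps_deriv (binomial_fps l z)) i = fps_nth (fps_const (l * z) * binomial_fps l z) i" .
qed

text \<open>With \<open>P = (1 - z\<^sub>1X)\<^sup>-\<^sup>l (1 - z\<^sub>2X)\<^sup>-\<^sup>l\<close>, this compares coefficients in the differential
  equation \<open>(1 - 2uX + vX\<^sup>2) P' = 2l(u - vX) P\<close>.\<close>

lemma product_recurrence:
  fixes l z1 z2 :: complex
  assumes u: "2 * u = z1 + z2" and v: "v = z1 * z2"
  defines "G \<equiv> fps_nth (binomial_fps l z1 * binomial_fps l z2)"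
  shows "of_nat (a + 2) * G (a + 2) = 2 * u * (l + of_nat a + 1) * G (a + 1) - v * (2 * l + of_nat a) * G a"
proof -
  let ?F1 = "binomial_fps l z1" and ?F2 = "binomial_fps l z2" and ?P = "binomial_fps l z1 * binomial_fps l z2"
  let ?c = fps_const and ?X = "fps_X :: complex fps"
  have e: "(1 - ?c z1 * ?X) * (1 - ?c z2 * ?X) = 1 - ?c (2 * u) * ?X + ?c v * (?X * ?X)"
    unfolding u v by (simp add: algebra_simps fps_const_add[symmetric] fps_const_mult[symmetric] del: fps_const_add fps_const_mult)
  have "(1 - ?c z1 * ?X) * (1 - ?c z2 * ?X) * fps_deriv ?P =
     ((1 - ?c z1 * ?X) * fps_deriv ?F1) * (1 - ?c z2 * ?X) * ?F2 + ((1 - ?c z2 * ?X) * fps_deriv ?F2) * (1 - ?c z1 * ?X) * ?F1"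
  proof -
    have "A * B * (F1 * D2 + D1 * F2) = (A * D1) * B * F2 + (B * D2) * A * F1" for A B F1 F2 D1 D2 :: "complex fps"
      by (simp add: algebra_simps)
    then show ?thesis by (simp only: fps_deriv_mult)
  qed
  also have "\<dots> = (?c (l * z1) * (1 - ?c z2 * ?X) + ?c (l * z2) * (1 - ?c z1 * ?X)) * ?P"
  proof -
    have "(c1 * F1) * B * F2 + (c2 * F2) * A * F1 = (c1 * B + c2 * A) * (F1 * F2)" for A B F1 F2 c1 c2 :: "complex fps"
      by (simp add: algebra_simps)
    then show ?thesis by (simp only: binomial_fps_deriv)
  qed
  also have "?c (l * z1) * (1 - ?c z2 * ?X) + ?c (l * z2) * (1 - ?c z1 * ?X) = ?c (2 * l * u) - ?c (2 * l * v) * ?X"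
  proof -
    have "2 * l * u = l * z1 + l * z2" using u by (simp add: algebra_simps)
    then have cu: "?c (2 * l * u) = ?c (l * z1) + ?c (l * z2)" by simp
    have cv: "?c (2 * l * v) = ?c (l * v) + ?c (l * v)" by (simp add: algebra_simps)
    have A: "?c (l * z1) * (1 - ?c z2 * ?X) = ?c (l * z1) - ?c (l * v) * ?X"
      unfolding v right_diff_distrib mult_1_right mult.assoc[symmetric] fps_const_mult ..
    have "l * z2 * z1 = l * v" by (simp add: v)
    then have B: "?c (l * z2) * (1 - ?c z1 * ?X) = ?c (l * z2) - ?c (l * v) * ?X"
      unfolding right_diff_distrib mult_1_right mult.assoc[symmetric] fps_const_mult by simp
    show ?thesis unfolding A B cu cv by (simp only: distrib_right) simp
  qed
  finally have "fps_nth ((1 - ?c (2 * u) * ?X + ?c v * (?X * ?X)) * fps_deriv ?P) (Suc a) = fps_nth ((?c (2 * l * u) - ?c (2 * l * v) * ?X) * ?P) (Suc a)"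
    unfolding e by simp
  moreover have "fps_nth ((1 - ?c (2 * u) * ?X + ?c v * (?X * ?X)) * fps_deriv ?P) (Suc a) =
     of_nat (a + 2) * G (a + 2) - 2 * u * (of_nat (a + 1) * G (a + 1)) + v * (of_nat a * G a)"
  proof -
    have d: "fps_nth (fps_deriv ?P) m = of_nat (m + 1) * G (m + 1)" for m by (simp add: G_def del: fps_deriv_mult)
    have "(1 - ?c (2 * u) * ?X + ?c v * (?X * ?X)) * fps_deriv ?P = fps_deriv ?P - ?c (2 * u) * (?X * fps_deriv ?P) + ?c v * (?X * (?X * fps_deriv ?P))"
      by (simp add: algebra_simps)
    then have "fps_nth ((1 - ?c (2 * u) * ?X + ?c v * (?X * ?X)) * fps_deriv ?P) (Suc a) =
       fps_nth (fps_deriv ?P) (Suc a) - 2 * u * fps_nth (fps_deriv ?P) a + v * fps_nth (?X * fps_deriv ?P) a"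
      by (simp del: fps_deriv_nth fps_deriv_mult)
    moreover have "fps_nth (?X * fps_deriv ?P) a = of_nat a * G a"
      using d[of "a - 1"] by (cases a) (simp_all del: fps_deriv_nth fps_deriv_mult)
    ultimately show ?thesis unfolding d by simp
  qed
  moreover have "fps_nth ((?c (2 * l * u) - ?c (2 * l * v) * ?X) * ?P) (Suc a) = 2 * l * u * G (a + 1) - 2 * l * v * G a"
    by (simp add: G_def left_diff_distrib mult.assoc)
  ultimately have "of_nat (a + 2) * G (a + 2) - 2 * u * (of_nat (a + 1) * G (a + 1)) + v * (of_nat a * G a) = 2 * l * u * G (a + 1) - 2 * l * v * G a"
    by simp
  then show ?thesis by (simp add: algebra_simps)
qed

lemma geg_coef_rec:
  "of_nat (b + 2 * k + 1) * geg_coef l (b + 1) k = 2 * (l + of_nat (b + 2 * k)) * geg_coef l b k -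
     (2 * l + of_nat (b + 2 * k) - 1) * (if k = 0 then 0 else geg_coef l (b + 1) (k - 1))"
proof -
  have nzb: "of_nat (b + 1) \<noteq> (0 :: complex)" by (metis Suc_eq_plus1 of_nat_neq_0)
  have 1: "geg_coef l (b + 1) k * of_nat (b + 1) = geg_coef l b k * (2 * (l + of_nat (b + k)))"
  proof -
    have f: "fact (b + 1) = of_nat (b + 1) * (fact b :: complex)" by simp
    show ?thesis unfolding geg_coef_def f using nzb by (simp add: pochhammer_Suc divide_simps del: of_nat_Suc of_nat_add)
  qed
  have 2: "(if k = 0 then 0 else geg_coef l (b + 1) (k - 1)) * of_nat (b + 1) = - geg_coef l b k * (2 * of_nat k)"
  proof (cases k)
    case (Suc i)
    have nzi: "of_nat (Suc i) \<noteq> (0 :: complex)" by (rule of_nat_neq_0)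
    have f: "fact (b + 1) = of_nat (b + 1) * (fact b :: complex)" "fact (Suc i) = of_nat (Suc i) * (fact i :: complex)" by simp_all
    show ?thesis unfolding Suc geg_coef_def f using nzb nzi
      by (simp add: divide_simps del: of_nat_Suc of_nat_add)
  qed simp
  have "(of_nat (b + 2 * k + 1) * geg_coef l (b + 1) k) * of_nat (b + 1) = (2 * (l + of_nat (b + 2 * k)) * geg_coef l b k -
     (2 * l + of_nat (b + 2 * k) - 1) * (if k = 0 then 0 else geg_coef l (b + 1) (k - 1))) * of_nat (b + 1)"
    unfolding left_diff_distrib mult.assoc 1 2 by (simp add: algebra_simps)
  then show ?thesis using nzb by simp
qed

lemma geg_coef_rec0: "of_nat (2 * Suc k) * geg_coef l 0 (Suc k) = - (2 * l + of_nat (2 * k)) * geg_coef l 0 k"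
proof -
  have nzi: "of_nat (Suc k) \<noteq> (0 :: complex)" by (rule of_nat_neq_0)
  have f: "fact (Suc k) = of_nat (Suc k) * (fact k :: complex)" by simp
  show ?thesis unfolding geg_coef_def f using nzi
    by (simp add: pochhammer_Suc divide_simps del: of_nat_Suc) (simp add: algebra_simps)
qed

lemma geg_recurrence:
  "of_nat (a + 2) * geg l (a + 2) u v = 2 * u * (l + of_nat a + 1) * geg l (a + 1) u v - v * (2 * l + of_nat a) * geg l a u v"
proof -
  define e where "e a k = (if 2 * k \<le> a then geg_coef l (a - 2 * k) k * u ^ (a - 2 * k) else 0)" for a k
  have ge: "geg l c u v = (\<Sum>k\<le>N. e c k * v ^ k)" if "c \<le> N" for c N
    unfolding geg_def by (rule sum.mono_neutral_cong_left) (use that in \<open>auto simp: e_def\<close>)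
  have vg: "v * geg l a u v = (\<Sum>k\<le>a + 2. (if k = 0 then 0 else e a (k - 1)) * v ^ k)"
  proof -
    have "(\<Sum>k\<le>Suc (a + 1). (if k = 0 then 0 else e a (k - 1)) * v ^ k) = (\<Sum>k\<le>a + 1. e a k * v ^ Suc k)"
      by (subst sum.atMost_Suc_shift) simp
    also have "\<dots> = v * geg l a u v" by (subst ge[of a "a + 1"]) (simp_all add: sum_distrib_left mult_ac del: sum.atMost_Suc)
    finally show ?thesis by simp
  qed
  have tm: "of_nat (a + 2) * e (a + 2) k = 2 * u * (l + of_nat a + 1) * e (a + 1) k - (2 * l + of_nat a) * (if k = 0 then 0 else e a (k - 1))" for k
  proof -
    consider "2 * k > a + 2" | "2 * k = a + 2" | "2 * k \<le> a + 1" by linarith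
    then show ?thesis
    proof cases
      case 1 then show ?thesis by (auto simp: e_def)
    next
      case 2
      then obtain i where i: "k = Suc i" "a = 2 * i" by (cases k) auto
      show ?thesis using geg_coef_rec0[of i l] unfolding i by (simp add: e_def left_diff_distrib distrib_right)
    next
      case 3
      define b where "b = a + 1 - 2 * k"
      have a: "a + 1 = b + 2 * k" "a + 2 = b + 2 * k + 1" using 3 by (auto simp: b_def)
      have ea: "(if k = 0 then 0 else e a (k - 1)) = (if k = 0 then 0 else geg_coef l (b + 1) (k - 1)) * u ^ (b + 1)"
      proof (cases k)
        case (Suc i)
        then have "a - 2 * i = b + 1" "2 * i \<le> a" using a by auto
        then show ?thesis using Suc by (simp add: e_def)
      qed simp
      have la: "2 * l + of_nat a = 2 * l + of_nat (b + 2 * k) - 1" "l + of_nat a + 1 = l + of_nat (b + 2 * k)"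
        unfolding a(1)[symmetric] by simp_all
      have e2: "e (a + 2) k = geg_coef l (b + 1) k * u ^ (b + 1)" "e (a + 1) k = geg_coef l b k * u ^ b"
        unfolding a by (simp_all add: e_def)
      show ?thesis unfolding ea la e2 unfolding a(2) mult.assoc[symmetric] geg_coef_rec by (simp add: algebra_simps)
    qed
  qed
  have "of_nat (a + 2) * geg l (a + 2) u v = (\<Sum>k\<le>a + 2. (of_nat (a + 2) * e (a + 2) k) * v ^ k)"
    by (subst ge[of _ "a + 2"]) (auto simp: sum_distrib_left mult.assoc simp del: sum.atMost_Suc)
  also have "\<dots> = 2 * u * (l + of_nat a + 1) * (\<Sum>k\<le>a + 2. e (a + 1) k * v ^ k) - (2 * l + of_nat a) * (\<Sum>k\<le>a + 2. (if k = 0 then 0 else e a (k - 1)) * v ^ k)"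
    unfolding tm left_diff_distrib sum_subtractf sum_distrib_left by (simp only: mult.assoc)
  also have "\<dots> = 2 * u * (l + of_nat a + 1) * geg l (a + 1) u v - (2 * l + of_nat a) * (v * geg l a u v)"
    unfolding vg by (subst ge[of "a + 1" "a + 2"]) auto
  finally show ?thesis by (simp add: mult_ac)
qed

text \<open>The Cauchy product on the right satisfies the three-term recurrence of the Gegenbauer polynomials and has the same first two terms. Here
  \<open>z\<^sub>1\<close> and \<open>z\<^sub>2\<close> are the reciprocal roots of \<open>1 - 2ut + vt\<^sup>2\<close>.\<close>

lemma geg_product:
  assumes u: "2 * u = z1 + z2" and v: "v = z1 * z2"
  shows "geg l a u v = (\<Sum>i\<le>a. (neg_binomial_coef l i * z1 ^ i) * (neg_binomial_coef l (a - i) * z2 ^ (a - i)))"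
proof -
  define G where "G = fps_nth (binomial_fps l z1 * binomial_fps l z2)"
  have "geg l a u v = G a"
  proof (induction a rule: less_induct)
    case (less a)
    consider "a = 0" | "a = 1" | c where "a = c + 2" by (metis One_nat_def Suc_1 add_2_eq_Suc' not0_implies_Suc)
    then show ?case
    proof cases
      case 1 then show ?thesis by (simp add: geg_def geg_coef_def G_def binomial_fps_def neg_binomial_coef_def)
    next
      case 2
      have "G 1 = l * (z1 + z2)" by (simp add: G_def fps_mult_nth binomial_fps_def neg_binomial_coef_def algebra_simps)
      then show ?thesis using 2 by (simp add: geg_def geg_coef_def u[symmetric] mult_ac)
    next
      case 3
      have nz: "of_nat (c + 2) \<noteq> (0::complex)" by (metis add_2_eq_Suc' of_nat_neq_0)
      have "of_nat (c + 2) * geg l (c + 2) u v = of_nat (c + 2) * G (c + 2)"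
        unfolding geg_recurrence product_recurrence[OF u v, of c l, folded G_def] using less.IH[of c] less.IH[of "c + 1"] 3 by simp
      then show ?thesis using nz 3 by simp
    qed
  qed
  then show ?thesis by (simp add: G_def fps_mult_nth binomial_fps_def atLeast0AtMost)
qed

lemma neg_binomial_coef_gchoose: "neg_binomial_coef l i * z ^ i = ((- l) gchoose i) * (- z) ^ i"
  by (simp add: neg_binomial_coef_def gbinomial_pochhammer power_minus' mult_ac)

lemma neg_binomial_coef_powser: "norm z < 1 \<Longrightarrow> (\<lambda>i. neg_binomial_coef l i * z ^ i) sums ((1 - z) powr (- l))"
  using gen_binomial_complex[of "- z" "- l"] by (simp add: neg_binomial_coef_gchoose)

lemma neg_binomial_coef_abs_summable: "norm z < 1 \<Longrightarrow> summable (\<lambda>i. norm (neg_binomial_coef l i * z ^ i))"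
proof -
  assume "norm z < 1"
  define t where "t = (norm z + 1) / 2"
  have t: "norm z < t" "t < 1" "t > 0" using \<open>norm z < 1\<close> by (auto simp: t_def add_nonneg_pos)
  then have "summable (\<lambda>i. neg_binomial_coef l i * complex_of_real t ^ i)"
    using neg_binomial_coef_powser[of "complex_of_real t" l] by (simp add: sums_iff)
  moreover have "norm z < norm (complex_of_real t)" using t by simp
  ultimately show ?thesis by (rule powser_insidea)
qed

lemma geg_generating:
  assumes u: "2 * u = z1 + z2" and v: "v = z1 * z2" and z: "norm z1 < 1" "norm z2 < 1"
  shows "(\<lambda>a. geg l a u v) sums ((1 - z1) powr (- l) * (1 - z2) powr (- l))"
  unfolding geg_product[OF u v]
  using Cauchy_product_sums[OF neg_binomial_coef_abs_summable[OF z(1), of l] neg_binomial_coef_abs_summable[OF z(2), of l]]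
    neg_binomial_coef_powser[OF z(1), of l] neg_binomial_coef_powser[OF z(2), of l] by (simp add: sums_iff)

text \<open>In the product formula
  \<open>|z\<^sub>1|\<^sup>i|z\<^sub>2|\<^sup>a\<^sup>-\<^sup>i \<le> R\<^sup>a = (R/\<theta>)\<^sup>a \<theta>\<^sup>i\<theta>\<^sup>a\<^sup>-\<^sup>i\<close>,
  and the coefficients weighted with powers of \<open>\<theta> < 1\<close> are summable.\<close>

lemma geg_bound:
  assumes \<theta>: "0 < \<theta>" "\<theta> < 1"
  shows "\<exists>C\<ge>0. \<forall>a u v z1 z2 R. 2 * u = z1 + z2 \<longrightarrow> v = z1 * z2 \<longrightarrow> norm z1 \<le> R \<longrightarrow> norm z2 \<le> R \<longrightarrow>
     norm (geg l a u v) \<le> C * (R / \<theta>) ^ a"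
proof -
  define g where "g i = norm (neg_binomial_coef l i * complex_of_real \<theta> ^ i)" for i
  have sg: "summable g" unfolding g_def by (rule neg_binomial_coef_abs_summable) (use \<theta> in auto)
  define C where "C = (\<Sum>i. g i) * (\<Sum>i. g i)"
  have g0: "g i \<ge> 0" for i by (simp add: g_def)
  have g1: "g i \<le> (\<Sum>i. g i)" for i using sum_le_suminf[OF sg, of "{i}"] g0 by auto
  have C0: "C \<ge> 0" unfolding C_def using suminf_nonneg[OF sg g0] by simp
  have gs: "(\<Sum>i\<le>a. g i * g (a - i)) \<le> C" for a
  proof -
    have "(\<Sum>i\<le>a. g i * g (a - i)) \<le> (\<Sum>i\<le>a. g i * (\<Sum>i. g i))"
      using g0 g1 by (intro sum_mono mult_left_mono) auto
    also have "\<dots> = (\<Sum>i\<le>a. g i) * (\<Sum>i. g i)" by (simp add: sum_distrib_right)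
    also have "\<dots> \<le> C" unfolding C_def
      using suminf_nonneg[OF sg g0] by (intro mult_right_mono sum_le_suminf[OF sg]) (auto simp: g0)
    finally show ?thesis .
  qed
  have "norm (geg l a u v) \<le> C * (R / \<theta>) ^ a" if u: "2 * u = z1 + z2" and v: "v = z1 * z2" and R: "norm z1 \<le> R" "norm z2 \<le> R" for a u v z1 z2 R
  proof -
    have R0: "R \<ge> 0" using R(1) norm_ge_zero order_trans by blast
    have t: "norm ((neg_binomial_coef l i * z1 ^ i) * (neg_binomial_coef l (a - i) * z2 ^ (a - i))) \<le> (g i * g (a - i)) * (R / \<theta>) ^ a" if "i \<le> a" for i
    proof -
      have "norm ((neg_binomial_coef l i * z1 ^ i) * (neg_binomial_coef l (a - i) * z2 ^ (a - i))) = norm (neg_binomial_coef l i) * norm (neg_binomial_coef l (a - i)) * (norm z1 ^ i * norm z2 ^ (a - i))"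
        by (simp add: norm_mult norm_power mult_ac)
      also have "\<dots> \<le> norm (neg_binomial_coef l i) * norm (neg_binomial_coef l (a - i)) * (R ^ i * R ^ (a - i))"
        using R R0 by (intro mult_left_mono mult_mono power_mono) auto
      also have "R ^ i * R ^ (a - i) = (\<theta> ^ i * \<theta> ^ (a - i)) * (R / \<theta>) ^ a"
        using that \<theta> by (simp add: power_divide flip: power_add)
      also have "norm (neg_binomial_coef l i) * norm (neg_binomial_coef l (a - i)) * ((\<theta> ^ i * \<theta> ^ (a - i)) * (R / \<theta>) ^ a) = (g i * g (a - i)) * (R / \<theta>) ^ a"
        using \<theta> by (simp add: g_def norm_mult norm_power mult_ac)
      finally show ?thesis .
    qed
    have "norm (geg l a u v) \<le> (\<Sum>i\<le>a. (g i * g (a - i)) * (R / \<theta>) ^ a)"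
      unfolding geg_product[OF u v] by (rule sum_norm_le) (use t in auto)
    also have "\<dots> = (\<Sum>i\<le>a. g i * g (a - i)) * (R / \<theta>) ^ a" by (simp add: sum_distrib_right)
    also have "\<dots> \<le> C * (R / \<theta>) ^ a" using gs R0 \<theta> by (intro mult_right_mono) auto
    finally show ?thesis .
  qed
  then show ?thesis using C0 by blast
qed

lemma pzonal_bound:
  assumes \<theta>: "0 < \<theta>" "\<theta> < 1"
  shows "\<exists>C\<ge>0. \<forall>m u v z1 z2 R. 2 * u = z1 + z2 \<longrightarrow> v = z1 * z2 \<longrightarrow> norm z1 \<le> R \<longrightarrow> norm z2 \<le> R \<longrightarrow>
     norm (pzonal l p m u v) \<le> C * (R / \<theta>) ^ m"
proof -
  obtain C where C: "C \<ge> 0" "\<forall>a u v z1 z2 R. 2 * u = z1 + z2 \<longrightarrow> v = z1 * z2 \<longrightarrow> norm z1 \<le> R \<longrightarrow> norm z2 \<le> R \<longrightarrow>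
     norm (geg l a u v) \<le> C * (R / \<theta>) ^ a" using geg_bound[OF \<theta>] by blast
  have "norm (pzonal l p m u v) \<le> (2 * C) * (R / \<theta>) ^ m" if u: "2 * u = z1 + z2" and v: "v = z1 * z2" and R: "norm z1 \<le> R" "norm z2 \<le> R" for m u v z1 z2 R
  proof -
    have R0: "R \<ge> 0" using R(1) norm_ge_zero order_trans by blast
    have C': "norm (geg l a u v) \<le> C * (R / \<theta>) ^ a" for a using C(2) u v R by blast
    have "norm (if 2 * p \<le> m then v ^ p * geg l (m - 2 * p) u v else 0) \<le> C * (R / \<theta>) ^ m"
    proof (cases "2 * p \<le> m")
      case True
      \<comment> \<open>the factor \<open>v\<^sup>p\<close> makes up for the missing degrees\<close>
      have "norm v \<le> (R / \<theta>)\<^sup>2"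
      proof -
        have "norm v \<le> R * R" unfolding v norm_mult using R R0 by (intro mult_mono) auto
        also have "\<dots> \<le> (R / \<theta>) * (R / \<theta>)" using R0 \<theta> by (intro mult_mono) (auto simp: divide_simps mult_left_le)
        finally show ?thesis by (simp add: power2_eq_square)
      qed
      then have "norm v ^ p * norm (geg l (m - 2 * p) u v) \<le> ((R / \<theta>)\<^sup>2) ^ p * (C * (R / \<theta>) ^ (m - 2 * p))"
        using C' by (intro mult_mono power_mono) auto
      also have "\<dots> = C * (R / \<theta>) ^ m" using True by (simp add: mult_ac flip: power_mult power_add)
      finally show ?thesis using True by (simp add: norm_mult norm_power)
    next
      case False then show ?thesis using C R0 \<theta> by simp
    qed
    then show ?thesis unfolding pzonal_def using C'[of m] norm_triangle_ineq4[of "geg l m u v" "if 2 * p \<le> m then v ^ p * geg l (m - 2 * p) u v else 0"] by simp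
  qed
  then show ?thesis using C(1) by (intro exI[of _ "2 * C"]) simp
qed

lemma pzonal_generating:
  assumes u: "2 * u = z1 + z2" and v: "v = z1 * z2" and z: "norm z1 < 1" "norm z2 < 1"
  shows "(\<lambda>m. pzonal l p m u v) sums ((1 - v ^ p) * ((1 - z1) powr (- l) * (1 - z2) powr (- l)))"
proof -
  let ?G = "(1 - z1) powr (- l) * (1 - z2) powr (- l)"
  have g: "(\<lambda>a. geg l a u v) sums ?G" by (rule geg_generating[OF u v z])
  have "(\<lambda>m. (\<lambda>m. if 2 * p \<le> m then v ^ p * geg l (m - 2 * p) u v else 0) (m + 2 * p)) sums (v ^ p * ?G)"
    using sums_mult[OF g, of "v ^ p"] by simp
  then have "(\<lambda>m. if 2 * p \<le> m then v ^ p * geg l (m - 2 * p) u v else 0) sums (v ^ p * ?G)"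
    by (subst (asm) sums_iff_shift) simp
  from sums_diff[OF g this] show ?thesis unfolding pzonal_def by (simp add: algebra_simps)
qed

text \<open>Dilation and rotation of \<open>x\<close> act on \<open>u\<close> and \<open>v\<close> in this way, so each zonal polynomial is homogeneous under
  both.\<close>

lemma pzonal_scale: "pzonal l p m (w * u) (w\<^sup>2 * v) = w ^ m * pzonal l p m u v"
proof -
  have g: "geg l a (w * u) (w\<^sup>2 * v) = w ^ a * geg l a u v" for a
    unfolding geg_def sum_distrib_left
  proof (rule sum.cong[OF refl])
    fix k assume "k \<in> {..a div 2}"
    then have "w ^ a = w ^ (a - 2 * k) * (w\<^sup>2) ^ k" by (simp flip: power_mult power_add)
    then show "geg_coef l (a - 2 * k) k * (w * u) ^ (a - 2 * k) * (w\<^sup>2 * v) ^ k = w ^ a * (geg_coef l (a - 2 * k) k * u ^ (a - 2 * k) * v ^ k)"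
      by (simp add: power_mult_distrib mult_ac)
  qed
  have "(w\<^sup>2) ^ p * w ^ (m - 2 * p) = w ^ m" if "2 * p \<le> m" using that by (simp flip: power_mult power_add)
  then show ?thesis unfolding pzonal_def g by (auto simp: power_mult_distrib algebra_simps)
qed

text \<open>The arguments of \<open>a\<close> and \<open>b\<close> lie in \<open>(-\<pi>/2, \<pi>/2)\<close>, so their sum stays in the principal range.\<close>

lemma powr_mult_Re_pos:
  assumes "Re a > 0" "Re b > 0"
  shows "(a * b) powr c = a powr c * b powr (c::complex)"
proof -
  have nz: "a \<noteq> 0" "b \<noteq> 0" using assms by auto
  have "Im (Ln a) < pi / 2" "Im (Ln a) > - (pi / 2)" "Im (Ln b) < pi / 2" "Im (Ln b) > - (pi / 2)"
    using Re_Ln_pos_lt[OF nz(1)] Re_Ln_pos_lt[OF nz(2)] assms by (auto simp: abs_less_iff)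
  then have "Ln (a * b) = Ln a + Ln b"
    by (intro Ln_times_simple nz) linarith+
  then show ?thesis using nz by (simp add: powr_def exp_add[symmetric] algebra_simps)
qed

section \<open>Growth of the homogeneous parts\<close>

text \<open>Induction on the number of nodes: dividing by \<open>X - x0\<close> leaves a quotient whose values at the remaining nodes are controlled by those of
  \<open>P\<close>.\<close>

lemma coefficients_bounded_by_values:
  assumes "finite X" "card X = p"
  shows "\<exists>C\<ge>0. \<forall>P::complex poly. degree P < p \<longrightarrow> (\<forall>i. norm (coeff P i) \<le> C * (\<Sum>x\<in>X. norm (poly P (complex_of_real x))))"
  using assms
proof (induction p arbitrary: X)
  case 0 then show ?case by (intro exI[of _ 0]) auto
next
  case (Suc p)
  then obtain x0 X' where X: "X = insert x0 X'" "x0 \<notin> X'" "card X' = p" "finite X'"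
    by (metis card_Suc_eq_finite)
  obtain C where C: "C \<ge> 0" "\<And>P :: complex poly. \<And>i. degree P < p \<Longrightarrow> norm (coeff P i) \<le> C * (\<Sum>x\<in>X'. norm (poly P (complex_of_real x)))"
    using Suc.IH[OF X(4,3)] by blast
  define K where "K = (\<Sum>x\<in>X'. 1 / \<bar>x - x0\<bar>)"
  have K0: "K \<ge> 0" unfolding K_def by (intro sum_nonneg) auto
  have main: "norm (coeff P i) \<le> (C * K * (1 + \<bar>x0\<bar>) + 1) * (\<Sum>x\<in>X. norm (poly P (complex_of_real x)))"
    if P: "degree P < Suc p" for P :: "complex poly" and i
  proof -
    let ?x0 = "complex_of_real x0"
    define T where "T = (\<Sum>x\<in>X. norm (poly P (complex_of_real x)))"
    have T: "norm (poly P ?x0) \<le> T" "T \<ge> 0" unfolding T_def X(1) using X by (auto simp: sum_nonneg)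
    define Q where "Q = synthetic_div P ?x0"
    have PQ: "P = [:- ?x0, 1:] * Q + [:poly P ?x0:]" unfolding Q_def by (rule synthetic_div_correct'[symmetric])
    have Qb: "norm (coeff Q j) \<le> C * K * T" for j
    proof (cases "p = 0")
      case True
      then have "degree P = 0" using P by simp
      then have "Q = 0" by (simp add: Q_def synthetic_div_eq_0_iff)
      then show ?thesis using C(1) K0 T by simp
    next
      case False
      have "degree Q < p" using P False by (simp add: Q_def degree_synthetic_div)
      then have "norm (coeff Q j) \<le> C * (\<Sum>x\<in>X'. norm (poly Q (complex_of_real x)))" by (rule C(2))
      also have "(\<Sum>x\<in>X'. norm (poly Q (complex_of_real x))) \<le> (\<Sum>x\<in>X'. 1 / \<bar>x - x0\<bar> * T)"
      proof (rule sum_mono)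
        fix x assume x: "x \<in> X'"
        have ne: "x \<noteq> x0" using x X by auto
        have "poly P (complex_of_real x) = complex_of_real (x - x0) * poly Q (complex_of_real x) + poly P ?x0"
          by (subst PQ) (simp add: algebra_simps)
        then have "norm (complex_of_real (x - x0) * poly Q (complex_of_real x)) \<le> norm (poly P (complex_of_real x)) + norm (poly P ?x0)"
          using norm_triangle_ineq4[of "poly P (complex_of_real x)" "poly P ?x0"] by simp
        also have "\<dots> \<le> T"
        proof -
          have "(\<Sum>x\<in>{x, x0}. norm (poly P (complex_of_real x))) \<le> T" unfolding T_def
            by (rule sum_mono2) (use X x in auto)
          then show ?thesis using ne by simp
        qed
        finally have "\<bar>x - x0\<bar> * norm (poly Q (complex_of_real x)) \<le> T" by (simp only: norm_mult norm_of_real)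
        then show "norm (poly Q (complex_of_real x)) \<le> 1 / \<bar>x - x0\<bar> * T" using ne by (simp add: field_simps)
      qed
      also have "\<dots> = K * T" by (simp add: K_def sum_distrib_right)
      finally show ?thesis using C(1) by (simp add: mult_left_mono mult.assoc)
    qed
    have "coeff P i = (if i = 0 then 0 else coeff Q (i - 1)) - ?x0 * coeff Q i + (if i = 0 then poly P ?x0 else 0)"
      by (subst PQ) (cases i, simp_all)
    then have "norm (coeff P i) \<le> norm (if i = 0 then 0 else coeff Q (i - 1)) + norm (?x0 * coeff Q i) + norm (if i = 0 then poly P ?x0 else 0)"
      by (metis (no_types, lifting) norm_triangle_ineq norm_triangle_ineq4 order_trans add_right_mono)
    also have "\<dots> \<le> C * K * T + \<bar>x0\<bar> * (C * K * T) + T"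
    proof (intro add_mono)
      have "0 \<le> C * K * T" using C(1) K0 T by simp
      then show "norm (if i = 0 then 0 else coeff Q (i - 1)) \<le> C * K * T" using Qb by simp
      show "norm (?x0 * coeff Q i) \<le> \<bar>x0\<bar> * (C * K * T)" using Qb by (simp add: norm_mult mult_left_mono)
      show "norm (if i = 0 then poly P ?x0 else 0) \<le> T" using T by simp
    qed
    finally show ?thesis by (simp add: T_def algebra_simps)
  qed
  show ?case
    by (rule exI[of _ "C * K * (1 + \<bar>x0\<bar>) + 1"]) (use C(1) K0 main in auto)
qed

lemma sum_coefficients_bounded_by_values:
  assumes "finite X" "card X = p"
  shows "\<exists>C\<ge>0. \<forall>B::nat \<Rightarrow> complex. \<forall>i<p. norm (B i) \<le> C * (\<Sum>x\<in>X. norm (\<Sum>i<p. B i * complex_of_real x ^ i))"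
proof -
  obtain C where C: "C \<ge> 0" "\<And>P :: complex poly. \<And>i. degree P < p \<Longrightarrow> norm (coeff P i) \<le> C * (\<Sum>x\<in>X. norm (poly P (complex_of_real x)))"
    using coefficients_bounded_by_values[OF assms] by blast
  have "norm (B i) \<le> C * (\<Sum>x\<in>X. norm (\<Sum>i<p. B i * complex_of_real x ^ i))" if i: "i < p" for B i
  proof -
    define P where "P = (\<Sum>i<p. monom (B i) i)"
    have "coeff P j = (if j < p then B j else 0)" for j
      by (simp add: P_def coeff_sum if_distrib cong: if_cong)
    moreover have "degree P < p" using i unfolding P_def
      by (intro degree_sum_less) (auto intro: le_less_trans[OF degree_monom_le])
    moreover have "poly P z = (\<Sum>i<p. B i * z ^ i)" for z by (simp add: P_def poly_sum poly_monom)
    ultimately show ?thesis using C(2)[of P i] i by simp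
  qed
  then show ?thesis using C(1) by blast
qed

text \<open>The quadratic \<open>1 - 2(b \<cdot> x)t + |b|\<^sup>2|x|\<^sup>2t\<^sup>2\<close> has nonpositive discriminant by Cauchy-Schwarz, so its
  reciprocal roots are complex conjugates of modulus \<open>|b||x|\<close>.\<close>

lemma real_vector_roots:
  fixes x b :: "real^'n::finite"
  shows "\<exists>z1 z2. 2 * lin b x = z1 + z2 \<and> nsq b * nsq x = z1 * z2 \<and> norm z1 = norm b * norm x \<and> norm z2 = norm b * norm x"
proof -
  define d where "d = sqrt ((norm b * norm x)\<^sup>2 - (b \<bullet> x)\<^sup>2)"
  have "(b \<bullet> x)\<^sup>2 \<le> (norm b * norm x)\<^sup>2"
    using Cauchy_Schwarz_ineq2[of b x] by (metis abs_ge_zero power2_abs power_mono)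
  then have d: "d\<^sup>2 = (norm b * norm x)\<^sup>2 - (b \<bullet> x)\<^sup>2" by (simp add: d_def)
  define z where "z = Complex (b \<bullet> x) d"
  have n: "norm z = norm b * norm x" by (simp add: z_def cmod_def d)
  have "z + cnj z = 2 * lin b x" by (simp add: z_def lin_def complex_eq_iff)
  moreover have "z * cnj z = nsq b * nsq x"
    unfolding complex_norm_square[of z, symmetric] n by (simp add: nsq_def power_mult_distrib)
  ultimately show ?thesis using n by (intro exI[of _ z] exI[of _ "cnj z"]) simp
qed

lemma pzonal_real_bound:
  assumes \<theta>: "0 < \<theta>" "\<theta> < 1"
  shows "\<exists>C\<ge>0. \<forall>m (b::real^'n::finite) x. norm (pzonal l p m (lin b x) (nsq b * nsq x)) \<le> C * (norm b * norm x / \<theta>) ^ m"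
proof -
  obtain C where C: "C \<ge> 0" "\<forall>m u v z1 z2 R. 2 * u = z1 + z2 \<longrightarrow> v = z1 * z2 \<longrightarrow> norm z1 \<le> R \<longrightarrow> norm z2 \<le> R \<longrightarrow>
     norm (pzonal l p m u v) \<le> C * (R / \<theta>) ^ m" using pzonal_bound[OF \<theta>] by blast
  have "norm (pzonal l p m (lin b x) (nsq b * nsq x)) \<le> C * (norm b * norm x / \<theta>) ^ m" for m and b x :: "real^'n"
  proof -
    obtain z1 z2 where "2 * lin b x = z1 + z2" "nsq b * nsq x = z1 * z2" "norm z1 = norm b * norm x" "norm z2 = norm b * norm x"
      using real_vector_roots[of b x] by blast
    then show ?thesis using C(2)[rule_format, of "lin b x" z1 z2 "nsq b * nsq x" "norm b * norm x" m] by simp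
  qed
  then show ?thesis using C(1) by blast
qed

lemma integral_power_indicator:
  assumes "0 \<le> \<rho>" "\<rho> \<le> 1"
  shows "set_integrable lborel {0..1} (\<lambda>s. s ^ k * indicat_real {..\<rho>} s)"
    and "(LINT s:{0..1}|lborel. s ^ k * indicat_real {..\<rho>} s) = \<rho> ^ Suc k / real (Suc k)"
proof -
  have e: "indicat_real {0..1} s *\<^sub>R (s ^ k * indicat_real {..\<rho>} s) = indicat_real {0..\<rho>} s *\<^sub>R s ^ k" for s
    using assms by (auto simp: indicator_def)
  show "set_integrable lborel {0..1} (\<lambda>s. s ^ k * indicat_real {..\<rho>} s)"
    unfolding set_integrable_def e by (intro borel_integrable_atLeastAtMost'[unfolded set_integrable_def] continuous_intros)
  show "(LINT s:{0..1}|lborel. s ^ k * indicat_real {..\<rho>} s) = \<rho> ^ Suc k / real (Suc k)"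
    unfolding set_lebesgue_integral_def e using integral_power[OF assms(1), of k] by (simp add: mult.commute)
qed

context homogeneous_expansion begin

lemma bounded_on_cball: assumes "0 < r" "r < 1" shows "\<exists>K\<ge>0. \<forall>x\<in>cball 0 r. norm (u x) \<le> K"
proof -
  have "1 < 1 / r" using assms by (simp add: field_simps)
  from Phi_bounded[OF assms(1) _ this] obtain \<delta> M where \<delta>: "\<delta> > 0"
    and M: "\<forall>x\<in>cball 0 r. \<forall>w\<in>ball (complex_of_real 1) \<delta>. norm (\<Phi> w x) \<le> M" by auto
  have "norm (u x) \<le> max M 0" if "x \<in> cball 0 r" for x
  proof -
    have "norm (\<Phi> (complex_of_real 1) x) \<le> M" using M that \<delta> by simp
    moreover have "\<Phi> (complex_of_real 1) x = u (1 *\<^sub>R x)" by (rule Phi_real) (use that assms in auto)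
    ultimately show ?thesis by simp
  qed
  then show ?thesis by (intro exI[of _ "max M 0"]) auto
qed

text \<open>Among the Almansi components of all the \<open>q m\<close>, only those that are harmonic of degree exactly \<open>a\<close> see the zonal harmonic,
  and they occur in the degrees \<open>a + 2i\<close> with \<open>i < p\<close>. The dependence on \<open>\<rho>\<close> through
  \<open>\<rho>\<^sup>2\<^sup>i\<close> tells them apart.\<close>

lemma zonal_moment:
  assumes lap: "\<And>m. (laplacian ^^ p) (q m) = (\<lambda>x. 0)" and \<rho>: "0 < \<rho>" "\<rho> < 1"
    and h: "\<And>m k. k < p \<Longrightarrow> homogeneous_polynomial (m - 2 * k) (h m k)" "\<And>m k. k < p \<Longrightarrow> laplacian (h m k) = (\<lambda>x. 0)"
      "\<And>m k. k < p \<Longrightarrow> m < 2 * k \<Longrightarrow> h m k = (\<lambda>x. 0)" and qh: "\<And>m x. q m x = (\<Sum>k<p. nsq x ^ k * h m k x)"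
  defines "Z \<equiv> \<lambda>a b x. pzonal (of_nat CARD('n) / 2) 1 a (lin b x) (nsq b * nsq x)"
  shows "(LINT x|lborel. u x * (Z a b x * complex_of_real (indicator {..\<rho>} (norm x)))) =
    (\<Sum>i<p. sphere_integral (\<lambda>x::real^'n. 1) * h (a + 2 * i) i b * complex_of_real (\<rho> ^ (CARD('n) + 2 * a + 2 * i) / real (CARD('n) + 2 * a + 2 * i)))"
    (is "(LINT x|lborel. u x * ?\<phi> x) = _")
proof -
  let ?S1 = "sphere_integral (\<lambda>x::real^'n. 1)"
  define c where "c m = complex_of_real (\<rho> ^ (CARD('n) + m + a) / real (CARD('n) + m + a))" for m
  have pZ: "homogeneous_polynomial a (Z a b)" unfolding Z_def by (rule hp_pzonal)
  have ev: "indicat_real (cball 0 1) x *\<^sub>R ?\<phi> x = ?\<phi> x" for x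
    using \<rho> by (auto simp: indicator_def)
  have ev2: "indicat_real (cball 0 1) x *\<^sub>R (f x * complex_of_real (indicat_real {..\<rho>} (norm x))) = f x * complex_of_real (indicat_real {..\<rho>} (norm x))" for f :: "real^'n \<Rightarrow> complex" and x
    using \<rho> by (auto simp: indicator_def)
  have \<phi>int: "integrable lborel ?\<phi>"
    using polar_hp(1)[OF pZ, of "indicat_real {..\<rho>}"] integral_power_indicator(1)[of \<rho>] \<rho>
    unfolding set_integrable_def ev2 by simp
  have S: "sphere_integral (\<lambda>x. q m x * Z a b x) = (\<Sum>i<p. if m = a + 2 * i then ?S1 * h m i b else 0)" for m
  proof -
    have t: "polyf (\<lambda>x. h m i x * Z a b x)" if "i < p" for i
      using that by (intro polyf_mult hp_polyf[OF h(1)] hp_polyf[OF pZ])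
    have t2: "polyf (\<lambda>x. nsq x ^ i * (h m i x * Z a b x))" if "i < p" for i
      by (intro polyf_mult[OF _ t[OF that]] hp_polyf[OF hp_power[OF hp_nsq]])
    have "(\<lambda>x. q m x * Z a b x) = (\<lambda>x. \<Sum>i<p. nsq x ^ i * (h m i x * Z a b x))"
      unfolding qh by (simp add: sum_distrib_right mult.assoc)
    then have "sphere_integral (\<lambda>x. q m x * Z a b x) = (\<Sum>i<p. sphere_integral (\<lambda>x. nsq x ^ i * (h m i x * Z a b x)))"
      by (simp only:) (rule sphere_sum, rule t2, simp)
    also have "\<dots> = (\<Sum>i<p. if m = a + 2 * i then ?S1 * h m i b else 0)"
    proof (rule sum.cong[OF refl])
      fix i assume "i \<in> {..<p}" then have i: "i < p" by simp
      have "sphere_integral (\<lambda>x. nsq x ^ i * (h m i x * Z a b x)) = sphere_integral (\<lambda>x. h m i x * Z a b x)"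
        by (rule sphere_nsq_power[OF t[OF i]])
      also have "\<dots> = (if m - 2 * i = a then ?S1 * h m i b else 0)"
        unfolding Z_def by (rule zonal_reproducing[OF h(1,2)[OF i]])
      also have "\<dots> = (if m = a + 2 * i then ?S1 * h m i b else 0)"
        using h(3)[OF i, of m] by (cases "m < 2 * i") auto
      finally show "sphere_integral (\<lambda>x. nsq x ^ i * (h m i x * Z a b x)) = (if m = a + 2 * i then ?S1 * h m i b else 0)" .
    qed
    finally show ?thesis .
  qed
  have I: "(LINT x|lborel. q m x * ?\<phi> x) = sphere_integral (\<lambda>x. q m x * Z a b x) * c m" for m
  proof -
    have "(LINT x|lborel. q m x * ?\<phi> x) = (LINT x:cball 0 1|lborel. (q m x * Z a b x) * complex_of_real (indicat_real {..\<rho>} (norm x)))"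
      unfolding set_lebesgue_integral_def
      by (rule Bochner_Integration.integral_cong[OF refl]) (use \<rho> in \<open>auto simp: indicator_def\<close>)
    also have "\<dots> = sphere_integral (\<lambda>x. q m x * Z a b x) * complex_of_real (LINT s:{0..1}|lborel. s ^ (CARD('n) + (m + a) - 1) * indicat_real {..\<rho>} s)"
      by (rule polar_hp(2)[OF hp_mult[OF hp pZ]]) (use integral_power_indicator(1)[of \<rho>] \<rho> in auto)
    also have "(LINT s:{0..1}|lborel. s ^ (CARD('n) + (m + a) - 1) * indicat_real {..\<rho>} s) = \<rho> ^ (CARD('n) + m + a) / real (CARD('n) + m + a)"
    proof -
      have "Suc (CARD('n) + (m + a) - 1) = CARD('n) + m + a" by simp
      then show ?thesis using integral_power_indicator(2)[of \<rho> "CARD('n) + (m + a) - 1"] \<rho> by (simp only:)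
    qed
    finally show ?thesis by (simp add: c_def)
  qed
  have "(LINT x|lborel. u x * ?\<phi> x) = (\<Sum>m\<le>a + 2 * p. LINT x|lborel. q m x * ?\<phi> x)"
  proof (rule termwise_integral[OF \<rho> \<phi>int])
    show "?\<phi> x = 0" if "norm x > \<rho>" for x using that by simp
    show "(LINT x|lborel. q m x * ?\<phi> x) = 0" if "m > a + 2 * p" for m
      unfolding I S using that by (simp add: sum.neutral)
  qed
  also have "\<dots> = (\<Sum>m\<le>a + 2 * p. \<Sum>i<p. if m = a + 2 * i then ?S1 * h m i b * c m else 0)"
    unfolding I S by (simp add: sum_distrib_right if_distrib[of "\<lambda>z. z * _"] cong: if_cong)
  also have "\<dots> = (\<Sum>i<p. \<Sum>m\<le>a + 2 * p. if m = a + 2 * i then ?S1 * h m i b * c m else 0)" by (rule sum.swap)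
  also have "\<dots> = (\<Sum>i<p. ?S1 * h (a + 2 * i) i b * c (a + 2 * i))"
    by (intro sum.cong refl) (auto simp: sum.delta)
  also have "\<dots> = (\<Sum>i<p. ?S1 * h (a + 2 * i) i b * complex_of_real (\<rho> ^ (CARD('n) + 2 * a + 2 * i) / real (CARD('n) + 2 * a + 2 * i)))"
  proof (intro sum.cong refl)
    fix i
    have e: "CARD('n) + (a + 2 * i) + a = CARD('n) + 2 * a + 2 * i" by simp
    show "?S1 * h (a + 2 * i) i b * c (a + 2 * i) = ?S1 * h (a + 2 * i) i b * complex_of_real (\<rho> ^ (CARD('n) + 2 * a + 2 * i) / real (CARD('n) + 2 * a + 2 * i))"
      unfolding c_def e ..
  qed
  finally show ?thesis .
qed

text \<open>The moments of \<open>zonal_moment\<close> are bounded by the size of \<open>u\<close> on a ball of radius less than one and of the zonal harmonic.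
  Taking \<open>p\<close> different radii and inverting the resulting polynomial system bounds every harmonic component, with a loss that is geometric
  in the degree and as close to \<open>1\<close> as desired.\<close>

lemma coefficient_growth:
  assumes lap: "\<And>m. (laplacian ^^ p) (q m) = (\<lambda>x. 0)" and s: "0 < s" "s < 1"
  shows "\<exists>M\<ge>0. \<forall>m x. norm x \<le> 1 \<longrightarrow> norm (q m x) \<le> M / s ^ m"
proof -
  let ?n = "CARD('n)"
  let ?S1 = "sphere_integral (\<lambda>x::real^'n. 1)"
  have S1: "?S1 \<noteq> 0"
  proof -
    have "real ?n * unit_ball_vol (real ?n) > 0" by simp
    then show ?thesis unfolding sphere_one by (metis less_irrefl of_real_eq_0_iff)
  qed
  have "\<forall>m. \<exists>h. (\<forall>k<p. homogeneous_polynomial (m - 2 * k) (h k) \<and> laplacian (h k) = (\<lambda>x. 0) \<and>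
              (m < 2 * k \<longrightarrow> h k = (\<lambda>x. 0))) \<and> (\<forall>x. q m x = (\<Sum>k<p. nsq x ^ k * h k x))"
    by (intro allI almansi_decomposition hp lap)
  then obtain h where h': "\<forall>m. (\<forall>k<p. homogeneous_polynomial (m - 2 * k) (h m k) \<and> laplacian (h m k) = (\<lambda>x. 0) \<and>
              (m < 2 * k \<longrightarrow> h m k = (\<lambda>x. 0))) \<and> (\<forall>x. q m x = (\<Sum>k<p. nsq x ^ k * h m k x))"
    by (rule choice[THEN exE])
  have h: "homogeneous_polynomial (m - 2 * k) (h m k)" "laplacian (h m k) = (\<lambda>x. 0)"
      "m < 2 * k \<Longrightarrow> h m k = (\<lambda>x. 0)" if "k < p" for m k
    using h' that by simp_all
  have qh: "q m x = (\<Sum>k<p. nsq x ^ k * h m k x)" for m x using h' by simp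
  \<comment> \<open>The estimate loses three factors \<open>\<theta>\<^sup>-\<^sup>m\<close>: one from the radii, which are at least \<open>\<theta>\<close>, one from the
    bound on the zonal harmonic, and one that absorbs the linear factor \<open>n + 2m\<close> from the radial integration.\<close>
  define \<theta> where "\<theta> = root 3 s"
  have \<theta>: "0 < \<theta>" "\<theta> < 1" "\<theta> ^ 3 = s" using s by (auto simp: \<theta>_def)
  \<comment> \<open>\<open>p\<close> distinct radii in \<open>[\<theta>, 1)\<close>\<close>
  define r where "r k = \<theta> + (1 - \<theta>) * (real k / (real p + 1))" for k :: nat
  have r: "\<theta> \<le> r k" "r k \<le> r p" "r k < 1" if "k \<le> p" for k
  proof -
    show "\<theta> \<le> r k" using \<theta> by (simp add: r_def)
    have "real k / (real p + 1) \<le> real p / (real p + 1)" using that by (intro divide_right_mono) auto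
    then have "(1 - \<theta>) * (real k / (real p + 1)) \<le> (1 - \<theta>) * (real p / (real p + 1))"
      using \<theta> by (intro mult_left_mono) auto
    then show "r k \<le> r p" by (simp add: r_def)
    have "real k / (real p + 1) < 1" using that by simp
    then have "(1 - \<theta>) * (real k / (real p + 1)) < (1 - \<theta>) * 1" using \<theta> by (intro mult_strict_left_mono) auto
    then show "r k < 1" by (simp add: r_def)
  qed
  have rinj: "r i < r k" if "i < k" for i k
  proof -
    have "real i / (real p + 1) < real k / (real p + 1)" using that by (intro divide_strict_right_mono) auto
    then have "(1 - \<theta>) * (real i / (real p + 1)) < (1 - \<theta>) * (real k / (real p + 1))"
      using \<theta> by (intro mult_strict_left_mono) auto
    then show ?thesis by (simp add: r_def)
  qed
  have rpos: "0 < r k" if "k \<le> p" for k using r(1)[OF that] \<theta> by simp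
  define X where "X = (\<lambda>k. (r k)\<^sup>2) ` {..<p}"
  have injX: "inj_on (\<lambda>k. (r k)\<^sup>2) {..<p}"
  proof (rule inj_onI)
    fix i k assume ik: "i \<in> {..<p}" "k \<in> {..<p}" "(r i)\<^sup>2 = (r k)\<^sup>2"
    then have "r i = r k" using rpos[of i] rpos[of k] by (auto intro: power2_eq_imp_eq)
    then show "i = k" using rinj[of i k] rinj[of k i] by (metis less_irrefl linorder_neqE_nat)
  qed
  have X: "finite X" "card X = p" unfolding X_def using card_image[OF injX] by auto
  obtain CX where CX: "CX \<ge> 0" "\<forall>B::nat \<Rightarrow> complex. \<forall>i<p. norm (B i) \<le> CX * (\<Sum>x\<in>X. norm (\<Sum>i<p. B i * complex_of_real x ^ i))"
    using sum_coefficients_bounded_by_values[OF X] by blast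
  obtain K where K: "K \<ge> 0" "\<And>x. x \<in> cball 0 (r p) \<Longrightarrow> norm (u x) \<le> K"
    using bounded_on_cball[OF rpos r(3)] by blast
  obtain CZ where CZ: "CZ \<ge> 0" "\<forall>m (b::real^'n) x. norm (pzonal (of_nat ?n / 2) 1 m (lin b x) (nsq b * nsq x)) \<le> CZ * (norm b * norm x / \<theta>) ^ m"
    using pzonal_real_bound[OF \<theta>(1,2)] by blast
  define V where "V = measure lborel (cball (0::real^'n) 1)"
  define D where "D = CX * (real p * (K * CZ * V / \<theta> ^ ?n))"
  have D0: "D \<ge> 0" unfolding D_def V_def using CX K CZ \<theta> by simp
  have hb: "norm (h (a + 2 * i) i b) \<le> D / norm ?S1 * real (?n + 2 * a + 2 * i) / (\<theta>\<^sup>2) ^ a" if b: "norm b \<le> 1" and i: "i < p" for a i b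
  proof -
    define Z where "Z x = pzonal (of_nat ?n / 2) 1 a (lin b x) (nsq b * nsq x)" for x :: "real^'n"
    \<comment> \<open>the coefficients of the polynomial in \<open>\<rho>\<^sup>2\<close> given by \<open>zonal_moment\<close>\<close>
    define B where "B i = ?S1 * h (a + 2 * i) i b / of_nat (?n + 2 * a + 2 * i)" for i
    have Bval: "norm (\<Sum>i<p. B i * complex_of_real ((r k)\<^sup>2) ^ i) \<le> K * CZ * V / \<theta> ^ ?n / (\<theta>\<^sup>2) ^ a" if k: "k < p" for k
    proof -
      define \<rho> where "\<rho> = r k"
      have \<rho>: "0 < \<rho>" "\<rho> < 1" "\<theta> \<le> \<rho>" "\<rho> \<le> r p" using r[of k] rpos[of k] k by (auto simp: \<rho>_def)
      let ?I = "LINT x|lborel. u x * (Z x * complex_of_real (indicator {..\<rho>} (norm x)))"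
      have "?I = (\<Sum>i<p. ?S1 * h (a + 2 * i) i b * complex_of_real (\<rho> ^ (?n + 2 * a + 2 * i) / real (?n + 2 * a + 2 * i)))"
        unfolding Z_def by (rule zonal_moment[OF lap \<rho>(1,2) h qh])
      also have "\<dots> = complex_of_real \<rho> ^ (?n + 2 * a) * (\<Sum>i<p. B i * complex_of_real (\<rho>\<^sup>2) ^ i)"
        unfolding sum_distrib_left
      proof (intro sum.cong refl)
        fix i
        have "\<rho> ^ (?n + 2 * a + 2 * i) = \<rho> ^ (?n + 2 * a) * (\<rho>\<^sup>2) ^ i" by (simp only: power_add power_mult)
        then show "?S1 * h (a + 2 * i) i b * complex_of_real (\<rho> ^ (?n + 2 * a + 2 * i) / real (?n + 2 * a + 2 * i)) =
          complex_of_real \<rho> ^ (?n + 2 * a) * (B i * complex_of_real (\<rho>\<^sup>2) ^ i)"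
          unfolding B_def by (simp del: of_nat_add)
      qed
      finally have Ieq: "norm ?I = \<rho> ^ (?n + 2 * a) * norm (\<Sum>i<p. B i * complex_of_real (\<rho>\<^sup>2) ^ i)"
        using \<rho> by (simp add: norm_mult norm_power)
      have "norm ?I \<le> K * (CZ * (\<rho> / \<theta>) ^ a) * V"
      proof (cases "integrable lborel (\<lambda>x. u x * (Z x * complex_of_real (indicator {..\<rho>} (norm x))))")
        case True
        have "norm ?I \<le> (LINT x|lborel. norm (u x * (Z x * complex_of_real (indicator {..\<rho>} (norm x)))))" by (rule integral_norm_bound)
        also have "\<dots> \<le> (LINT x|lborel. K * (CZ * (\<rho> / \<theta>) ^ a) * indicat_real (cball (0::real^'n) 1) x)"
        proof (rule integral_mono)
          show "integrable lborel (\<lambda>x. norm (u x * (Z x * complex_of_real (indicator {..\<rho>} (norm x)))))" using True by (rule integrable_norm)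
          show "integrable lborel (\<lambda>x. K * (CZ * (\<rho> / \<theta>) ^ a) * indicat_real (cball (0::real^'n) 1) x)"
            by (intro integrable_mult_right integrable_real_indicator) (auto simp: emeasure_cball_less_top)
          fix x :: "real^'n"
          show "norm (u x * (Z x * complex_of_real (indicator {..\<rho>} (norm x)))) \<le> K * (CZ * (\<rho> / \<theta>) ^ a) * indicat_real (cball 0 1) x"
          proof (cases "norm x \<le> \<rho>")
            case True
            have "norm (Z x) \<le> CZ * (norm b * norm x / \<theta>) ^ a" using CZ(2) by (simp add: Z_def)
            also have "\<dots> \<le> CZ * (\<rho> / \<theta>) ^ a"
              using CZ(1) \<theta> True mult_mono[OF b True] by (intro mult_left_mono power_mono divide_right_mono) auto
            finally have "norm (Z x) \<le> CZ * (\<rho> / \<theta>) ^ a" .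
            moreover have "norm (u x) \<le> K" by (rule K(2)) (use True \<rho> in auto)
            ultimately have "norm (u x) * norm (Z x) \<le> K * (CZ * (\<rho> / \<theta>) ^ a)" using K(1) by (intro mult_mono) auto
            then show ?thesis using True \<rho> by (simp add: norm_mult)
          next
            case False
            then show ?thesis using K(1) CZ(1) \<rho> \<theta> by (simp add: indicator_def)
          qed
        qed
        also have "\<dots> = K * (CZ * (\<rho> / \<theta>) ^ a) * V" by (simp add: V_def)
        finally show ?thesis .
      next
        case False
        then show ?thesis using K(1) CZ(1) \<rho> \<theta> by (simp add: not_integrable_integral_eq V_def)
      qed
      then have "norm (\<Sum>i<p. B i * complex_of_real (\<rho>\<^sup>2) ^ i) \<le> K * (CZ * (\<rho> / \<theta>) ^ a) * V / \<rho> ^ (?n + 2 * a)"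
        unfolding Ieq using \<rho> by (subst pos_le_divide_eq) (simp_all add: mult.commute)
      also have "\<dots> = K * CZ * V / (\<rho> ^ ?n * (\<rho> ^ a * \<theta> ^ a))"
      proof -
        have pe: "\<rho> ^ (?n + 2 * a) = \<rho> ^ ?n * (\<rho> ^ a * \<rho> ^ a)" by (simp add: power_add mult_2)
        have "\<rho> ^ a \<noteq> 0" using \<rho> by simp
        then show ?thesis unfolding pe power_divide by (simp add: divide_simps)
      qed
      also have "\<dots> \<le> K * CZ * V / (\<theta> ^ ?n * (\<theta> ^ a * \<theta> ^ a))"
        using K(1) CZ(1) \<rho> \<theta> by (intro divide_left_mono mult_mono power_mono mult_nonneg_nonneg mult_pos_pos) (auto simp: V_def)
      also have "\<dots> = K * CZ * V / \<theta> ^ ?n / (\<theta>\<^sup>2) ^ a"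
        by (simp add: power_mult_distrib power2_eq_square)
      finally show ?thesis by (simp add: \<rho>_def)
    qed
    have "norm (B i) \<le> CX * (\<Sum>x\<in>X. norm (\<Sum>i<p. B i * complex_of_real x ^ i))" using CX(2) i by blast
    also have "(\<Sum>x\<in>X. norm (\<Sum>i<p. B i * complex_of_real x ^ i)) = (\<Sum>k<p. norm (\<Sum>i<p. B i * complex_of_real ((r k)\<^sup>2) ^ i))"
      unfolding X_def using injX by (simp add: sum.reindex)
    also have "\<dots> \<le> (\<Sum>k<p. K * CZ * V / \<theta> ^ ?n / (\<theta>\<^sup>2) ^ a)"
      by (rule sum_mono) (use Bval in auto)
    also have "\<dots> = real p * (K * CZ * V / \<theta> ^ ?n / (\<theta>\<^sup>2) ^ a)" by simp
    finally have "norm (B i) \<le> D / (\<theta>\<^sup>2) ^ a"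
      using CX(1) by (simp add: D_def mult_left_mono)
    then have "norm (B i) * (real (?n + 2 * a + 2 * i) / norm ?S1) \<le> D / (\<theta>\<^sup>2) ^ a * (real (?n + 2 * a + 2 * i) / norm ?S1)"
      by (intro mult_right_mono) auto
    moreover have "norm (h (a + 2 * i) i b) = norm (B i) * (real (?n + 2 * a + 2 * i) / norm ?S1)"
      using S1 unfolding B_def by (simp add: norm_mult norm_divide del: of_nat_add)
    ultimately show ?thesis by (simp add: mult_ac del: of_nat_add)
  qed
  have "(\<lambda>m. of_nat m * \<theta> ^ m) \<longlonglongrightarrow> 0" by (rule powser_times_n_limit_0) (use \<theta> in auto)
  then obtain E where E: "\<And>m. norm (of_nat m * \<theta> ^ m) \<le> E"
    using convergent_imp_Bseq[OF convergentI] BseqE by blast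
  have E0: "E \<ge> 0" using E[of 0] by simp
  define M where "M = real p * (D / norm ?S1 * (real ?n + 2 * E))"
  have M0: "M \<ge> 0" unfolding M_def using D0 E0 by simp
  have "norm (q m x) \<le> M / s ^ m" if x: "norm x \<le> 1" for m x
  proof -
    have hm: "norm (nsq x ^ k * h m k x) \<le> D / norm ?S1 * (real ?n + 2 * E) / s ^ m" if k: "k < p" for k
    proof (cases "m < 2 * k")
      case True
      then show ?thesis using h(3)[OF k] D0 E0 s by simp
    next
      case False
      define a where "a = m - 2 * k"
      have m: "m = a + 2 * k" using False by (simp add: a_def)
      have "norm (nsq x ^ k * h m k x) \<le> norm (h m k x)"
        using x by (simp add: nsq_def norm_mult norm_power power_le_one mult_left_le_one_le)
      also have "\<dots> \<le> D / norm ?S1 * real (?n + 2 * a + 2 * k) / (\<theta>\<^sup>2) ^ a" using hb[OF x k, of a] m by simp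
      also have "\<dots> \<le> D / norm ?S1 * (real ?n + 2 * real m) / (\<theta>\<^sup>2) ^ m"
        using D0 \<theta> m by (intro frac_le mult_left_mono mult_nonneg_nonneg power_decreasing) (auto simp: power_le_one)
      also have "\<dots> = D / norm ?S1 * ((real ?n + 2 * real m) * \<theta> ^ m) / s ^ m"
      proof -
        have ps: "s ^ m = (\<theta>\<^sup>2) ^ m * \<theta> ^ m"
          unfolding \<theta>(3)[symmetric] by (simp add: power_mult_distrib[symmetric] power2_eq_square power3_eq_cube)
        show ?thesis unfolding ps using \<theta>(1) by simp
      qed
      also have "\<dots> \<le> D / norm ?S1 * (real ?n + 2 * E) / s ^ m"
      proof (intro divide_right_mono mult_left_mono)
        have "real m * \<theta> ^ m \<le> E" using E[of m] \<theta> by simp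
        moreover have "real ?n * \<theta> ^ m \<le> real ?n * 1" using \<theta> by (intro mult_left_mono) (auto simp: power_le_one)
        ultimately show "(real ?n + 2 * real m) * \<theta> ^ m \<le> real ?n + 2 * E" unfolding distrib_right mult.assoc by linarith
      qed (use D0 s in auto)
      finally show ?thesis .
    qed
    have "norm (q m x) \<le> (\<Sum>k<p. D / norm ?S1 * (real ?n + 2 * E) / s ^ m)"
      unfolding qh by (rule sum_norm_le) (use hm in auto)
    then show ?thesis by (simp add: M_def)
  qed
  then show ?thesis using M0 by blast
qed

end

section \<open>Radial moments of the weight\<close>

text \<open>The substitution \<open>t = s\<^sup>2\<close> gives a beta integral.\<close>

lemma weight_moment:
  assumes d: "real k + 1 + \<alpha> > 0" and \<beta>: "\<beta> > -1"
  shows "set_integrable lborel {0..1} (\<lambda>s. s ^ k * (s powr \<alpha> * (1 - s\<^sup>2) powr \<beta>))"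
    and "(LINT s:{0..1}|lborel. s ^ k * (s powr \<alpha> * (1 - s\<^sup>2) powr \<beta>)) = Beta ((real k + 1 + \<alpha>) / 2) (\<beta> + 1) / 2"
proof -
  define a where "a = (real k + 1 + \<alpha>) / 2"
  \<comment> \<open>the integrand after the substitution \<open>t = s\<^sup>2\<close>\<close>
  define f where "f t = 1 / 2 * (t powr (a - 1) * (1 - t) powr (\<beta> + 1 - 1))" for t :: real
  have a: "a > 0" using d by (simp add: a_def)
  have int0: "set_integrable lborel {0..1} (\<lambda>t. t powr (a - 1) * (1 - t) powr (\<beta> + 1 - 1))"
    by (rule integrable_Beta) (use a \<beta> in auto)
  have int: "set_integrable lborel {(\<lambda>s::real. s\<^sup>2) 0..(\<lambda>s. s\<^sup>2) 1} f"
    unfolding f_def by (intro set_integrable_mult_right) (use int0 in simp)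
  have val: "(LINT t:{0..1}|lborel. f t) = Beta a (\<beta> + 1) / 2"
  proof -
    have "(LINT t:{0..1}|lborel. t powr (a - 1) * (1 - t) powr (\<beta> + 1 - 1)) = integral {0..1} (\<lambda>t. t powr (a - 1) * (1 - t) powr (\<beta> + 1 - 1))"
      by (rule set_borel_integral_eq_integral(2)[OF int0])
    also have "\<dots> = Beta a (\<beta> + 1)" by (rule integral_unique, rule has_integral_Beta_real) (use a \<beta> in auto)
    finally show ?thesis unfolding f_def by simp
  qed
  have eq: "f (s\<^sup>2) * (2 * s) = s ^ k * (s powr \<alpha> * (1 - s\<^sup>2) powr \<beta>)" if "s \<in> {0..1}" for s
  proof (cases "s = 0")
    case False
    then have s: "s > 0" using that by auto
    have "(s\<^sup>2) powr (a - 1) = s powr (2 * (a - 1))"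
      using s by (simp add: powr_powr flip: powr_numeral)
    then have "(s\<^sup>2) powr (a - 1) * s = s powr (2 * (a - 1)) * s powr 1" using s by simp
    also have "\<dots> = s powr (2 * (a - 1) + 1)" by (simp only: powr_add)
    also have "2 * (a - 1) + 1 = real k + \<alpha>" by (simp add: a_def field_simps)
    also have "s powr (real k + \<alpha>) = s ^ k * s powr \<alpha>" using s by (simp add: powr_add powr_realpow)
    finally have "(s\<^sup>2) powr (a - 1) * s = s ^ k * s powr \<alpha>" .
    then show ?thesis by (simp add: f_def)
  qed (simp add: f_def)
  have der: "((\<lambda>s. s\<^sup>2) has_real_derivative 2 * s) (at s)" for s :: real
    by (auto intro!: derivative_eq_intros)
  have sub: "set_integrable lborel {0..1} (\<lambda>s. f (s\<^sup>2) * (2 * s))"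
    "(LBINT x. f x * indicator {0..1} x) = (LBINT s. f (s\<^sup>2) * (2 * s) * indicator {0..1} s)"
    using integral_substitution[OF int der] by (auto intro!: continuous_intros)
  have ieq: "indicat_real {0..1} s *\<^sub>R (f (s\<^sup>2) * (2 * s)) = indicat_real {0..1} s *\<^sub>R (s ^ k * (s powr \<alpha> * (1 - s\<^sup>2) powr \<beta>))" for s
    using eq[of s] by (cases "s \<in> {0..1}") auto
  show "set_integrable lborel {0..1} (\<lambda>s. s ^ k * (s powr \<alpha> * (1 - s\<^sup>2) powr \<beta>))"
    using sub(1) unfolding set_integrable_def ieq .
  have "(LINT s:{0..1}|lborel. s ^ k * (s powr \<alpha> * (1 - s\<^sup>2) powr \<beta>)) = (LBINT s. f (s\<^sup>2) * (2 * s) * indicator {0..1} s)"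
    unfolding set_lebesgue_integral_def ieq[symmetric] by (simp add: mult.commute)
  also have "\<dots> = (LINT t:{0..1}|lborel. f t)"
    unfolding sub(2)[symmetric] set_lebesgue_integral_def by (simp add: mult.commute)
  finally show "(LINT s:{0..1}|lborel. s ^ k * (s powr \<alpha> * (1 - s\<^sup>2) powr \<beta>)) = Beta ((real k + 1 + \<alpha>) / 2) (\<beta> + 1) / 2"
    unfolding val a_def .
qed

lemma weight_measurable: "(\<lambda>s::real. s powr \<alpha> * (1 - s\<^sup>2) powr \<beta>) \<in> borel_measurable borel"
  by measurable

lemma weight_integrable:
  assumes "real CARD('n::finite) + \<alpha> > 0" "\<beta> > -1"
  shows "set_integrable lborel (cball (0 :: real^'n) 1) (bergman_weight \<alpha> \<beta>)"
proof -
  have "set_integrable lborel (cball (0 :: real^'n) 1) (\<lambda>x. 1 * complex_of_real (norm x powr \<alpha> * (1 - (norm x)\<^sup>2) powr \<beta>))"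
  proof (rule polar_hp(1)[OF hp_const weight_measurable])
    have "real (CARD('n) + 0 - 1) + 1 + \<alpha> > 0" using assms by simp
    from weight_moment(1)[OF this assms(2)] show "set_integrable lborel {0..1} (\<lambda>s. s ^ (CARD('n) + 0 - 1) * (s powr \<alpha> * (1 - s\<^sup>2) powr \<beta>))" .
  qed
  then have "integrable lborel (\<lambda>x. Re (indicat_real (cball (0 :: real^'n) 1) x *\<^sub>R (1 * complex_of_real (norm x powr \<alpha> * (1 - (norm x)\<^sup>2) powr \<beta>))))"
    unfolding set_integrable_def by (rule integrable_Re)
  then show ?thesis unfolding set_integrable_def bergman_weight_def[abs_def] by simp
qed

section \<open>The homogeneous parts of the kernel\<close>

lemma polyf_expand_at: "polyf f \<Longrightarrow> \<exists>K c. finite K \<and> (\<forall>x. f x = (\<Sum>k\<in>K. c k * complex_of_real (monomial k (x - a))))"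
proof (induction rule: polyf.induct)
  case (polyf_const c)
  show ?case by (rule exI[of _ "{\<lambda>_. 0}"], rule exI[of _ "\<lambda>_. c"]) (simp add: monomial_def)
next
  case (polyf_coord j)
  let ?e = "\<lambda>i. if i = j then 1 else (0::nat)"
  have "monomial ?e x = x $ j" for x :: "real^'a"
    by (subst monomial_insert[of _ _ j]) (auto intro!: prod.neutral)
  moreover have "(\<lambda>_. 0) \<noteq> ?e" by (metis zero_neq_one)
  ultimately show ?case
    by (intro exI[of _ "{\<lambda>_. 0, ?e}"] exI[of _ "(\<lambda>_. 0)(?e := 1, (\<lambda>_. 0) := complex_of_real (a $ j))"])
       (auto simp: monomial_def[of "\<lambda>_. 0"])
next
  case (polyf_add f g)
  then obtain K c L d where K: "finite K" "\<And>x. f x = (\<Sum>k\<in>K. c k * complex_of_real (monomial k (x - a)))"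
    and L: "finite L" "\<And>x. g x = (\<Sum>k\<in>L. d k * complex_of_real (monomial k (x - a)))" by blast
  have "f x = (\<Sum>k\<in>K \<union> L. (if k \<in> K then c k else 0) * complex_of_real (monomial k (x - a)))" for x
    unfolding K(2) by (rule sum.mono_neutral_cong_left) (use K L in auto)
  moreover have "g x = (\<Sum>k\<in>K \<union> L. (if k \<in> L then d k else 0) * complex_of_real (monomial k (x - a)))" for x
    unfolding L(2) by (rule sum.mono_neutral_cong_left) (use K L in auto)
  ultimately have "f x + g x = (\<Sum>k\<in>K \<union> L. ((if k \<in> K then c k else 0) + (if k \<in> L then d k else 0)) * complex_of_real (monomial k (x - a)))" for x
    by (simp only: distrib_right sum.distrib)
  then show ?case using K(1) L(1) by (intro exI[of _ "K \<union> L"] exI[of _ "\<lambda>k. (if k \<in> K then c k else 0) + (if k \<in> L then d k else 0)"]) auto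
next
  case (polyf_mult f g)
  then obtain K c L d where K: "finite K" "\<And>x. f x = (\<Sum>k\<in>K. c k * complex_of_real (monomial k (x - a)))"
    and L: "finite L" "\<And>x. g x = (\<Sum>k\<in>L. d k * complex_of_real (monomial k (x - a)))" by blast
  let ?p = "\<lambda>z. (\<lambda>j. fst z j + snd z j)"
  define N where "N = ?p ` (K \<times> L)"
  define e where "e m = (\<Sum>z\<in>{z \<in> K \<times> L. ?p z = m}. c (fst z) * d (snd z))" for m
  have fin: "finite (K \<times> L)" using K L by simp
  have "f x * g x = (\<Sum>m\<in>N. e m * complex_of_real (monomial m (x - a)))" for x
  proof -
    have "f x * g x = (\<Sum>z\<in>K \<times> L. c (fst z) * d (snd z) * complex_of_real (monomial (?p z) (x - a)))"
      unfolding K(2) L(2) sum_product sum.cartesian_product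
      by (rule sum.cong) (auto simp: monomial_add mult_ac)
    also have "\<dots> = (\<Sum>m\<in>N. \<Sum>z\<in>{z \<in> K \<times> L. ?p z = m}. c (fst z) * d (snd z) * complex_of_real (monomial (?p z) (x - a)))"
      unfolding N_def by (rule sum.image_gen[OF fin])
    also have "\<dots> = (\<Sum>m\<in>N. e m * complex_of_real (monomial m (x - a)))"
      unfolding e_def sum_distrib_right by (intro sum.cong refl) auto
    finally show ?thesis .
  qed
  moreover have "finite N" using fin by (simp add: N_def)
  ultimately show ?case by blast
qed

lemma polyf_real_analytic: assumes "polyf f" shows "real_analytic_on f S"
  unfolding real_analytic_on_def
proof
  fix a assume "a \<in> S"
  obtain K c where K: "finite K" "\<And>x. f x = (\<Sum>k\<in>K. c k * complex_of_real (monomial k (x - a)))"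
    using polyf_expand_at[OF assms, of a] by blast
  have "((\<lambda>k. (if k \<in> K then c k else 0) * complex_of_real (monomial k (x - a))) has_sum f x) UNIV" for x
    by (rule has_sum_finite_neutralI[of K]) (use K in auto)
  then show "\<exists>r>0. \<exists>c. \<forall>x\<in>ball a r. ((\<lambda>k. c k * complex_of_real (monomial k (x - a))) has_sum f x) UNIV"
    by (intro exI[of _ 1] conjI zero_less_one exI[of _ "\<lambda>k. if k \<in> K then c k else 0"] ballI)
qed

lemma cnj_pochhammer: "cnj (pochhammer l k) = pochhammer (cnj l) k"
  by (induction k) (auto simp: pochhammer_Suc)

lemma cnj_pzonal: "cnj (pzonal l p m u v) = pzonal (cnj l) p m (cnj u) (cnj v)"
  by (simp add: pzonal_def geg_def geg_coef_def cnj_pochhammer)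

text \<open>The hypothesis gives \<open>l - m = 2(i - k)\<close> with \<open>0 < |i - k| < p\<close>, so the summands are the powers of a
  \<open>p\<close>-th root of unity different from \<open>1\<close>. This is why averaging over \<open>p\<close> balls with angles
  \<open>j\<pi>/p\<close> separates the degrees that the sphere does not.\<close>

lemma root_of_unity_sum:
  assumes p: "p > 0" and lm: "l + 2 * k = m + 2 * i" "i < p" "k < p" "l \<noteq> m"
  shows "(\<Sum>j<p. cis (real l * (real j * pi / real p)) * cis (- (real m * (real j * pi / real p)))) = 0"
proof -
  \<comment> \<open>an integer, since \<open>i - k\<close> may be negative\<close>
  define d where "d = int i - int k"
  have "real (l + 2 * k) = real (m + 2 * i)" using lm(1) by simp
  then have d: "real l - real m = 2 * real_of_int d" by (simp add: d_def)
  have d0: "d \<noteq> 0" "\<bar>d\<bar> < int p" using lm by (auto simp: d_def)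
  define z where "z = cis (2 * pi * (real_of_int d / real p))"
  have t: "cis (real l * (real j * pi / real p)) * cis (- (real m * (real j * pi / real p))) = z ^ j" for j
  proof -
    have "real l * (real j * pi / real p) - real m * (real j * pi / real p) = (real l - real m) * (real j * pi / real p)"
      by (simp add: left_diff_distrib diff_divide_distrib)
    also have "\<dots> = real j * (2 * pi * (real_of_int d / real p))" unfolding d by simp
    finally show ?thesis by (simp add: cis_mult z_def Complex.DeMoivre mult_ac)
  qed
  have zp: "z ^ p = 1"
  proof -
    have "z ^ p = cis (2 * pi * real_of_int d)" using p by (simp add: z_def Complex.DeMoivre mult_ac)
    also have "\<dots> = 1" by (rule cis_multiple_2pi) simp
    finally show ?thesis .
  qed
  have z1: "z \<noteq> 1"
  proof
    assume "z = 1"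
    then have "cos (2 * pi * (real_of_int d / real p)) = 1" by (simp add: z_def complex_eq_iff)
    then obtain n :: int where "2 * pi * (real_of_int d / real p) = real_of_int n * 2 * pi"
      using cos_one_2pi_int by blast
    then have "real_of_int d = real_of_int n * real p" using p by (simp add: field_simps)
    then have "real_of_int d = real_of_int (n * int p)" by simp
    then have dn: "d = n * int p" by (simp only: of_int_eq_iff)
    then have "n \<noteq> 0" using d0 by auto
    then have "int p \<le> \<bar>n\<bar> * int p" using p by (simp add: mult_le_cancel_right1)
    then show False using d0 dn p by (simp add: abs_mult)
  qed
  show ?thesis unfolding t using geometric_sum[OF z1, of p] zp by simp
qed

text \<open>The reciprocal of the surface area of the sphere times the radial moment
  \<open>\<integral>\<^sub>0\<^sup>1 s\<^sup>n\<^sup>-\<^sup>1\<^sup>+\<^sup>2\<^sup>m\<^sup>+\<^sup>\<alpha> (1 - s\<^sup>2)\<^sup>\<beta> ds\<close>.\<close>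

definition kernel_weight :: "nat \<Rightarrow> real \<Rightarrow> real \<Rightarrow> nat \<Rightarrow> real" where
  "kernel_weight n \<alpha> \<beta> m = 1 / (real n * unit_ball_vol (real n) * (Beta ((real n + \<alpha>) / 2 + real m) (\<beta> + 1) / 2))"

definition kernel_part :: "nat \<Rightarrow> real \<Rightarrow> real \<Rightarrow> nat \<Rightarrow> complex^'n::finite \<Rightarrow> complex^'n \<Rightarrow> complex" where
  "kernel_part p \<alpha> \<beta> m y z = complex_of_real (kernel_weight CARD('n) \<alpha> \<beta> m) *
     pzonal (of_nat CARD('n) / 2) p m (cdot z (cnj_vec y)) (cdot z z * cdot (cnj_vec y) (cnj_vec y))"

lemma cdot_rot: "cdot (rot \<psi> x) (cnj_vec (rot \<phi> b)) = cis (\<psi> - \<phi>) * lin b x"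
  "cdot (rot \<psi> x) (rot \<psi> x) * cdot (cnj_vec (rot \<phi> b)) (cnj_vec (rot \<phi> b)) = (cis (\<psi> - \<phi>))\<^sup>2 * (nsq b * nsq x)"
proof -
  have e: "cis (\<psi> - \<phi>) = cis \<psi> * cis (- \<phi>)" by (simp add: cis_mult)
  show "cdot (rot \<psi> x) (cnj_vec (rot \<phi> b)) = cis (\<psi> - \<phi>) * lin b x"
    by (simp add: cdot_def rot_def cnj_vec_def lin_eq e sum_distrib_left cis_cnj mult_ac)
  have "cdot (rot \<psi> x) (rot \<psi> x) = (cis \<psi>)\<^sup>2 * nsq x"
    by (simp add: cdot_def rot_def nsq_eq sum_distrib_left power2_eq_square mult_ac)
  moreover have "cdot (cnj_vec (rot \<phi> b)) (cnj_vec (rot \<phi> b)) = (cis (- \<phi>))\<^sup>2 * nsq b"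
    by (simp add: cdot_def rot_def cnj_vec_def nsq_eq sum_distrib_left power2_eq_square cis_cnj mult_ac)
  ultimately show "cdot (rot \<psi> x) (rot \<psi> x) * cdot (cnj_vec (rot \<phi> b)) (cnj_vec (rot \<phi> b)) = (cis (\<psi> - \<phi>))\<^sup>2 * (nsq b * nsq x)"
    by (simp add: e power_mult_distrib mult_ac)
qed

lemma kernel_part_rot:
  fixes x b :: "real^'n::finite"
  shows "kernel_part p \<alpha> \<beta> m (rot \<phi> b) (rot \<psi> x) = complex_of_real (kernel_weight CARD('n) \<alpha> \<beta> m) * cis (real m * (\<psi> - \<phi>)) *
    pzonal (of_nat CARD('n) / 2) p m (lin b x) (nsq b * nsq x)"
  unfolding kernel_part_def cdot_rot pzonal_scale using Complex.DeMoivre[of "\<psi> - \<phi>" m] by (simp only: mult_ac)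

lemma kernel_part_in_space:
  fixes b :: "real^'n::finite"
  assumes n: "real CARD('n) + \<alpha> > 0" and \<beta>: "\<beta> > -1"
  shows "kernel_part p \<alpha> \<beta> m (rot \<phi> b) \<in> bergman_space p \<alpha> \<beta>"
proof -
  let ?\<kappa> = "complex_of_real (kernel_weight CARD('n) \<alpha> \<beta> m)"
  let ?W = "\<lambda>x::real^'n. pzonal (of_nat CARD('n) / 2) p m (lin b x) (nsq b * nsq x)"
  define u where "u x = (?\<kappa> * cis (- (real m * \<phi>))) * ?W x" for x
  have hu: "homogeneous_polynomial m u" unfolding u_def[abs_def] by (intro hp_cmult hp_pzonal)
  have pW: "polyf ?W" by (rule hp_polyf[OF hp_pzonal])
  have ph: "polyharmonic_on_ball p u"
    unfolding polyharmonic_on_ball_def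
  proof (intro conjI ballI)
    show "real_analytic_on u (ball 0 1)" by (rule polyf_real_analytic[OF hp_polyf[OF hu]])
    show "(laplacian ^^ p) u x = 0" for x
      unfolding u_def[abs_def] lap_iter_cmult[OF pW] pzonal_polyharmonic by simp
  qed
  have rotu: "kernel_part p \<alpha> \<beta> m (rot \<phi> b) (rot \<psi> x) = cis (real m * \<psi>) * u x" for \<psi> and x :: "real^'n"
  proof -
    have "cis (real m * (\<psi> - \<phi>)) = cis (real m * \<psi>) * cis (- (real m * \<phi>))" by (simp add: cis_mult right_diff_distrib)
    then show ?thesis unfolding kernel_part_rot u_def by (simp add: mult_ac)
  qed
  have ext: "extends_to_rotated_balls p u (kernel_part p \<alpha> \<beta> m (rot \<phi> b))"
    unfolding extends_to_rotated_balls_def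
  proof (rule exI[of _ "\<lambda>l. if l = m then u else (\<lambda>x. 0)"], intro conjI allI ballI impI)
    show "homogeneous_polynomial l (if l = m then u else (\<lambda>x. 0))" for l using hu hp_zero by auto
    show "(\<lambda>l. (if l = m then u else (\<lambda>x. 0)) x) sums u x" for x
    proof -
      have "(\<lambda>l. (if l = m then u else (\<lambda>x. 0)) x) = (\<lambda>l. if l = m then u x else 0)" by auto
      then show ?thesis using sums_single[of m "\<lambda>_. u x"] by (simp only:)
    qed
    show "(\<lambda>l. cis (real l * \<psi>) * (if l = m then u else (\<lambda>x. 0)) x) sums kernel_part p \<alpha> \<beta> m (rot \<phi> b) (rot \<psi> x)" for \<psi> x
    proof -
      have "(\<lambda>l. cis (real l * \<psi>) * (if l = m then u else (\<lambda>x. 0)) x) = (\<lambda>l. if l = m then cis (real m * \<psi>) * u x else 0)" by auto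
      then show ?thesis unfolding rotu using sums_single[of m "\<lambda>_. cis (real m * \<psi>) * u x"] by (simp only:)
    qed
  qed
  have sq: "set_integrable lborel (ball 0 1) (\<lambda>x. (cmod (kernel_part p \<alpha> \<beta> m (rot \<phi> b) (rot \<psi> x)))\<^sup>2 * bergman_weight \<alpha> \<beta> x)" for \<psi>
  proof -
    have "compact (u ` cball 0 1)" by (intro compact_continuous_image polyf_continuous hp_polyf[OF hu]) auto
    then obtain B where "\<forall>y\<in>u ` cball 0 1. norm y \<le> B" using compact_imp_bounded bounded_iff by blast
    then have B: "norm (u x) \<le> B" if "x \<in> cball 0 1" for x using that by simp
    have um[measurable]: "u \<in> borel_measurable borel" by (rule polyf_measurable[OF hp_polyf[OF hu]])
    have wm[measurable]: "bergman_weight \<alpha> \<beta> \<in> borel_measurable (borel :: (real^'n) measure)"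
      unfolding bergman_weight_def[abs_def] by measurable
    have w0: "bergman_weight \<alpha> \<beta> x \<ge> 0" for x :: "real^'n" by (simp add: bergman_weight_def)
    have i: "integrable lborel (\<lambda>x::real^'n. B\<^sup>2 * (indicat_real (cball 0 1) x *\<^sub>R bergman_weight \<alpha> \<beta> x))"
      using weight_integrable[OF n \<beta>] unfolding set_integrable_def by (rule integrable_mult_right)
    have eq: "cmod (cis (real m * \<psi>) * u x) = cmod (u x)" for x by (simp add: norm_mult)
    show ?thesis unfolding set_integrable_def rotu eq
    proof (rule Bochner_Integration.integrable_bound[OF i])
      show "AE x in lborel. norm (indicat_real (ball 0 1) x *\<^sub>R ((cmod (u x))\<^sup>2 * bergman_weight \<alpha> \<beta> x))
         \<le> norm (B\<^sup>2 * (indicat_real (cball 0 1) x *\<^sub>R bergman_weight \<alpha> \<beta> x))"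
      proof (rule AE_I2)
        fix x :: "real^'n"
        show "norm (indicat_real (ball 0 1) x *\<^sub>R ((cmod (u x))\<^sup>2 * bergman_weight \<alpha> \<beta> x))
         \<le> norm (B\<^sup>2 * (indicat_real (cball 0 1) x *\<^sub>R bergman_weight \<alpha> \<beta> x))"
          using B[of x] w0[of x] by (auto simp: indicator_def norm_mult abs_mult intro!: mult_right_mono power_mono)
      qed
    qed measurable
  qed
  show ?thesis unfolding bergman_space_def mem_Collect_eq using ph ext sq
    by (intro conjI exI[of _ u] allI impI)
qed

text \<open>A function \<open>U\<close> in the space is only square integrable, so the integrals are first restricted to \<open>|y| \<le> \<rho> < 1\<close>,
  where the growth estimate makes the expansion of \<open>U\<close> converge geometrically. For each such \<open>\<rho>\<close> the sum over the
  rotated balls isolates degree \<open>m\<close>; then \<open>\<rho> \<rightarrow> 1\<close> by dominated convergence.\<close>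

lemma bergman_inner_kernel:
  fixes b :: "real^'n::finite" and \<alpha> \<beta> \<phi> :: real
  assumes p: "p > 0" and n: "real CARD('n) + \<alpha> > 0" and \<beta>: "\<beta> > -1"
    and hom: "homogeneous_expansion u q" and lap: "\<And>m. (laplacian ^^ p) (q m) = (\<lambda>x. 0)"
    and ext: "\<And>k x. k < p \<Longrightarrow> x \<in> ball 0 1 \<Longrightarrow>
       (\<lambda>m. cis (real m * (real k * pi / real p)) * q m x) sums U (rot (real k * pi / real p) x)"
    and sq: "\<And>k. k < p \<Longrightarrow> set_integrable lborel (ball 0 1)
       (\<lambda>y. (cmod (U (rot (real k * pi / real p) y)))\<^sup>2 * bergman_weight \<alpha> \<beta> y)"
  shows "bergman_inner p \<alpha> \<beta> U (kernel_part p \<alpha> \<beta> m (rot \<phi> b)) = cis (real m * \<phi>) * q m b"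
proof -
  interpret homogeneous_expansion u q by (rule hom)
  let ?n = "CARD('n)"
  let ?S1 = "sphere_integral (\<lambda>x::real^'n. 1)"
  define W where "W x = pzonal (of_nat ?n / 2) p m (lin b x) (nsq b * nsq x)" for x :: "real^'n"
  define \<eta> where "\<eta> s = s powr \<alpha> * (1 - s\<^sup>2) powr \<beta>" for s :: real
  define \<psi> where "\<psi> k = real k * pi / real p" for k :: nat
  define V where "V k x = U (rot (\<psi> k) x)" for k and x :: "real^'n"
  have w: "bergman_weight \<alpha> \<beta> x = \<eta> (norm x)" for x :: "real^'n" by (simp add: bergman_weight_def \<eta>_def)
  have \<eta>m[measurable]: "\<eta> \<in> borel_measurable borel" unfolding \<eta>_def[abs_def] by (rule weight_measurable)
  have \<eta>0: "\<eta> s \<ge> 0" for s by (simp add: \<eta>_def)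
  have hW: "homogeneous_polynomial m W" unfolding W_def by (rule hp_pzonal)
  have Wm[measurable]: "W \<in> borel_measurable borel" by (rule polyf_measurable[OF hp_polyf[OF hW]])
  have qm[measurable]: "q l \<in> borel_measurable borel" for l by (rule polyf_measurable[OF hp_polyf[OF hp]])
  have Vsums: "(\<lambda>l. cis (real l * \<psi> k) * q l x) sums V k x" if "k < p" "norm x < 1" for k x
    using ext[OF that(1), of x] that(2) by (simp add: \<psi>_def V_def)
  define c where "c \<rho> d = (LINT s:{0..1}|lborel. s ^ (?n + d - 1) * (\<eta> s * indicat_real {..\<rho>} s))" for \<rho> d
  define cc where "cc d = (LINT s:{0..1}|lborel. s ^ (?n + d - 1) * \<eta> s)" for d
  have wm: "set_integrable lborel {0..1} (\<lambda>s. s ^ (?n + d - 1) * \<eta> s)" "cc d = Beta ((real ?n + real d + \<alpha>) / 2) (\<beta> + 1) / 2" for d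
  proof -
    have s: "Suc (?n + d - 1) = ?n + d" by simp
    have r: "real (?n + d - 1) + 1 = real ?n + real d"
      using arg_cong[OF s, of real] unfolding of_nat_Suc of_nat_add by linarith
    have "real (?n + d - 1) + 1 + \<alpha> > 0" unfolding r using n by simp
    from weight_moment[OF this \<beta>] show "set_integrable lborel {0..1} (\<lambda>s. s ^ (?n + d - 1) * \<eta> s)"
        "cc d = Beta ((real ?n + real d + \<alpha>) / 2) (\<beta> + 1) / 2"
      unfolding \<eta>_def cc_def r by simp_all
  qed
  have wmr: "set_integrable lborel {0..1} (\<lambda>s. s ^ (?n + d - 1) * (\<eta> s * indicat_real {..\<rho>} s))" for d \<rho>
  proof -
    have "set_integrable lborel ({0..1} \<inter> {..\<rho>}) (\<lambda>s. s ^ (?n + d - 1) * \<eta> s)"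
      by (rule set_integrable_subset[OF wm(1)]) auto
    moreover have "indicat_real ({0..1} \<inter> {..\<rho>}) s *\<^sub>R (s ^ (?n + d - 1) * \<eta> s) = indicat_real {0..1} s *\<^sub>R (s ^ (?n + d - 1) * (\<eta> s * indicat_real {..\<rho>} s))" for s
      by (auto simp: indicator_def)
    ultimately show ?thesis unfolding set_integrable_def by (simp only:)
  qed
  define J where "J \<rho> k = (LINT x|lborel. V k x * (W x * complex_of_real (\<eta> (norm x) * indicat_real {..\<rho>} (norm x))))" for \<rho> k
  have J_sums: "(\<lambda>l. cis (real l * \<psi> k) * (sphere_integral (\<lambda>x. q l x * W x) * complex_of_real (c \<rho> (l + m)))) sums J \<rho> k"
    if \<rho>: "0 < \<rho>" "\<rho> < 1" and k: "k < p" for \<rho> k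
  proof -
    define \<phi>f where "\<phi>f x = W x * complex_of_real (\<eta> (norm x) * indicat_real {..\<rho>} (norm x))" for x
    have ind: "indicat_real (cball 0 1) x *\<^sub>R (f x * complex_of_real (\<eta> (norm x) * indicat_real {..\<rho>} (norm x))) =
       f x * complex_of_real (\<eta> (norm x) * indicat_real {..\<rho>} (norm x))" for f :: "real^'n \<Rightarrow> complex" and x
      using \<rho> by (auto simp: indicator_def)
    have mm: "(\<lambda>s. \<eta> s * indicat_real {..\<rho>} s) \<in> borel_measurable borel" by measurable
    have \<phi>fi: "integrable lborel \<phi>f"
      using polar_hp(1)[OF hW mm wmr] unfolding set_integrable_def ind \<phi>f_def[abs_def] .
    have \<phi>f0: "norm x \<le> \<rho>" if "\<phi>f x \<noteq> 0" for x using that by (auto simp: \<phi>f_def indicator_def split: if_splits)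
    \<comment> \<open>The growth estimate with \<open>s = sqrt \<rho>\<close> gives
      \<open>|q\<^sub>l(x)| \<le> \<rho>\<^sup>l M s\<^sup>-\<^sup>l = M s\<^sup>l\<close> for \<open>|x| \<le> \<rho>\<close>.\<close>
    define s where "s = sqrt \<rho>"
    have s: "0 < s" "s < 1" "s * s = \<rho>" using \<rho> by (auto simp: s_def real_sqrt_lt_1_iff)
    obtain M where M: "M \<ge> 0" "\<forall>l x. norm x \<le> 1 \<longrightarrow> norm (q l x) \<le> M / s ^ l"
      using coefficient_growth[OF lap s(1,2)] by blast
    have qb: "norm (q l x) \<le> M * s ^ l" if x: "norm x \<le> \<rho>" for l x
    proof -
      have "norm (q l x) = norm x ^ l * norm (q l (sgn x))" by (subst hp_sgn[OF hp]) (simp add: norm_mult norm_power)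
      also have "\<dots> \<le> \<rho> ^ l * (M / s ^ l)"
        using x M \<rho> by (intro mult_mono power_mono) (auto simp: norm_sgn)
      also have "\<dots> = M * s ^ l" unfolding s(3)[symmetric] using s(1) by (simp add: power_mult_distrib)
      finally show ?thesis .
    qed
    have "(\<lambda>l. LINT x|lborel. (cis (real l * \<psi> k) * q l x) * \<phi>f x) sums (LINT x|lborel. V k x * \<phi>f x)"
    proof (rule sums_integral_geometric(1)[OF \<phi>fi, of _ s M])
      show "norm (cis (real l * \<psi> k) * q l x) \<le> M * s ^ l" if "\<phi>f x \<noteq> 0" for l x
        using qb[OF \<phi>f0[OF that]] by (simp add: norm_mult)
      show "(\<lambda>l. cis (real l * \<psi> k) * q l x) sums V k x" if "\<phi>f x \<noteq> 0" for x
        using \<phi>f0[OF that] \<rho> by (intro Vsums k) auto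
    qed (use s M in auto)
    moreover have "(LINT x|lborel. (cis (real l * \<psi> k) * q l x) * \<phi>f x) = cis (real l * \<psi> k) * (sphere_integral (\<lambda>x. q l x * W x) * complex_of_real (c \<rho> (l + m)))" for l
    proof -
      have "(LINT x|lborel. (cis (real l * \<psi> k) * q l x) * \<phi>f x) = cis (real l * \<psi> k) * (LINT x|lborel. q l x * \<phi>f x)"
        by (simp add: mult.assoc)
      also have "(LINT x|lborel. q l x * \<phi>f x) = (LINT x:cball 0 1|lborel. (q l x * W x) * complex_of_real (\<eta> (norm x) * indicat_real {..\<rho>} (norm x)))"
        unfolding set_lebesgue_integral_def \<phi>f_def
        by (rule Bochner_Integration.integral_cong[OF refl]) (use \<rho> in \<open>auto simp: indicator_def\<close>)
      also have "\<dots> = sphere_integral (\<lambda>x. q l x * W x) * complex_of_real (c \<rho> (l + m))"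
        unfolding c_def by (rule polar_hp(2)[OF hp_mult[OF hp hW] mm wmr])
      finally show ?thesis .
    qed
    ultimately show ?thesis unfolding J_def \<phi>f_def by (simp only:)
  qed
  have Jtot: "(\<Sum>k<p. cis (- (real m * \<psi> k)) * J \<rho> k) = of_nat p * (?S1 * q m b * complex_of_real (c \<rho> (m + m)))"
    if \<rho>: "0 < \<rho>" "\<rho> < 1" for \<rho>
  proof -
    define A where "A l = sphere_integral (\<lambda>x. q l x * W x) * complex_of_real (c \<rho> (l + m))" for l
    define z where "z l = (\<Sum>k<p. cis (real l * \<psi> k) * cis (- (real m * \<psi> k)))" for l
    have "(\<lambda>l. \<Sum>k<p. cis (- (real m * \<psi> k)) * (cis (real l * \<psi> k) * A l)) sums (\<Sum>k<p. cis (- (real m * \<psi> k)) * J \<rho> k)"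
      unfolding A_def by (intro sums_sum sums_mult J_sums \<rho>) auto
    moreover have "(\<Sum>k<p. cis (- (real m * \<psi> k)) * (cis (real l * \<psi> k) * A l)) = z l * A l" for l
      unfolding z_def sum_distrib_right by (intro sum.cong refl) (simp add: mult_ac)
    moreover have "z l * A l = (if l = m then of_nat p * A m else 0)" for l
    proof (cases "l = m")
      case True
      have "cis (real m * \<psi> k) * cis (- (real m * \<psi> k)) = 1" for k by (simp add: cis_mult)
      then show ?thesis using True by (simp add: z_def)
    next
      case False
      show ?thesis
      proof (cases "\<exists>i k. i < p \<and> k < p \<and> l + 2 * k = m + 2 * i")
        case True
        then obtain i k where ik: "i < p" "k < p" "l + 2 * k = m + 2 * i" by blast
        have "z l = 0" unfolding z_def \<psi>_def by (rule root_of_unity_sum[OF p ik(3,1,2) False])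
        then show ?thesis using False by simp
      next
        case no: False
        have "sphere_integral (\<lambda>x. q l x * W x) = 0" unfolding W_def
          by (rule pzonal_pairing(2)[OF hp lap]) (use no in blast)
        then show ?thesis using False by (simp add: A_def)
      qed
    qed
    ultimately have "(\<lambda>l. if l = m then of_nat p * A m else 0) sums (\<Sum>k<p. cis (- (real m * \<psi> k)) * J \<rho> k)" by (simp only:)
    then have "(\<Sum>k<p. cis (- (real m * \<psi> k)) * J \<rho> k) = of_nat p * A m"
      using sums_single[of m "\<lambda>_. of_nat p * A m"] by (rule sums_unique2)
    moreover have "A m = ?S1 * q m b * complex_of_real (c \<rho> (m + m))"
      unfolding A_def W_def pzonal_pairing(1)[OF hp lap refl] ..
    ultimately show ?thesis by simp
  qed
  define r where "r i = 1 - 1 / real (Suc (Suc i))" for i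
  have r: "0 < r i" "r i < 1" for i by (auto simp: r_def field_simps)
  have rlim: "r \<longlonglongrightarrow> 1"
    unfolding r_def using tendsto_diff[OF tendsto_const[of 1] LIMSEQ_Suc[OF LIMSEQ_Suc[OF lim_1_over_n[where 'a=real]]]] by simp
  have ev: "eventually (\<lambda>i. s \<le> r i) sequentially" if "s < 1" for s
    using order_tendstoD(1)[OF rlim that] by (auto elim!: eventually_mono)
  have clim: "(\<lambda>i. c (r i) d) \<longlonglongrightarrow> cc d" for d
    unfolding c_def cc_def set_lebesgue_integral_def
  proof (rule integral_dominated_convergence)
    show "integrable lborel (\<lambda>s. norm (indicat_real {0..1} s *\<^sub>R (s ^ (?n + d - 1) * \<eta> s)))"
      using wm(1)[of d] unfolding set_integrable_def by (rule integrable_norm)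
    show "AE s in lborel. (\<lambda>i. indicat_real {0..1} s *\<^sub>R (s ^ (?n + d - 1) * (\<eta> s * indicat_real {..r i} s))) \<longlonglongrightarrow> indicat_real {0..1} s *\<^sub>R (s ^ (?n + d - 1) * \<eta> s)"
    proof -
      have "AE s in (lborel :: real measure). s \<noteq> 1" by (rule AE_lborel_singleton)
      then show ?thesis
      proof eventually_elim
        case (elim s)
        show ?case
        proof (cases "s \<in> {0..1}")
          case True
          then have "s < 1" using elim by auto
          from ev[OF this] show ?thesis
            by (intro tendsto_eventually) (auto elim!: eventually_mono simp: indicator_def)
        qed simp
      qed
    qed
    show "AE s in lborel. norm (indicat_real {0..1} s *\<^sub>R (s ^ (?n + d - 1) * (\<eta> s * indicat_real {..r i} s))) \<le> norm (indicat_real {0..1} s *\<^sub>R (s ^ (?n + d - 1) * \<eta> s))" for i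
      by (rule AE_I2) (auto simp: indicator_def)
  qed measurable
  define JJ where "JJ k = (LINT x:ball 0 1|lborel. V k x * (W x * complex_of_real (\<eta> (norm x))))" for k
  have Jlim: "(\<lambda>i. J (r i) k) \<longlonglongrightarrow> JJ k" if k: "k < p" for k
  proof -
    have Vm[measurable]: "(\<lambda>x. indicat_real (ball 0 1) x *\<^sub>R V k x) \<in> borel_measurable lborel"
    proof (rule borel_measurable_LIMSEQ_metric)
      show "(\<lambda>x. indicat_real (ball 0 1) x *\<^sub>R (\<Sum>l<N. cis (real l * \<psi> k) * q l x)) \<in> borel_measurable lborel" for N
        by measurable
      show "(\<lambda>N. indicat_real (ball 0 1) x *\<^sub>R (\<Sum>l<N. cis (real l * \<psi> k) * q l x)) \<longlonglongrightarrow> indicat_real (ball 0 1) x *\<^sub>R V k x" for x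
      proof (cases "x \<in> ball 0 1")
        case True
        then show ?thesis using Vsums[OF k, of x] by (simp add: sums_def)
      qed simp
    qed
    have "compact (W ` cball 0 1)" by (intro compact_continuous_image polyf_continuous hp_polyf[OF hW]) auto
    then obtain B where B': "\<forall>y\<in>W ` cball 0 1. norm y \<le> B" using compact_imp_bounded bounded_iff by blast
    then have B: "norm (W x) \<le> B" if "x \<in> cball 0 1" for x using that by simp
    have "norm (W 0) \<le> B" by (rule B) simp
    then have B0: "B \<ge> 0" by (rule order_trans[OF norm_ge_zero])
    \<comment> \<open>the integrable majorant comes from \<open>|V| \<le> 1 + |V|\<^sup>2\<close>\<close>
    define g where "g x = B * (indicat_real (cball 0 1) x *\<^sub>R bergman_weight \<alpha> \<beta> x + indicat_real (ball 0 1) x *\<^sub>R ((cmod (V k x))\<^sup>2 * bergman_weight \<alpha> \<beta> x))" for x :: "real^'n"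
    have gi: "integrable lborel g"
      unfolding g_def using weight_integrable[OF n \<beta>] sq[OF k]
      by (intro integrable_mult_right Bochner_Integration.integrable_add) (simp_all add: set_integrable_def V_def \<psi>_def)
    have dom: "norm (indicat_real (ball 0 1) x *\<^sub>R (V k x * (W x * complex_of_real (\<eta> (norm x))))) \<le> g x" for x
    proof (cases "x \<in> ball 0 1")
      case True
      have vq: "norm (V k x) \<le> 1 + (norm (V k x))\<^sup>2"
      proof -
        have "0 \<le> (norm (V k x) - 1)\<^sup>2" by simp
        then show ?thesis by (simp add: power2_diff) (smt (verit) norm_ge_zero)
      qed
      have "norm (V k x * (W x * complex_of_real (\<eta> (norm x)))) = norm (V k x) * (norm (W x) * \<eta> (norm x))"
        using \<eta>0 by (simp add: norm_mult)
      also have "\<dots> \<le> (1 + (norm (V k x))\<^sup>2) * (B * \<eta> (norm x))"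
        using vq B[of x] True \<eta>0 B0 by (intro mult_mono mult_nonneg_nonneg) auto
      also have "\<dots> = g x" using True by (simp add: g_def w algebra_simps)
      finally show ?thesis using True by simp
    next
      case False then show ?thesis using B0 \<eta>0 by (simp add: g_def w indicator_def)
    qed
    have Jr: "J (r i) k = (LINT x|lborel. (indicat_real (ball 0 1) x *\<^sub>R V k x) * (W x * complex_of_real (\<eta> (norm x) * indicat_real {..r i} (norm x))))" for i
      unfolding J_def by (rule Bochner_Integration.integral_cong[OF refl]) (use r[of i] in \<open>auto simp: indicator_def\<close>)
    have JJr: "JJ k = (LINT x|lborel. (indicat_real (ball 0 1) x *\<^sub>R V k x) * (W x * complex_of_real (\<eta> (norm x))))"
      unfolding JJ_def set_lebesgue_integral_def by simp
    show ?thesis unfolding Jr JJr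
    proof (rule integral_dominated_convergence[OF _ _ gi])
      show "AE x in lborel. (\<lambda>i. (indicat_real (ball 0 1) x *\<^sub>R V k x) * (W x * complex_of_real (\<eta> (norm x) * indicat_real {..r i} (norm x))))
          \<longlonglongrightarrow> (indicat_real (ball 0 1) x *\<^sub>R V k x) * (W x * complex_of_real (\<eta> (norm x)))"
      proof (rule AE_I2)
        fix x :: "real^'n"
        show "(\<lambda>i. (indicat_real (ball 0 1) x *\<^sub>R V k x) * (W x * complex_of_real (\<eta> (norm x) * indicat_real {..r i} (norm x))))
          \<longlonglongrightarrow> (indicat_real (ball 0 1) x *\<^sub>R V k x) * (W x * complex_of_real (\<eta> (norm x)))"
        proof (cases "x \<in> ball 0 1")
          case True
          then have "norm x < 1" by simp
          from ev[OF this] show ?thesis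
            by (intro tendsto_eventually) (auto elim!: eventually_mono simp: indicator_def)
        qed simp
      qed
      show "AE x in lborel. norm ((indicat_real (ball 0 1) x *\<^sub>R V k x) * (W x * complex_of_real (\<eta> (norm x) * indicat_real {..r i} (norm x)))) \<le> g x" for i
      proof (rule AE_I2)
        fix x :: "real^'n"
        have "norm ((indicat_real (ball 0 1) x *\<^sub>R V k x) * (W x * complex_of_real (\<eta> (norm x) * indicat_real {..r i} (norm x)))) \<le>
          norm (indicat_real (ball 0 1) x *\<^sub>R (V k x * (W x * complex_of_real (\<eta> (norm x)))))"
          by (auto simp: indicator_def norm_mult)
        then show "norm ((indicat_real (ball 0 1) x *\<^sub>R V k x) * (W x * complex_of_real (\<eta> (norm x) * indicat_real {..r i} (norm x)))) \<le> g x"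
          using dom[of x] by linarith
      qed
    qed measurable
  qed
  have "(\<lambda>i. \<Sum>k<p. cis (- (real m * \<psi> k)) * J (r i) k) \<longlonglongrightarrow> (\<Sum>k<p. cis (- (real m * \<psi> k)) * JJ k)"
    by (intro tendsto_sum tendsto_mult tendsto_const Jlim) auto
  moreover have "(\<lambda>i. of_nat p * (?S1 * q m b * complex_of_real (c (r i) (m + m)))) \<longlonglongrightarrow> of_nat p * (?S1 * q m b * complex_of_real (cc (m + m)))"
    by (intro tendsto_mult tendsto_const tendsto_of_real clim)
  ultimately have tot: "(\<Sum>k<p. cis (- (real m * \<psi> k)) * JJ k) = of_nat p * (?S1 * q m b * complex_of_real (cc (m + m)))"
    unfolding Jtot[OF r] by (rule LIMSEQ_unique)
  let ?\<kappa> = "kernel_weight ?n \<alpha> \<beta> m"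
  \<comment> \<open>the zonal polynomials are real at real points, so conjugating the kernel only conjugates the phase\<close>
  have cW: "cnj (W x) = W x" for x
    unfolding W_def cnj_pzonal by (simp add: lin_def nsq_def)
  have term_eq: "(LINT x:ball 0 1|lborel. U (rot (real k * pi / real p) x) * cnj (kernel_part p \<alpha> \<beta> m (rot \<phi> b) (rot (real k * pi / real p) x)) * complex_of_real (bergman_weight \<alpha> \<beta> x))
     = complex_of_real ?\<kappa> * cis (real m * \<phi>) * (cis (- (real m * \<psi> k)) * JJ k)" for k
  proof -
    have "cis (- (real m * (\<psi> k - \<phi>))) = cis (real m * \<phi>) * cis (- (real m * \<psi> k))"
      by (simp add: cis_mult right_diff_distrib)
    then have e: "U (rot (real k * pi / real p) x) * cnj (kernel_part p \<alpha> \<beta> m (rot \<phi> b) (rot (real k * pi / real p) x)) * complex_of_real (bergman_weight \<alpha> \<beta> x)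
      = (complex_of_real ?\<kappa> * cis (real m * \<phi>) * cis (- (real m * \<psi> k))) * (V k x * (W x * complex_of_real (\<eta> (norm x))))" for x :: "real^'n"
      unfolding kernel_part_rot W_def[symmetric] \<psi>_def[symmetric] V_def[symmetric] w
      by (simp add: cW cis_cnj mult_ac)
    show ?thesis unfolding e JJ_def by simp
  qed
  have "bergman_inner p \<alpha> \<beta> U (kernel_part p \<alpha> \<beta> m (rot \<phi> b)) =
     1 / of_nat p * (complex_of_real ?\<kappa> * cis (real m * \<phi>) * (\<Sum>k<p. cis (- (real m * \<psi> k)) * JJ k))"
    unfolding bergman_inner_def term_eq sum_distrib_left ..
  also have "\<dots> = (complex_of_real ?\<kappa> * ?S1 * complex_of_real (cc (m + m))) * (cis (real m * \<phi>) * q m b)"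
    unfolding tot using p by simp
  also have "complex_of_real ?\<kappa> * ?S1 * complex_of_real (cc (m + m)) = 1"
  proof -
    have arg: "(real ?n + real (m + m) + \<alpha>) / 2 = (real ?n + \<alpha>) / 2 + real m" by (simp add: field_simps)
    have "Beta ((real ?n + \<alpha>) / 2 + real m) (\<beta> + 1) > 0"
    proof -
      have "(real ?n + \<alpha>) / 2 + real m > 0" using n by (intro add_pos_nonneg) auto
      then show ?thesis unfolding Beta_def using \<beta> by (intro divide_pos_pos mult_pos_pos Gamma_real_pos) auto
    qed
    moreover have "unit_ball_vol (real ?n) \<noteq> 0" using unit_ball_vol_pos[of "real ?n"] by (metis less_irrefl of_nat_0_le_iff)
    ultimately have "?\<kappa> * (real ?n * unit_ball_vol (real ?n)) * cc (m + m) = 1"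
      unfolding kernel_weight_def wm(2) arg by simp
    then show ?thesis unfolding sphere_one by (metis of_real_1 of_real_mult)
  qed
  finally show ?thesis by simp
qed

section \<open>Fractional derivatives of power series\<close>

text \<open>The beta integral on \<open>(0,t)\<close>, by the substitution \<open>\<tau> = t x\<close>.\<close>

lemma beta_scaled:
  fixes t a l :: real
  assumes t: "t > 0" and a: "a > 0" and l: "l > 0"
  shows "integrable lborel (\<lambda>\<tau>. indicat_real {0<..<t} \<tau> * (\<tau> powr (a - 1) * (t - \<tau>) powr (l - 1)))"
    and "(LINT \<tau>|lborel. indicat_real {0<..<t} \<tau> * (\<tau> powr (a - 1) * (t - \<tau>) powr (l - 1))) = t powr (a + l - 1) * Beta a l"
proof -
  define g where "g \<tau> = indicat_real {0<..<t} \<tau> * (\<tau> powr (a - 1) * (t - \<tau>) powr (l - 1))" for \<tau>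
  have int0: "set_integrable lborel {0..1} (\<lambda>x. x powr (a - 1) * (1 - x) powr (l - 1))"
    by (rule integrable_Beta[OF a l])
  have val0: "(LINT x:{0..1}|lborel. x powr (a - 1) * (1 - x) powr (l - 1)) = Beta a l"
    unfolding set_borel_integral_eq_integral(2)[OF int0] by (rule integral_unique, rule has_integral_Beta_real[OF a l])
  have e: "g (0 + t * x) = t powr (a + l - 2) * (indicat_real {0..1} x *\<^sub>R (x powr (a - 1) * (1 - x) powr (l - 1)))" for x
  proof (cases "0 < x \<and> x < 1")
    case True
    have "(t - t * x) powr (l - 1) = t powr (l - 1) * (1 - x) powr (l - 1)"
      using powr_mult[of t "1 - x" "l - 1"] t True by (simp add: right_diff_distrib)
    moreover have "(t * x) powr (a - 1) = t powr (a - 1) * x powr (a - 1)" using t True by (simp add: powr_mult)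
    moreover have "t powr (a - 1) * t powr (l - 1) = t powr (a + l - 2)" by (simp flip: powr_add)
    moreover have "0 < t * x" "t * x < t" using t True by auto
    ultimately show ?thesis using True by (simp add: g_def mult_ac)
  next
    case False
    then have "\<not> (0 < t * x \<and> t * x < t)" using t by (auto simp: zero_less_mult_iff)
    then have "g (0 + t * x) = 0" by (auto simp: g_def indicator_def)
    moreover have "indicat_real {0..1} x *\<^sub>R (x powr (a - 1) * (1 - x) powr (l - 1)) = 0"
      using False by (cases "x = 0 \<or> x = 1") (auto simp: indicator_def)
    ultimately show ?thesis by simp
  qed
  have "integrable lborel (\<lambda>x. g (0 + t * x))"
    unfolding e using int0 unfolding set_integrable_def by (rule integrable_mult_right)
  then show "integrable lborel (\<lambda>\<tau>. indicat_real {0<..<t} \<tau> * (\<tau> powr (a - 1) * (t - \<tau>) powr (l - 1)))"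
    using lborel_integrable_real_affine_iff[of t g 0] t unfolding g_def by simp
  have "(LINT \<tau>|lborel. g \<tau>) = \<bar>t\<bar> *\<^sub>R (LINT x|lborel. g (0 + t * x))"
    by (rule lborel_integral_real_affine) (use t in simp)
  also have "\<dots> = t * (t powr (a + l - 2) * Beta a l)"
    unfolding e using t val0 by (simp add: set_lebesgue_integral_def)
  also have "\<dots> = t powr (a + l - 1) * Beta a l"
  proof -
    have "t * t powr (a + l - 2) = t powr 1 * t powr (a + l - 2)" using t by simp
    also have "\<dots> = t powr (a + l - 1)" unfolding powr_add[symmetric] by simp
    finally show ?thesis by (simp only: mult.assoc[symmetric])
  qed
  finally show "(LINT \<tau>|lborel. indicat_real {0<..<t} \<tau> * (\<tau> powr (a - 1) * (t - \<tau>) powr (l - 1))) = t powr (a + l - 1) * Beta a l"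
    by (simp add: g_def)
qed

text \<open>The fractional integral of \<open>\<tau>\<^sup>\<mu>\<^sup>+\<^sup>m\<close> is a beta integral; the series is dominated by a geometric one on
  \<open>(0,t)\<close>.\<close>

lemma rl_integral_power_series:
  fixes W :: "nat \<Rightarrow> complex" and G :: "real \<Rightarrow> complex"
  assumes \<rho>: "0 < \<rho>" and C: "0 \<le> C" "\<And>m. norm (W m) \<le> C * \<rho> ^ m"
    and G: "\<And>t. 0 < t \<Longrightarrow> t * \<rho> < 1 \<Longrightarrow> (\<lambda>m. W m * complex_of_real t ^ m) sums G t"
    and \<mu>: "\<mu> > -1" and l: "l \<ge> 0" and t: "0 < t" "t * \<rho> < 1"
  shows "(\<lambda>m. W m * complex_of_real (Gamma (real m + \<mu> + 1) / Gamma (real m + \<mu> + 1 + l)) * complex_of_real (t powr (real m + \<mu> + l)))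
     sums rl_integral l (\<lambda>t. complex_of_real (t powr \<mu>) * G t) t"
proof (cases "l = 0")
  case True
  have Gp: "Gamma (real m + \<mu> + 1) > 0" for m using \<mu> by (intro Gamma_real_pos) linarith
  have "(\<lambda>m. complex_of_real (t powr \<mu>) * (W m * complex_of_real t ^ m)) sums (complex_of_real (t powr \<mu>) * G t)"
    by (intro sums_mult G t)
  moreover have "complex_of_real (t powr \<mu>) * (W m * complex_of_real t ^ m) =
     W m * complex_of_real (Gamma (real m + \<mu> + 1) / Gamma (real m + \<mu> + 1 + l)) * complex_of_real (t powr (real m + \<mu> + l))" for m
    using Gp[of m] t True by (simp add: powr_add powr_realpow mult_ac)
  ultimately show ?thesis using True by (simp add: rl_integral_def)
next
  case False
  then have l: "l > 0" using l by simp
  define \<phi> where "\<phi> \<tau> = complex_of_real (indicat_real {0<..<t} \<tau> * (\<tau> powr (\<mu> + 1 - 1) * (t - \<tau>) powr (l - 1)))" for \<tau>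
  have \<phi>i: "integrable lborel \<phi>"
    unfolding \<phi>_def[abs_def] by (intro integrable_of_real beta_scaled(1) t l) (use \<mu> in simp)
  have \<phi>0: "0 < \<tau> \<and> \<tau> < t" if "\<phi> \<tau> \<noteq> 0" for \<tau> using that by (auto simp: \<phi>_def indicator_def split: if_splits)
  have sm: "(\<lambda>m. LINT \<tau>|lborel. (W m * complex_of_real \<tau> ^ m) * \<phi> \<tau>) sums (LINT \<tau>|lborel. G \<tau> * \<phi> \<tau>)"
  proof (rule sums_integral_geometric(1)[OF \<phi>i, of _ "t * \<rho>" C])
    show "norm (W m * complex_of_real \<tau> ^ m) \<le> C * (t * \<rho>) ^ m" if "\<phi> \<tau> \<noteq> 0" for m \<tau>
    proof -
      have "norm (W m) * \<bar>\<tau>\<bar> ^ m \<le> (C * \<rho> ^ m) * t ^ m"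
        using \<phi>0[OF that] C \<rho> by (intro mult_mono power_mono) auto
      then show ?thesis by (simp add: norm_mult norm_power power_mult_distrib mult_ac)
    qed
    show "(\<lambda>m. W m * complex_of_real \<tau> ^ m) sums G \<tau>" if "\<phi> \<tau> \<noteq> 0" for \<tau>
    proof (rule G)
      show "0 < \<tau>" using \<phi>0[OF that] by simp
      have "\<tau> * \<rho> \<le> t * \<rho>" using \<phi>0[OF that] \<rho> by (intro mult_right_mono) auto
      then show "\<tau> * \<rho> < 1" using t by simp
    qed
  qed (use t \<rho> C in \<open>auto intro!: borel_measurable_times\<close>)
  have mom: "(LINT \<tau>|lborel. (W m * complex_of_real \<tau> ^ m) * \<phi> \<tau>) = W m * complex_of_real (t powr (real m + \<mu> + l) * Beta (real m + \<mu> + 1) l)" for m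
  proof -
    have a: "real m + \<mu> + 1 > 0" using \<mu> by linarith
    have e: "(W m * complex_of_real \<tau> ^ m) * \<phi> \<tau> = W m * complex_of_real (indicat_real {0<..<t} \<tau> * (\<tau> powr (real m + \<mu> + 1 - 1) * (t - \<tau>) powr (l - 1)))" for \<tau>
    proof (cases "\<tau> \<in> {0<..<t}")
      case True
      then have "\<tau> powr (real m + \<mu>) = \<tau> ^ m * \<tau> powr \<mu>" by (simp add: powr_add powr_realpow)
      then show ?thesis by (simp add: \<phi>_def mult_ac)
    qed (simp add: \<phi>_def)
    have "real m + \<mu> + 1 + l - 1 = real m + \<mu> + l" by simp
    then show ?thesis
      unfolding e integral_mult_right_zero integral_complex_of_real beta_scaled(2)[OF t(1) a l] by (simp only:)
  qed
  have "rl_integral l (\<lambda>t. complex_of_real (t powr \<mu>) * G t) t = complex_of_real (1 / Gamma l) * (LINT \<tau>|lborel. G \<tau> * \<phi> \<tau>)"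
  proof -
    have "indicat_real {0<..<t} \<tau> *\<^sub>R (complex_of_real (\<tau> powr \<mu>) * G \<tau> / complex_of_real ((t - \<tau>) powr (1 - l))) = G \<tau> * \<phi> \<tau>" for \<tau>
    proof (cases "\<tau> \<in> {0<..<t}")
      case True
      have "(t - \<tau>) powr (l - 1) = inverse ((t - \<tau>) powr (1 - l))" by (simp flip: powr_minus)
      then show ?thesis using True by (simp add: \<phi>_def divide_inverse mult_ac)
    qed (simp add: \<phi>_def)
    then show ?thesis using False by (simp add: rl_integral_def set_lebesgue_integral_def)
  qed
  moreover have "(\<lambda>m. complex_of_real (1 / Gamma l) * (W m * complex_of_real (t powr (real m + \<mu> + l) * Beta (real m + \<mu> + 1) l))) sums
      (complex_of_real (1 / Gamma l) * (LINT \<tau>|lborel. G \<tau> * \<phi> \<tau>))"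
    using sums_mult[OF sm] unfolding mom .
  moreover have "complex_of_real (1 / Gamma l) * (W m * complex_of_real (t powr (real m + \<mu> + l) * Beta (real m + \<mu> + 1) l)) =
     W m * complex_of_real (Gamma (real m + \<mu> + 1) / Gamma (real m + \<mu> + 1 + l)) * complex_of_real (t powr (real m + \<mu> + l))" for m
  proof -
    have "1 / Gamma l * Beta (real m + \<mu> + 1) l = Gamma (real m + \<mu> + 1) / Gamma (real m + \<mu> + 1 + l)"
      using Gamma_real_pos[OF l] by (simp add: Beta_def)
    then have "complex_of_real (1 / Gamma l) * complex_of_real (Beta (real m + \<mu> + 1) l) = complex_of_real (Gamma (real m + \<mu> + 1) / Gamma (real m + \<mu> + 1 + l))"
      by (metis of_real_mult)
    then show ?thesis by (simp only: of_real_mult mult_ac) (metis mult.assoc mult.commute)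
  qed
  ultimately show ?thesis by simp
qed

lemma powr_series_has_vector_derivative:
  fixes a :: "nat \<Rightarrow> complex" and D :: "real \<Rightarrow> complex"
  assumes D: "\<And>t. 0 < t \<Longrightarrow> t < T \<Longrightarrow> (\<lambda>m. a m * complex_of_real (t powr (real m + \<sigma>))) sums D t"
    and t: "0 < t" "t < T"
  shows "\<exists>D'. (D has_vector_derivative D') (at t) \<and>
     (\<lambda>m. a m * complex_of_real ((real m + \<sigma>) * t powr (real m + \<sigma> - 1))) sums D'"
proof -
  have split: "complex_of_real (s powr (real m + \<sigma>)) = complex_of_real (s powr \<sigma>) * complex_of_real s ^ m" if "s > 0" for s m
    using that by (simp add: powr_add powr_realpow mult.commute)
  have ps: "(\<lambda>m. a m * complex_of_real s ^ m) sums (D s / complex_of_real (s powr \<sigma>))" if "0 < s" "s < T" for s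
  proof -
    have nz: "complex_of_real (s powr \<sigma>) \<noteq> 0" using that by simp
    have "(\<lambda>m. a m * complex_of_real (s powr (real m + \<sigma>)) / complex_of_real (s powr \<sigma>)) sums (D s / complex_of_real (s powr \<sigma>))"
      by (intro sums_divide D that)
    then show ?thesis unfolding split[OF that(1)] using nz by simp
  qed
  \<comment> \<open>dividing by \<open>t\<^sup>\<sigma>\<close> leaves an ordinary power series, which may be differentiated termwise\<close>
  define P where "P z = (\<Sum>m. a m * z ^ m)" for z :: complex
  define P' where "P' = (\<Sum>m. diffs a m * complex_of_real t ^ m)"
  define K where "K = (t + T) / 2"
  have K: "0 < K" "K < T" "t < K" using t by (auto simp: K_def)
  have DP: "D s = complex_of_real (s powr \<sigma>) * P (complex_of_real s)" if "0 < s" "s < T" for s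
    using ps[OF that] that by (simp add: P_def sums_iff field_simps)
  have sK: "summable (\<lambda>m. a m * complex_of_real K ^ m)" using ps[OF K(1,2)] by (simp add: sums_iff)
  have nt: "norm (complex_of_real t) < norm (complex_of_real K)" using K t by simp
  have derP: "(P has_field_derivative P') (at (complex_of_real t))"
    unfolding P_def[abs_def] P'_def by (rule termdiffs_strong[OF sK nt])
  have sd: "summable (\<lambda>m. diffs a m * complex_of_real t ^ m)"
  proof (rule termdiff_converges[of _ K])
    show "norm (complex_of_real t) < K" using nt K by simp
    fix z :: complex assume "norm z < K"
    then show "summable (\<lambda>m. a m * z ^ m)" using powser_inside[OF sK, of z] K by simp
  qed
  have s1: "(\<lambda>m. of_nat m * a m * complex_of_real t ^ (m - Suc 0)) sums P'"
    unfolding P'_def by (rule diffs_equiv[OF sd])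
  have s0: "(\<lambda>m. a m * complex_of_real t ^ m) sums P (complex_of_real t)"
    using ps[OF t] by (simp add: P_def sums_iff)
  define D' where "D' = complex_of_real (t powr \<sigma>) * P' + complex_of_real (\<sigma> * t powr (\<sigma> - 1)) * P (complex_of_real t)"
  have "((\<lambda>s. P (complex_of_real s)) has_vector_derivative P') (at t)"
    using derP by (rule has_vector_derivative_real_field)
  moreover have "((\<lambda>s. complex_of_real (s powr \<sigma>)) has_vector_derivative complex_of_real (\<sigma> * t powr (\<sigma> - 1))) (at t)"
    by (rule has_vector_derivative_of_real) (rule has_real_derivative_powr[OF t(1)])
  ultimately have "((\<lambda>s. complex_of_real (s powr \<sigma>) * P (complex_of_real s)) has_vector_derivative D') (at t)"
    using has_vector_derivative_mult[of "\<lambda>s. complex_of_real (s powr \<sigma>)" "complex_of_real (\<sigma> * t powr (\<sigma> - 1))" t UNIV "\<lambda>s. P (complex_of_real s)" P']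
    by (simp add: D'_def)
  then have "(D has_vector_derivative D') (at t)"
    by (rule has_vector_derivative_transform_within_open[where S = "{0<..<T}"]) (use t DP in auto)
  moreover have "(\<lambda>m. a m * complex_of_real ((real m + \<sigma>) * t powr (real m + \<sigma> - 1))) sums D'"
  proof -
    have "(\<lambda>m. complex_of_real (t powr \<sigma>) * (of_nat m * a m * complex_of_real t ^ (m - Suc 0)) +
       complex_of_real (\<sigma> * t powr (\<sigma> - 1)) * (a m * complex_of_real t ^ m)) sums D'"
      unfolding D'_def by (intro sums_add sums_mult s1 s0)
    moreover have "complex_of_real (t powr \<sigma>) * (of_nat m * a m * complex_of_real t ^ (m - Suc 0)) +
       complex_of_real (\<sigma> * t powr (\<sigma> - 1)) * (a m * complex_of_real t ^ m) = a m * complex_of_real ((real m + \<sigma>) * t powr (real m + \<sigma> - 1))" for m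
    proof -
      have p1: "t powr (real m + \<sigma> - 1) = t powr (\<sigma> - 1) * t ^ m"
      proof -
        have "real m + \<sigma> - 1 = (\<sigma> - 1) + real m" by simp
        then show ?thesis using t by (simp only: powr_add powr_realpow)
      qed
      have p2: "real m * (t powr \<sigma> * t ^ (m - Suc 0)) = real m * t powr (real m + \<sigma> - 1)"
      proof (cases m)
        case (Suc i)
        have "t powr \<sigma> * t ^ i = t powr (\<sigma> + real i)" using t by (simp add: powr_add powr_realpow)
        then show ?thesis using Suc by (simp add: add.commute)
      qed simp
      have t1: "complex_of_real (t powr \<sigma>) * (of_nat m * a m * complex_of_real t ^ (m - Suc 0)) = a m * complex_of_real (real m * (t powr \<sigma> * t ^ (m - Suc 0)))"
        by (simp add: mult_ac)
      have t2: "complex_of_real (\<sigma> * t powr (\<sigma> - 1)) * (a m * complex_of_real t ^ m) = a m * complex_of_real (\<sigma> * t powr (real m + \<sigma> - 1))"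
        unfolding p1 by (simp add: mult_ac)
      show ?thesis unfolding t1 t2 unfolding p2 unfolding distrib_right of_real_add distrib_left ..
    qed
    ultimately show ?thesis by (simp only:)
  qed
  ultimately show ?thesis by blast
qed

text \<open>The \<open>j\<close>-fold derivative is taken one step at a time: after \<open>i\<close> steps the coefficients carry
  \<open>\<Gamma>(s + m + j - i)\<close> in the denominator, and \<open>\<Gamma>(z + 1) = z \<Gamma>(z)\<close> moves from one step to the
  next. Since \<open>\<rho> < 1\<close>, the identities hold on a neighbourhood of \<open>t = 1\<close>, as iterated differentiation there
  demands.\<close>

lemma rl_deriv_power_series:
  fixes W :: "nat \<Rightarrow> complex" and G :: "real \<Rightarrow> complex" and j :: nat
  assumes \<rho>: "0 < \<rho>" "\<rho> < 1" and C: "0 \<le> C" "\<And>m. norm (W m) \<le> C * \<rho> ^ m"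
    and G: "\<And>t. 0 < t \<Longrightarrow> t * \<rho> < 1 \<Longrightarrow> (\<lambda>m. W m * complex_of_real t ^ m) sums G t"
    and s: "s > 0" and \<beta>: "\<beta> > -1" and j: "\<beta> + 1 \<le> real j"
  shows "(\<lambda>m. W m * complex_of_real (Gamma (s + real m + \<beta> + 1) / Gamma (s + real m)))
     sums rl_deriv j (\<beta> + 1) (\<lambda>t. complex_of_real (t powr (s + \<beta>)) * G t) 1"
proof -
  define F where "F = rl_integral (real j - (\<beta> + 1)) (\<lambda>t. complex_of_real (t powr (s + \<beta>)) * G t)"
  define a where "a i m = W m * complex_of_real (Gamma (s + real m + \<beta> + 1) / Gamma (s + real m + real (j - i)))" for i m
  have T: "t * \<rho> < 1" if "t < 1 / \<rho>" for t using that \<rho> by (simp add: field_simps)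
  have "(\<lambda>m. a i m * complex_of_real (t powr (real m + (s + real (j - i) - 1)))) sums ((\<lambda>f t. vector_derivative f (at t)) ^^ i) F t"
    if "i \<le> j" "0 < t" "t < 1 / \<rho>" for i t
    using that
  proof (induction i arbitrary: t)
    case 0
    have "s + \<beta> > -1" "real j - (\<beta> + 1) \<ge> 0" using s \<beta> j by auto
    from rl_integral_power_series[OF \<rho>(1) C G this 0(2) T[OF 0(3)]]
    have "(\<lambda>m. W m * complex_of_real (Gamma (real m + (s + \<beta>) + 1) / Gamma (real m + (s + \<beta>) + 1 + (real j - (\<beta> + 1)))) *
        complex_of_real (t powr (real m + (s + \<beta>) + (real j - (\<beta> + 1))))) sums F t" unfolding F_def .
    moreover have "real m + (s + \<beta>) + 1 = s + real m + \<beta> + 1" "s + real m + \<beta> + 1 + (real j - (\<beta> + 1)) = s + real m + real (j - 0)"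
       "real m + (s + \<beta>) + (real j - (\<beta> + 1)) = real m + (s + real (j - 0) - 1)" for m by simp_all
    ultimately show ?case unfolding a_def by (simp only: funpow_0)
  next
    case (Suc i)
    have IH: "(\<lambda>m. a i m * complex_of_real (\<tau> powr (real m + (s + real (j - i) - 1)))) sums ((\<lambda>f t. vector_derivative f (at t)) ^^ i) F \<tau>"
      if "0 < \<tau>" "\<tau> < 1 / \<rho>" for \<tau> using Suc.IH[of \<tau>] Suc.prems that by simp
    from powr_series_has_vector_derivative[OF IH Suc.prems(2,3)] obtain D' where D':
      "(((\<lambda>f t. vector_derivative f (at t)) ^^ i) F has_vector_derivative D') (at t)"
      "(\<lambda>m. a i m * complex_of_real ((real m + (s + real (j - i) - 1)) * t powr (real m + (s + real (j - i) - 1) - 1))) sums D'" by blast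
    have ji: "real (j - i) - 1 = real (j - Suc i)" using Suc.prems by (simp add: of_nat_diff)
    have "a i m * complex_of_real ((real m + (s + real (j - i) - 1)) * t powr (real m + (s + real (j - i) - 1) - 1)) =
        a (Suc i) m * complex_of_real (t powr (real m + (s + real (j - Suc i) - 1)))" for m
    proof -
      define z where "z = s + real m + real (j - Suc i)"
      have z: "z > 0" using s by (simp add: z_def add_pos_nonneg)
      have e: "real m + (s + real (j - i) - 1) = z" "s + real m + real (j - i) = z + 1" "real m + (s + real (j - Suc i) - 1) = z - 1"
        using ji by (auto simp: z_def)
      have "z \<notin> \<int>\<^sub>\<le>\<^sub>0" using z by (auto elim!: nonpos_Ints_cases)
      then have Gz: "Gamma (z + 1) = z * Gamma z" by (rule Gamma_plus1)
      show ?thesis unfolding a_def e z_def[symmetric] Gz using z Gamma_real_pos[OF z] by simp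
    qed
    with D'(2) have "(\<lambda>m. a (Suc i) m * complex_of_real (t powr (real m + (s + real (j - Suc i) - 1)))) sums D'" by (simp only:)
    moreover have "((\<lambda>f t. vector_derivative f (at t)) ^^ Suc i) F t = D'"
      using vector_derivative_at[OF D'(1)] by simp
    ultimately show ?case by (simp only:)
  qed
  from this[of j 1] \<rho> show ?thesis
    unfolding rl_deriv_def F_def[symmetric] a_def by simp
qed

section \<open>The kernel formula\<close>

text \<open>The denominator of the Poisson kernel factors into \<open>(1 - wz\<^sub>1)(1 - wz\<^sub>2)\<close> with both factors in the right half-plane,
  which lets the principal power be taken factor by factor before the generating function is applied.\<close>

lemma poisson_kernel_expansion:
  fixes a b :: "real^'n::finite" and \<psi> \<phi> t :: real
  assumes t: "0 < t" "t * (norm b * norm a) < 1"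
  shows "(\<lambda>m. (cis (\<psi> - \<phi>) ^ m * pzonal (of_nat CARD('n) / 2) p m (lin b a) (nsq b * nsq a)) * complex_of_real t ^ m)
     sums poisson_kernel p (t *\<^sub>R rot \<psi> a) (rot \<phi> b)"
proof -
  let ?l = "of_nat CARD('n) / 2 :: complex"
  obtain z1 z2 where z: "2 * lin b a = z1 + z2" "nsq b * nsq a = z1 * z2" "norm z1 = norm b * norm a" "norm z2 = norm b * norm a"
    using real_vector_roots[of b a] by blast
  define w where "w = complex_of_real t * cis (\<psi> - \<phi>)"
  define u v where "u = w * lin b a" and "v = w\<^sup>2 * (nsq b * nsq a)"
  have nw: "norm w = t" using t by (simp add: w_def norm_mult)
  have zw: "2 * u = w * z1 + w * z2" "v = (w * z1) * (w * z2)"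
    using z(1,2) by (simp_all add: u_def v_def power2_eq_square algebra_simps)
  have nz: "norm (w * z1) < 1" "norm (w * z2) < 1" using t z(3,4) by (simp_all add: norm_mult nw)
  have scl: "t *\<^sub>R rot \<psi> a = rot \<psi> (t *\<^sub>R a)" by (simp add: rot_def vec_eq_iff) (simp add: scaleR_conv_of_real[where ?'a = complex] mult_ac)
  have lt: "lin b (t *\<^sub>R a) = complex_of_real t * lin b a" by (simp add: lin_def)
  have nt: "nsq (t *\<^sub>R a) = (complex_of_real t)\<^sup>2 * nsq a" by (simp add: nsq_def power_mult_distrib)
  have cu: "cdot (t *\<^sub>R rot \<psi> a) (cnj_vec (rot \<phi> b)) = u" unfolding scl cdot_rot(1) lt u_def w_def by simp
  have cv: "cdot (t *\<^sub>R rot \<psi> a) (t *\<^sub>R rot \<psi> a) * cdot (cnj_vec (rot \<phi> b)) (cnj_vec (rot \<phi> b)) = v"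
    unfolding scl cdot_rot(2) nt v_def w_def by (simp add: power_mult_distrib mult_ac)
  have re: "Re (1 - w * z1) > 0" "Re (1 - w * z2) > 0"
    using nz complex_Re_le_cmod[of "w * z1"] complex_Re_le_cmod[of "w * z2"] unfolding minus_complex.sel one_complex.sel by linarith+
  have "poisson_kernel p (t *\<^sub>R rot \<psi> a) (rot \<phi> b) = (1 - v ^ p) / (1 - 2 * u + v) powr ?l"
    unfolding poisson_kernel_def power_mult_distrib[symmetric] cu cv ..
  also have "1 - 2 * u + v = (1 - w * z1) * (1 - w * z2)" unfolding zw by (simp add: algebra_simps)
  also have "(1 - v ^ p) / ((1 - w * z1) * (1 - w * z2)) powr ?l = (1 - v ^ p) * ((1 - w * z1) powr (- ?l) * (1 - w * z2) powr (- ?l))"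
    unfolding powr_mult_Re_pos[OF re] powr_minus divide_inverse inverse_mult_distrib ..
  finally have pk: "poisson_kernel p (t *\<^sub>R rot \<psi> a) (rot \<phi> b) = (1 - v ^ p) * ((1 - w * z1) powr (- ?l) * (1 - w * z2) powr (- ?l))" .
  have "(\<lambda>m. pzonal ?l p m u v) sums poisson_kernel p (t *\<^sub>R rot \<psi> a) (rot \<phi> b)"
    unfolding pk by (rule pzonal_generating[OF zw nz])
  moreover have "pzonal ?l p m u v = (cis (\<psi> - \<phi>) ^ m * pzonal ?l p m (lin b a) (nsq b * nsq a)) * complex_of_real t ^ m" for m
    unfolding u_def v_def pzonal_scale w_def by (simp add: power_mult_distrib mult_ac)
  ultimately show ?thesis by (simp only:)
qed

lemma kernel_weight_Gamma:
  assumes "n > 0" "real n + \<alpha> > 0" "\<beta> > -1"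
  shows "kernel_weight n \<alpha> \<beta> m = 2 / (real n * Gamma (\<beta> + 1) * unit_ball_vol (real n)) *
     (Gamma ((real n + \<alpha>) / 2 + real m + \<beta> + 1) / Gamma ((real n + \<alpha>) / 2 + real m))"
proof -
  have "(real n + \<alpha>) / 2 + real m > 0" using assms by (intro add_pos_nonneg) auto
  then have "Gamma ((real n + \<alpha>) / 2 + real m) > 0" "Gamma ((real n + \<alpha>) / 2 + real m + \<beta> + 1) > 0" "Gamma (\<beta> + 1) > 0"
    using assms(3) by (intro Gamma_real_pos; linarith)+
  then show ?thesis using assms(1) unfolding kernel_weight_def Beta_def by (simp add: add.assoc field_simps)
qed

theorem theorem5:
  fixes p j :: nat and \<alpha> \<beta> :: real
    and R :: "complex^'n::finite \<Rightarrow> complex^'n \<Rightarrow> complex"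
    and x y :: "complex^'n"
  assumes "p > 0"
    and "real CARD('n) + \<alpha> > 0"
    and "\<beta> > -1"
    and "is_bergman_kernel p \<alpha> \<beta> R"
    and "x \<in> rotated_balls p"
    and "y \<in> rotated_balls p"
    and "real j - 1 \<le> \<beta> + 1" and "\<beta> + 1 \<le> real j"
  shows "cnj (R x y) =
    complex_of_real (2 / (real CARD('n) * Gamma (\<beta> + 1) * unit_ball_vol (real CARD('n)))) *
    rl_deriv j (\<beta> + 1)
      (\<lambda>t. complex_of_real (t powr ((real CARD('n) + \<alpha>) / 2 + \<beta>)) * poisson_kernel p (t *\<^sub>R x) y) 1"
proof -
  let ?n = "CARD('n)"
  obtain k0 a where a: "k0 < p" "x = rot (real k0 * pi / real p) a" "norm a < 1"
    using assms(5) unfolding rotated_balls_def by auto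
  obtain k1 b where b: "k1 < p" "y = rot (real k1 * pi / real p) b" "norm b < 1"
    using assms(6) unfolding rotated_balls_def by auto
  define \<psi> \<phi> where "\<psi> = real k0 * pi / real p" and "\<phi> = real k1 * pi / real p"
  have x: "x = rot \<psi> a" and y: "y = rot \<phi> b" using a b by (simp_all add: \<psi>_def \<phi>_def)
  have Rx: "R x \<in> bergman_space p \<alpha> \<beta>" and rep: "\<And>U. U \<in> bergman_space p \<alpha> \<beta> \<Longrightarrow> U x = bergman_inner p \<alpha> \<beta> U (R x)"
    using assms(4,5) unfolding is_bergman_kernel_def by blast+
  obtain u where u: "polyharmonic_on_ball p u" "extends_to_rotated_balls p u (R x)"
    and sq: "\<And>k. k < p \<Longrightarrow> set_integrable lborel (ball 0 1) (\<lambda>z. (cmod (R x (rot (real k * pi / real p) z)))\<^sup>2 * bergman_weight \<alpha> \<beta> z)"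
    using Rx unfolding bergman_space_def by blast
  obtain q where q: "\<forall>m. homogeneous_polynomial m (q m)" "\<forall>x\<in>ball 0 1. (\<lambda>m. q m x) sums u x"
    and ext: "\<forall>\<psi>. \<forall>z\<in>ball 0 1. rot \<psi> z \<in> rotated_balls p \<longrightarrow> (\<lambda>m. cis (real m * \<psi>) * q m z) sums R x (rot \<psi> z)"
    using u(2) unfolding extends_to_rotated_balls_def by blast
  have an: "real_analytic_on u (ball 0 1)" and lapu: "\<And>x. x \<in> ball 0 1 \<Longrightarrow> (laplacian ^^ p) u x = 0"
    using u(1) unfolding polyharmonic_on_ball_def by auto
  have hom: "homogeneous_expansion u q"
    by unfold_locales (use an q in auto)
  have lap: "(laplacian ^^ p) (q m) = (\<lambda>x. 0)" for m
    by (rule homogeneous_part_polyharmonic[OF an lapu]) (use q in auto)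
  have ext': "(\<lambda>m. cis (real m * (real k * pi / real p)) * q m z) sums R x (rot (real k * pi / real p) z)"
    if "k < p" "z \<in> ball 0 1" for k z
  proof -
    have "rot (real k * pi / real p) z \<in> rotated_balls p" unfolding rotated_balls_def using that by (intro UN_I[of k] imageI) auto
    then show ?thesis using ext that(2) by blast
  qed
  define K where "K m = kernel_part p \<alpha> \<beta> m y x" for m
  \<comment> \<open>The reproducing property applied to \<open>kernel_part\<close>, and conversely \<open>kernel_part\<close> paired with \<open>R x\<close>.\<close>
  have Keq: "K m = cnj (cis (real m * \<phi>) * q m b)" for m
  proof -
    have "K m = bergman_inner p \<alpha> \<beta> (kernel_part p \<alpha> \<beta> m y) (R x)"
      unfolding K_def y by (rule rep[OF kernel_part_in_space[OF assms(2,3)]])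
    also have "\<dots> = cnj (bergman_inner p \<alpha> \<beta> (R x) (kernel_part p \<alpha> \<beta> m y))"
    proof -
      have "cnj (LINT z:ball 0 1|lborel. f z) = (LINT z:ball 0 1|lborel. cnj (f z))" for f :: "real^'n \<Rightarrow> complex"
        unfolding set_lebesgue_integral_def by (simp add: Bochner_Integration.integral_cnj[symmetric])
      then show ?thesis unfolding bergman_inner_def by (simp add: mult_ac)
    qed
    also have "bergman_inner p \<alpha> \<beta> (R x) (kernel_part p \<alpha> \<beta> m y) = cis (real m * \<phi>) * q m b"
      unfolding y by (rule bergman_inner_kernel[OF assms(1-3) hom lap ext' sq])
    finally show ?thesis .
  qed
  have "(\<lambda>m. cis (real m * \<phi>) * q m b) sums R x y"
    unfolding y \<phi>_def by (rule ext'[OF b(1)]) (use b in simp)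
  then have R_sums: "K sums cnj (R x y)"
    unfolding Keq[abs_def] by (simp only: sums_cnj)
  define W where "W m = cis (\<psi> - \<phi>) ^ m * pzonal (of_nat ?n / 2) p m (lin b a) (nsq b * nsq a)" for m
  define r where "r = norm b * norm a"
  have r: "0 \<le> r" "r < 1"
  proof -
    have "norm b * norm a \<le> norm b * 1" using a by (intro mult_left_mono) auto
    then show "0 \<le> r" "r < 1" using b by (auto simp: r_def)
  qed
  \<comment> \<open>The bound on the zonal polynomials costs a factor \<open>\<theta>\<^sup>-\<^sup>m\<close>; with \<open>r < \<theta>\<close> the ratio
    \<open>r / \<theta>\<close> stays below \<open>1\<close>, and averaging it with \<open>1\<close> gives a \<open>\<rho>\<close> that is positive
    also if \<open>r = 0\<close>.\<close>
  define \<theta> where "\<theta> = (r + 1) / 2"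
  have \<theta>: "0 < \<theta>" "\<theta> < 1" "r < \<theta>" using r by (auto simp: \<theta>_def)
  define \<rho> where "\<rho> = (r / \<theta> + 1) / 2"
  have rt: "0 \<le> r / \<theta>" "r / \<theta> < 1" "r \<le> r / \<theta>" using r \<theta> mult_left_le_one_le[of r \<theta>] by (auto simp: field_simps)
  have \<rho>: "0 < \<rho>" "\<rho> < 1" "r / \<theta> \<le> \<rho>"
  proof -
    have "0 < (c + 1) / 2 \<and> (c + 1) / 2 < 1 \<and> c \<le> (c + 1) / 2" if "0 \<le> c" "c < 1" for c :: real using that by simp
    from this[OF rt(1,2)] show "0 < \<rho>" "\<rho> < 1" "r / \<theta> \<le> \<rho>" by (simp_all only: \<rho>_def)
  qed
  obtain C where C: "C \<ge> 0" "\<forall>m (b::real^'n) x. norm (pzonal (of_nat ?n / 2) p m (lin b x) (nsq b * nsq x)) \<le> C * (norm b * norm x / \<theta>) ^ m"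
    using pzonal_real_bound[OF \<theta>(1,2)] by blast
  have Wb: "norm (W m) \<le> C * \<rho> ^ m" for m
  proof -
    have "norm (W m) \<le> C * (r / \<theta>) ^ m" using C(2) by (simp add: W_def norm_mult norm_power r_def)
    also have "\<dots> \<le> C * \<rho> ^ m" using C(1) rt \<rho> by (intro mult_left_mono power_mono) auto
    finally show ?thesis .
  qed
  have G: "(\<lambda>m. W m * complex_of_real t ^ m) sums poisson_kernel p (t *\<^sub>R x) y" if "0 < t" "t * \<rho> < 1" for t
    unfolding W_def x y
  proof (rule poisson_kernel_expansion[OF that(1)])
    have "r \<le> \<rho>" using rt \<rho> by linarith
    then have "t * r \<le> t * \<rho>" using that by (intro mult_left_mono) auto
    then show "t * (norm b * norm a) < 1" using that(2) unfolding r_def by linarith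
  qed
  let ?s = "(real ?n + \<alpha>) / 2"
  let ?c = "2 / (real ?n * Gamma (\<beta> + 1) * unit_ball_vol (real ?n))"
  have "(\<lambda>m. complex_of_real ?c * (W m * complex_of_real (Gamma (?s + real m + \<beta> + 1) / Gamma (?s + real m)))) sums
     (complex_of_real ?c * rl_deriv j (\<beta> + 1) (\<lambda>t. complex_of_real (t powr (?s + \<beta>)) * poisson_kernel p (t *\<^sub>R x) y) 1)"
    by (intro sums_mult rl_deriv_power_series[OF \<rho>(1,2) C(1) Wb G _ assms(3,8)]) (use assms(2) in auto)
  moreover have "complex_of_real ?c * (W m * complex_of_real (Gamma (?s + real m + \<beta> + 1) / Gamma (?s + real m))) = K m" for m
  proof -
    have kw: "complex_of_real (kernel_weight ?n \<alpha> \<beta> m) = complex_of_real ?c * complex_of_real (Gamma (?s + real m + \<beta> + 1) / Gamma (?s + real m))"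
      unfolding of_real_mult[symmetric] by (subst kernel_weight_Gamma[OF _ assms(2,3)]) simp_all
    have "cis (real m * (\<psi> - \<phi>)) = cis (\<psi> - \<phi>) ^ m" by (simp only: Complex.DeMoivre)
    then have "K m = complex_of_real (kernel_weight ?n \<alpha> \<beta> m) * W m"
      unfolding K_def x y kernel_part_rot W_def by (simp only: mult.assoc)
    then show ?thesis unfolding kw by (simp only: mult_ac)
  qed
  ultimately have "K sums (complex_of_real ?c * rl_deriv j (\<beta> + 1) (\<lambda>t. complex_of_real (t powr (?s + \<beta>)) * poisson_kernel p (t *\<^sub>R x) y) 1)"
    by (simp only:)
  then show ?thesis using R_sums sums_unique2 by blast
qed

end
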